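(* Let $\lambda$ be a partition, let $N^+(\lambda')$ be the set of non-attacking and top-row increasing positive fillings of $\mathsf{dg}'(\lambda)$, and let $\eta\in\mathcal A^+$. There is a bijection $\varphi:N^+(\lambda')\to N^+(\lambda')$ such that for all $\sigma\in N^+(\lambda')$: $\varphi(\sigma)$ is row-equivalent to $\sigma$, $$(\mathsf{maj},\eta^\circ)(\varphi(\sigma))=(\mathsf{maj},\overline{\mathsf{quadcoinv}}^{\star})(\sigma),\qquad c_\sigma(q,t)=c_{\varphi(\sigma)}(q,t),$$ the top rows of $\varphi(\sigma)$ and $\sigma$ are identical, and the number of restricted (and of unrestricted) boxes in each row is the same for $\sigma$ and $\varphi(\sigma)$.
   Context: $\mathsf{dg}'(\lambda)$ has boxes $(i,j)$, $1\le j\le\ell(\lambda)$, $1\le i\le\lambda_j$ (row $i$ from the bottom; column $j$ has height $\lambda_j$). $\mathsf{South}(u)$ is the box directly below $u$; $\mathsf{leg}(u)$ the number of boxes strictly above $u$ in its column. A rectangle is a maximal set of consecutive columns of equal height; its top row is the row whose index equals that height. $n(\lambda)=\sum_i(i-1)\lambda_i$. Two fillings are row-equivalent if each row has the same multiset of entries; the top row of a filling means the top rows of all its rectangles. For a positive filling $\sigma$, $\hat\sigma$ adds entry $0$ at $(\lambda_j+1,j)$ and $\infty$ at $(0,j)$ in each column $j$; values ordered naturally. $I(a,b)=1$ if $a>b$, else $0$; $\mathcal Q(a,b,c)=1$ iff exactly one of $I(a,b)=1$, $I(c,b)=0$, $I(a,c)=0$. $\mathsf{maj}(\sigma)=\sum(\mathsf{leg}(z)+1)$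 over $z$ not in row 1 with $\sigma(z)>\sigma(\mathsf{South}(z))$. Queue inversion triple: $(a,b,c)$ with $a$ at $(r+1,j)$, $b$ at $(r,j)$, $c$ at $(r,k)$ of $\hat\sigma$, $k>j$, $c\ne0$, $\mathcal Q(a,b,c)=1$. A quadruple position: $z$ at $(r+1,j)$, $w$ at $(r+1,k)$, $u$ at $(r,j)$, $v$ at $(r,k)$ of $\hat\sigma$ with $j<k$, $\lambda_j=\lambda_k$, $0\le r\le\lambda_j$. $\mathcal Q(z,w,u,v)=1$ if $w=v$ and $z,u,w$ pairwise distinct; $=0$ if $w=u$, $z\ne w$, $v\ne w$; otherwise $=\mathcal Q(z,u,v)$. $\mathsf{quadcoinv}(\sigma)$ = number of quadruple positions with $\mathcal Q(z,w,u,v)=1$ plus number of queue inversion triples whose column of $a,b$ is strictly taller than that of $c$; $\overline{\mathsf{quadcoinv}}=n(\lambda)-\mathsf{quadcoinv}$. Let $w(\sigma)$ be the word formed by the top-row entries of all rectangles read from left to right, $\mathsf{inv}(w)$ its number of inversions (pairs of positions $p<p'$ with $w_p>w_{p'}$), and $\overline{\mathsf{quadcoinv}}^{\star}(\sigma)=\overline{\mathsf{quadcoinv}}(\sigma)-\mathsf{inv}(w(\sigma))$. The statistics $\eta$: let $\mathcal S^*$ be the orderings $(z=w>v>u)$, $(u\ge z=w>v)$, $(v>u\ge z=w)$; $X_1: z>w>v>u$; $X_2: z>w>u>v$; $Y_1: u>v\ge z>w$; $Y_2: v>u\ge z>w$; $Z_1$: $\{z>u>v\ge w,\ v\ge z>w>u\}$;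 $Z_2$: $\{z>v>u\ge w,\ u\ge z>w>v\}$. $\mathcal S_1,\dots,\mathcal S_8$ consist of $\mathcal S^*$, the orderings $z>v\ge w>u$ and $u\ge z>v\ge w$, and respectively $(X_1,Y_1,Z_1)$, $(X_1,Y_2,Z_1)$, $(X_2,Y_1,Z_1)$, $(X_2,Y_2,Z_1)$, $(X_1,Y_1,Z_2)$, $(X_2,Y_1,Z_2)$, $(X_1,Y_2,Z_2)$, $(X_2,Y_2,Z_2)$. $\mathcal Q_{\mathcal S}(z,w,u,v)=1$ if $(z,w,u,v)$ satisfies an ordering of $\mathcal S^*$, or one of the other orderings of $\mathcal S$, or $(w,z,v,u)$ substituted for $(z,w,u,v)$ satisfies one of the other orderings of $\mathcal S$; else $0$. $\eta_{\mathcal S}(\sigma)$ = number of quadruple positions with $\mathcal Q_{\mathcal S}=1$ plus number of queue inversion triples whose column of $a,b$ is strictly taller than that of $c$; $\mathcal A^+=\{\eta_{\mathcal S_1},\dots,\eta_{\mathcal S_8}\}$. $\alpha(\sigma)$ = number of quadruple positions with $r\ge1$, $\mathcal Q_{\mathcal S}=0$, and $z,w,u,v$ not pairwise distinct; $\eta^\circ=n(\lambda)-\eta-\alpha$. Non-attacking: no distinct boxes $u,v$ with $\sigma(u)=\sigma(v)$ such that (I) same row; (II) $u=(i+1,j)$, $v=(i,k)$, $k>j$; (III) $u=(i,j)$, $v=(i-1,k)$, $k<j$, $\lambda_j=\lambda_k$. Top-row increasing: the top-row entries of each rectangle weakly increase left to right. A box is restricted if not in row 1 and $\sigma(u)=\sigma(\mathsf{South}(u))$,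 unrestricted otherwise. For $u=(i,j)$, $\overline{\mathsf{arm}}(u)=|\{(i-1,k):k>j,\ \lambda_k<\lambda_j\}|+|\{(i,k):k<j,\ \lambda_k=\lambda_j,\ (i,k)\text{ unrestricted}\}|$; $c_\sigma(q,t)=\prod\frac{1-t}{1-q^{\mathsf{leg}(u)+1}t^{\overline{\mathsf{arm}}(u)+1}}$ over $u$ not in row 1 with $\sigma(u)\ne\sigma(\mathsf{South}(u))$.
   Formalization: Inversions of the top-row word are counted within each rectangle separately, not across different rectangles; with inversions of the single concatenated word the claim is false, e.g. λ=(2,1) with entries 3 at (1,1), 2 at (2,1), 1 at (1,2). *)

theory Defs
  imports
    Complex_Main
    "HOL-Library.FuncSet"
    "HOL-Library.Multiset"
    "HOL-Library.Extended_Nat"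
    "HOL-Computational_Algebra.Polynomial"
    "HOL-Computational_Algebra.Fraction_Field"
begin

type_synonym box = "nat \<times> nat"
type_synonym filling = "box \<Rightarrow> nat"

text \<open>A partition is the weakly decreasing list of its positive parts.  Rows, columns and parts
  are numbered from 1, and a box is written (row, column), with rows counted from the bottom.\<close>

definition is_partition :: "nat list \<Rightarrow> bool" where
  "is_partition lam \<longleftrightarrow> sorted_wrt (\<ge>) lam \<and> (\<forall>x\<in>set lam. 0 < x)"

definition height :: "nat list \<Rightarrow> nat \<Rightarrow> nat" where
  "height lam j = lam ! (j - 1)"

definition n_stat :: "nat list \<Rightarrow> nat" where
  "n_stat lam = (\<Sum>i = 1..length lam. (i - 1) * height lam i)"

definition dg :: "nat list \<Rightarrow> box set" where
  "dg lam = {(i, j). 1 \<le> j \<and> j \<le> length lam \<and> 1 \<le> i \<and> i \<le> height lam j}"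

definition South :: "box \<Rightarrow> box" where
  "South u = (fst u - 1, snd u)"

definition leg :: "nat list \<Rightarrow> box \<Rightarrow> nat" where
  "leg lam u = card {i. (i, snd u) \<in> dg lam \<and> fst u < i}"

text \<open>A rectangle is represented by its set of columns; a run is a nonempty set of consecutive
  columns of equal height.\<close>

definition equal_height_run :: "nat list \<Rightarrow> nat set \<Rightarrow> bool" where
  "equal_height_run lam C \<longleftrightarrow>
     C \<noteq> {} \<and> C \<subseteq> {1..length lam} \<and> (\<exists>a b. C = {a..b}) \<and>
     (\<forall>j\<in>C. \<forall>k\<in>C. height lam j = height lam k)"

definition rectangles :: "nat list \<Rightarrow> nat set set" where
  "rectangles lam =
     {C. equal_height_run lam C \<and> (\<forall>D. equal_height_run lam D \<and> C \<subseteq> D \<longrightarrow> D = C)}"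

text \<open>The box of column \<open>j\<close> in the top row of its rectangle.\<close>

definition top_box :: "nat list \<Rightarrow> nat \<Rightarrow> box" where
  "top_box lam j = (height lam j, j)"

text \<open>Fillings are extensional (\<open>undefined\<close> outside the diagram), so that distinct functions
  are distinct fillings.\<close>

definition positive_fillings :: "nat list \<Rightarrow> filling set" where
  "positive_fillings lam = dg lam \<rightarrow>\<^sub>E {0<..}"

definition row_content :: "nat list \<Rightarrow> filling \<Rightarrow> nat \<Rightarrow> nat multiset" where
  "row_content lam \<sigma> i = image_mset \<sigma> (mset_set {u \<in> dg lam. fst u = i})"

definition row_equivalent :: "nat list \<Rightarrow> filling \<Rightarrow> filling \<Rightarrow> bool" where
  "row_equivalent lam \<sigma> \<tau> \<longleftrightarrow> (\<forall>i. row_content lam \<sigma> i = row_content lam \<tau> i)"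

definition same_top_rows :: "nat list \<Rightarrow> filling \<Rightarrow> filling \<Rightarrow> bool" where
  "same_top_rows lam \<sigma> \<tau> \<longleftrightarrow>
     (\<forall>C\<in>rectangles lam. \<forall>j\<in>C. \<sigma> (top_box lam j) = \<tau> (top_box lam j))"

definition top_row_increasing :: "nat list \<Rightarrow> filling \<Rightarrow> bool" where
  "top_row_increasing lam \<sigma> \<longleftrightarrow>
     (\<forall>C\<in>rectangles lam. \<forall>j\<in>C. \<forall>k\<in>C. j < k \<longrightarrow> \<sigma> (top_box lam j) \<le> \<sigma> (top_box lam k))"

definition attacking :: "nat list \<Rightarrow> box \<Rightarrow> box \<Rightarrow> bool" where
  "attacking lam u v \<longleftrightarrow>
     fst u = fst v
     \<or> (fst u = fst v + 1 \<and> snd v > snd u)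
     \<or> (fst u = fst v + 1 \<and> snd v < snd u \<and> height lam (snd u) = height lam (snd v))"

definition non_attacking :: "nat list \<Rightarrow> filling \<Rightarrow> bool" where
  "non_attacking lam \<sigma> \<longleftrightarrow>
     \<not> (\<exists>u\<in>dg lam. \<exists>v\<in>dg lam. u \<noteq> v \<and> \<sigma> u = \<sigma> v \<and> attacking lam u v)"

definition N_plus :: "nat list \<Rightarrow> filling set" where
  "N_plus lam = {\<sigma> \<in> positive_fillings lam. non_attacking lam \<sigma> \<and> top_row_increasing lam \<sigma>}"

definition hat_dg :: "nat list \<Rightarrow> box set" where
  "hat_dg lam = {(i, j). 1 \<le> j \<and> j \<le> length lam \<and> i \<le> height lam j + 1}"

text \<open>The augmented filling; meaningful on \<open>hat_dg lam\<close> only.\<close>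

definition hat :: "nat list \<Rightarrow> filling \<Rightarrow> box \<Rightarrow> enat" where
  "hat lam \<sigma> u =
     (if fst u = 0 then \<infinity> else if fst u = height lam (snd u) + 1 then 0 else enat (\<sigma> u))"

definition I_ind :: "enat \<Rightarrow> enat \<Rightarrow> nat" where
  "I_ind a b = (if a > b then 1 else 0)"

definition Q3 :: "enat \<Rightarrow> enat \<Rightarrow> enat \<Rightarrow> nat" where
  "Q3 a b c =
     (if of_bool (I_ind a b = 1) + of_bool (I_ind c b = 0) + of_bool (I_ind a c = 0) = (1::nat)
      then 1 else 0)"

definition Q4 :: "enat \<Rightarrow> enat \<Rightarrow> enat \<Rightarrow> enat \<Rightarrow> nat" where
  "Q4 z w u v =
     (if w = v \<and> z \<noteq> u \<and> u \<noteq> w \<and> z \<noteq> w then 1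
      else if w = u \<and> z \<noteq> w \<and> v \<noteq> w then 0
      else Q3 z u v)"

definition maj :: "nat list \<Rightarrow> filling \<Rightarrow> nat" where
  "maj lam \<sigma> = (\<Sum>z | z \<in> dg lam \<and> fst z \<noteq> 1 \<and> \<sigma> z > \<sigma> (South z). leg lam z + 1)"

text \<open>The triple \<open>(r, j, k)\<close> stands for the three boxes \<open>(r+1, j)\<close>, \<open>(r, j)\<close>, \<open>(r, k)\<close>.\<close>

definition queue_inversion_triples :: "nat list \<Rightarrow> filling \<Rightarrow> (nat \<times> nat \<times> nat) set" where
  "queue_inversion_triples lam \<sigma> =
     {(r, j, k). (r + 1, j) \<in> hat_dg lam \<and> (r, j) \<in> hat_dg lam \<and> (r, k) \<in> hat_dg lam \<and>
        k > j \<and> hat lam \<sigma> (r, k) \<noteq> 0 \<and>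
        Q3 (hat lam \<sigma> (r + 1, j)) (hat lam \<sigma> (r, j)) (hat lam \<sigma> (r, k)) = 1}"

definition taller_triples :: "nat list \<Rightarrow> filling \<Rightarrow> nat" where
  "taller_triples lam \<sigma> =
     card {(r, j, k). (r, j, k) \<in> queue_inversion_triples lam \<sigma> \<and> height lam j > height lam k}"

text \<open>The triple \<open>(r, j, k)\<close> stands for the quadruple position with \<open>z\<close>, \<open>w\<close> at
  \<open>(r+1, j)\<close>, \<open>(r+1, k)\<close> and \<open>u\<close>, \<open>v\<close> at \<open>(r, j)\<close>, \<open>(r, k)\<close>.\<close>

definition quad_positions :: "nat list \<Rightarrow> (nat \<times> nat \<times> nat) set" where
  "quad_positions lam =
     {(r, j, k). 1 \<le> j \<and> j < k \<and> k \<le> length lam \<and> height lam j = height lam k \<and>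
        r \<le> height lam j}"

definition at_quad :: "(enat \<Rightarrow> enat \<Rightarrow> enat \<Rightarrow> enat \<Rightarrow> 'a) \<Rightarrow> nat list \<Rightarrow> filling \<Rightarrow>
    nat \<times> nat \<times> nat \<Rightarrow> 'a" where
  "at_quad F lam \<sigma> = (\<lambda>(r, j, k).
     F (hat lam \<sigma> (r + 1, j)) (hat lam \<sigma> (r + 1, k)) (hat lam \<sigma> (r, j)) (hat lam \<sigma> (r, k)))"

definition quadcoinv :: "nat list \<Rightarrow> filling \<Rightarrow> nat" where
  "quadcoinv lam \<sigma> =
     card {p \<in> quad_positions lam. at_quad Q4 lam \<sigma> p = 1} + taller_triples lam \<sigma>"

definition quadcoinv_bar :: "nat list \<Rightarrow> filling \<Rightarrow> int" where
  "quadcoinv_bar lam \<sigma> = int (n_stat lam) - int (quadcoinv lam \<sigma>)"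

definition word_inv :: "nat list \<Rightarrow> nat" where
  "word_inv w = card {(p, p'). p < p' \<and> p' < length w \<and> w ! p > w ! p'}"

definition top_word :: "nat list \<Rightarrow> filling \<Rightarrow> nat set \<Rightarrow> nat list" where
  "top_word lam \<sigma> C = map (\<lambda>j. \<sigma> (top_box lam j)) (sorted_list_of_set C)"

text \<open>Inversions of the top-row words are counted rectangle by rectangle: there are none between
  entries in the top rows of different rectangles.  Counting inversions of the concatenation of
  these words instead would break the identity for eta below.  Already for \<open>lam = [2, 1]\<close> a
  filling in \<open>N_plus lam\<close> is determined by its row contents and top rows, so the bijection is
  forced to be the identity; there quadcoinv equals eta and alpha is 0, whereas the filling with
  entries 3 at (1,1), 2 at (2,1), 1 at (1,2) would have one inversion.\<close>

definition top_inv :: "nat list \<Rightarrow> filling \<Rightarrow> nat" where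
  "top_inv lam \<sigma> = (\<Sum>C\<in>rectangles lam. word_inv (top_word lam \<sigma> C))"

definition quadcoinv_bar_star :: "nat list \<Rightarrow> filling \<Rightarrow> int" where
  "quadcoinv_bar_star lam \<sigma> = quadcoinv_bar lam \<sigma> - int (top_inv lam \<sigma>)"

text \<open>Orderings of four values, always with arguments in the order \<open>z w u v\<close>.\<close>

type_synonym ordering = "enat \<Rightarrow> enat \<Rightarrow> enat \<Rightarrow> enat \<Rightarrow> bool"

definition S_star :: "ordering set" where
  "S_star =
     {\<lambda>z w u v. z = w \<and> w > v \<and> v > u,
      \<lambda>z w u v. u \<ge> z \<and> z = w \<and> w > v,
      \<lambda>z w u v. v > u \<and> u \<ge> z \<and> z = w}"

definition S_common :: "ordering set" where
  "S_common =
     {\<lambda>z w u v. z > v \<and> v \<ge> w \<and> w > u,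
      \<lambda>z w u v. u \<ge> z \<and> z > v \<and> v \<ge> w}"

definition X1 :: "ordering set" where "X1 = {\<lambda>z w u v. z > w \<and> w > v \<and> v > u}"
definition X2 :: "ordering set" where "X2 = {\<lambda>z w u v. z > w \<and> w > u \<and> u > v}"
definition Y1 :: "ordering set" where "Y1 = {\<lambda>z w u v. u > v \<and> v \<ge> z \<and> z > w}"
definition Y2 :: "ordering set" where "Y2 = {\<lambda>z w u v. v > u \<and> u \<ge> z \<and> z > w}"
definition Z1 :: "ordering set" where
  "Z1 = {\<lambda>z w u v. z > u \<and> u > v \<and> v \<ge> w, \<lambda>z w u v. v \<ge> z \<and> z > w \<and> w > u}"
definition Z2 :: "ordering set" where
  "Z2 = {\<lambda>z w u v. z > v \<and> v > u \<and> u \<ge> w, \<lambda>z w u v. u \<ge> z \<and> z > w \<and> w > v}"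

text \<open>The eight sets of orderings, each given without its common part \<open>S_star\<close>, which is
  treated separately in the definition of \<open>Q_S\<close>.\<close>

definition S_systems :: "ordering set set" where
  "S_systems =
     {S_common \<union> X1 \<union> Y1 \<union> Z1, S_common \<union> X1 \<union> Y2 \<union> Z1,
      S_common \<union> X2 \<union> Y1 \<union> Z1, S_common \<union> X2 \<union> Y2 \<union> Z1,
      S_common \<union> X1 \<union> Y1 \<union> Z2, S_common \<union> X2 \<union> Y1 \<union> Z2,
      S_common \<union> X1 \<union> Y2 \<union> Z2, S_common \<union> X2 \<union> Y2 \<union> Z2}"

definition Q_S :: "ordering set \<Rightarrow> enat \<Rightarrow> enat \<Rightarrow> enat \<Rightarrow> enat \<Rightarrow> nat" where
  "Q_S S z w u v =
     (if (\<exists>P\<in>S_star. P z w u v) \<or> (\<exists>P\<in>S. P z w u v) \<or> (\<exists>P\<in>S. P w z v u) then 1 else 0)"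

definition eta :: "ordering set \<Rightarrow> nat list \<Rightarrow> filling \<Rightarrow> nat" where
  "eta S lam \<sigma> =
     card {p \<in> quad_positions lam. at_quad (Q_S S) lam \<sigma> p = 1} + taller_triples lam \<sigma>"

definition alpha :: "ordering set \<Rightarrow> nat list \<Rightarrow> filling \<Rightarrow> nat" where
  "alpha S lam \<sigma> =
     card {p \<in> quad_positions lam. fst p \<ge> 1 \<and> at_quad (Q_S S) lam \<sigma> p = 0 \<and>
       at_quad (\<lambda>z w u v. \<not> distinct [z, w, u, v]) lam \<sigma> p}"

definition eta_circ :: "ordering set \<Rightarrow> nat list \<Rightarrow> filling \<Rightarrow> int" where
  "eta_circ S lam \<sigma> = int (n_stat lam) - int (eta S lam \<sigma>) - int (alpha S lam \<sigma>)"

definition restricted :: "filling \<Rightarrow> box \<Rightarrow> bool" where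
  "restricted \<sigma> u \<longleftrightarrow> fst u \<noteq> 1 \<and> \<sigma> u = \<sigma> (South u)"

definition restricted_in_row :: "nat list \<Rightarrow> filling \<Rightarrow> nat \<Rightarrow> nat" where
  "restricted_in_row lam \<sigma> i = card {u \<in> dg lam. fst u = i \<and> restricted \<sigma> u}"

definition unrestricted_in_row :: "nat list \<Rightarrow> filling \<Rightarrow> nat \<Rightarrow> nat" where
  "unrestricted_in_row lam \<sigma> i = card {u \<in> dg lam. fst u = i \<and> \<not> restricted \<sigma> u}"

definition arm_bar :: "nat list \<Rightarrow> filling \<Rightarrow> box \<Rightarrow> nat" where
  "arm_bar lam \<sigma> u =
     card {v \<in> dg lam. fst v = fst u - 1 \<and> snd v > snd u \<and>
             height lam (snd v) < height lam (snd u)}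
   + card {v \<in> dg lam. fst v = fst u \<and> snd v < snd u \<and>
             height lam (snd v) = height lam (snd u) \<and> \<not> restricted \<sigma> v}"

definition c_weight :: "nat list \<Rightarrow> filling \<Rightarrow> 'a::field \<Rightarrow> 'a \<Rightarrow> 'a" where
  "c_weight lam \<sigma> q t =
     (\<Prod>u | u \<in> dg lam \<and> fst u \<noteq> 1 \<and> \<sigma> u \<noteq> \<sigma> (South u).
        (1 - t) / (1 - q ^ (leg lam u + 1) * t ^ (arm_bar lam \<sigma> u + 1)))"

text \<open>The indeterminates of the field of rational functions in q and t over the rationals,
  realised as the fraction field of polynomials in t over polynomials in q.\<close>

definition q_var :: "rat poly poly fract" where "q_var = Fract [:[:0, 1:]:] 1"
definition t_var :: "rat poly poly fract" where "t_var = Fract [:0, 1:] 1"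

end

theory Submission
  imports Defs
begin

text \<open>In a non-attacking filling, two adjacent rows of a rectangle of width n are described by a
  matching f from the set A of upper entries to the set B of lower entries that fixes every
  element of both, together with an ordering of A.  If the sets of entries of all rectangle rows
  and the number of descents of every matching are prescribed, then \<open>maj\<close>, the triples between
  columns of different heights, the weight c and the restricted boxes are determined; and the top
  row is the increasing arrangement of its set.  So it suffices to match the two quadruple
  statistics.  On a quadruple with a repeated entry both contribute 1 (for eta this is what alpha
  compensates), and otherwise \<open>Q4\<close> asks whether v lies on the cyclic arc from u up to z.

  Exchanging two neighbouring upper entries x and y, together with exchanging f x and f y exactly
  when these two points do not separate x from y on the circle, shows that the joint distribution
  of descents and arc quadruples over all matchings does not depend on the ordering of A.  For the
  increasing and the decreasing ordering the arc statistic is the one belonging to (X2,Y1,Z1)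
  and to (X1,Y2,Z2), respectively.  The orderings X (Y) only concern pairs of descents (of
  ascents); toggling one of them amounts to passing between the increasing and the decreasing
  ordering for the matching restricted to the descents (ascents), and this does not affect mixed
  pairs because a mixed quadruple statistic is a function of x plus a function of f x.

  The bijection changes one matching at a time, from the bottom rows upwards, and moves the columns
  below rigidly: the new statistics depend on the matchings only, so what has already been
  converted stays converted.\<close>

section \<open>Pair statistics and equidistribution\<close>

text \<open>Given by a bijection of \<open>M\<close> onto itself rather than by equal fibre sizes,
  because the map between fillings is assembled from these bijections.\<close>

definition equidistributed :: "'a set \<Rightarrow> ('a \<Rightarrow> 'b) \<Rightarrow> ('a \<Rightarrow> 'b) \<Rightarrow> bool" where
  "equidistributed M s t \<longleftrightarrow> (\<exists>\<phi>. bij_betw \<phi> M M \<and> (\<forall>x\<in>M. t (\<phi> x) = s x))"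

lemma equidistributed_cong:
  assumes "\<And>x. x \<in> M \<Longrightarrow> s x = t x"
  shows "equidistributed M s t"
  unfolding equidistributed_def using assms by (intro exI[of _ id]) auto

lemma equidistributed_sym:
  assumes "equidistributed M s t"
  shows "equidistributed M t s"
proof -
  from assms obtain \<phi> where \<phi>: "bij_betw \<phi> M M" "\<And>x. x \<in> M \<Longrightarrow> t (\<phi> x) = s x"
    unfolding equidistributed_def by blast
  have "s (inv_into M \<phi> x) = t x" if "x \<in> M" for x
  proof -
    have "x \<in> \<phi> ` M" using \<phi>(1) that by (simp add: bij_betw_def)
    then show ?thesis
      using \<phi>(2)[OF inv_into_into[OF \<open>x \<in> \<phi> ` M\<close>]] by (simp add: f_inv_into_f)
  qed
  then show ?thesis
    unfolding equidistributed_def using bij_betw_inv_into[OF \<phi>(1)] by blast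
qed

lemma equidistributed_trans [trans]:
  assumes "equidistributed M s t" and "equidistributed M t u"
  shows "equidistributed M s u"
proof -
  from assms(1) obtain \<phi> where \<phi>: "bij_betw \<phi> M M" "\<And>x. x \<in> M \<Longrightarrow> t (\<phi> x) = s x"
    unfolding equidistributed_def by blast
  from assms(2) obtain \<psi> where \<psi>: "bij_betw \<psi> M M" "\<And>x. x \<in> M \<Longrightarrow> u (\<psi> x) = t x"
    unfolding equidistributed_def by blast
  have "\<phi> x \<in> M" if "x \<in> M" for x
    using that \<phi>(1) by (auto simp: bij_betw_def)
  then show ?thesis
    unfolding equidistributed_def using bij_betw_trans[OF \<phi>(1) \<psi>(1)] \<phi>(2) \<psi>(2)
    by (intro exI[of _ "\<psi> \<circ> \<phi>"]) simp
qed

lemma equidistributed_by_injection: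
  assumes "finite M" and "inj_on \<phi> M" and "\<phi> ` M \<subseteq> M" and "\<And>x. x \<in> M \<Longrightarrow> t (\<phi> x) = s x"
  shows "equidistributed M s t"
proof -
  have "bij_betw \<phi> M M"
    using endo_inj_surj[OF assms(1,3,2)] assms(2) by (simp add: bij_betw_def)
  then show ?thesis
    unfolding equidistributed_def using assms(4) by blast
qed

section \<open>Sums over pairs of entries of a list or a set\<close>

primrec pair_sum :: "('a \<Rightarrow> 'a \<Rightarrow> nat) \<Rightarrow> 'a list \<Rightarrow> nat" where
  "pair_sum g [] = 0"
| "pair_sum g (x # xs) = sum_list (map (g x) xs) + pair_sum g xs"

lemma pair_sum_append:
  "pair_sum g (xs @ ys) = pair_sum g xs + pair_sum g ys + (\<Sum>x\<leftarrow>xs. \<Sum>y\<leftarrow>ys. g x y)"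
  by (induction xs) auto

lemma pair_sum_map: "pair_sum g (map a xs) = pair_sum (\<lambda>i j. g (a i) (a j)) xs"
  by (induction xs) (auto simp: comp_def)

lemma pair_sum_cong:
  assumes "sorted_wrt P xs" and "\<And>x y. x \<in> set xs \<Longrightarrow> y \<in> set xs \<Longrightarrow> P x y \<Longrightarrow> g x y = h x y"
  shows "pair_sum g xs = pair_sum h xs"
  using assms
proof (induction xs)
  case (Cons x xs)
  then have "map (g x) xs = map (h x) xs" by (intro map_cong) auto
  moreover have "pair_sum g xs = pair_sum h xs" using Cons by (intro Cons.IH) auto
  ultimately show ?case by (simp only: pair_sum.simps)
qed simp

text \<open>For symmetric \<open>g\<close> this is twice the sum over unordered pairs. No
  arrangement of \<open>A\<close> enters, so it can be split over subsets and transported along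
  injections.\<close>

definition ordered_pair_sum :: "('a \<Rightarrow> 'a \<Rightarrow> nat) \<Rightarrow> 'a set \<Rightarrow> nat" where
  "ordered_pair_sum g A = (\<Sum>x\<in>A. \<Sum>y\<in>A - {x}. g x y)"

lemma ordered_pair_sum_cong:
  assumes "\<And>x y. x \<in> A \<Longrightarrow> y \<in> A \<Longrightarrow> x \<noteq> y \<Longrightarrow> g x y = h x y"
  shows "ordered_pair_sum g A = ordered_pair_sum h A"
  unfolding ordered_pair_sum_def using assms by (intro sum.cong) auto

lemma ordered_pair_sum_reindex:
  assumes "inj_on f A"
  shows "ordered_pair_sum g (f ` A) = ordered_pair_sum (\<lambda>x y. g (f x) (f y)) A"
proof -
  have "(\<Sum>y\<in>f ` A - {f x}. g (f x) y) = (\<Sum>y\<in>A - {x}. g (f x) (f y))" if "x \<in> A" for x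
  proof -
    have "f ` A - {f x} = f ` (A - {x})"
      using assms that by (auto simp: inj_on_def)
    then show ?thesis
      using assms by (simp add: sum.reindex inj_on_diff)
  qed
  then show ?thesis
    unfolding ordered_pair_sum_def using assms by (simp add: sum.reindex)
qed

lemma ordered_pair_sum_Un:
  assumes "finite A" "finite B" "A \<inter> B = {}"
    and "\<And>x y. x \<in> A \<Longrightarrow> y \<in> B \<Longrightarrow> g x y = g y x"
  shows "ordered_pair_sum g (A \<union> B) =
    ordered_pair_sum g A + ordered_pair_sum g B + 2 * (\<Sum>x\<in>A. \<Sum>y\<in>B. g x y)"
proof -
  have "(\<Sum>x\<in>A. \<Sum>y\<in>A \<union> B - {x}. g x y) = (\<Sum>x\<in>A. (\<Sum>y\<in>A - {x}. g x y) + (\<Sum>y\<in>B. g x y))"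
  proof (intro sum.cong refl)
    fix x assume "x \<in> A"
    then have "A \<union> B - {x} = (A - {x}) \<union> B" using assms(3) by blast
    then show "(\<Sum>y\<in>A \<union> B - {x}. g x y) = (\<Sum>y\<in>A - {x}. g x y) + (\<Sum>y\<in>B. g x y)"
      using assms(1-3) by (simp add: sum.union_disjoint Diff_Int_distrib2)
  qed
  moreover have "(\<Sum>x\<in>B. \<Sum>y\<in>A \<union> B - {x}. g x y) = (\<Sum>x\<in>B. (\<Sum>y\<in>B - {x}. g x y) + (\<Sum>y\<in>A. g x y))"
  proof (intro sum.cong refl)
    fix x assume "x \<in> B"
    then have "A \<union> B - {x} = (B - {x}) \<union> A" using assms(3) by blast
    moreover have "(B - {x}) \<inter> A = {}" using assms(3) by blast
    ultimately show "(\<Sum>y\<in>A \<union> B - {x}. g x y) = (\<Sum>y\<in>B - {x}. g x y) + (\<Sum>y\<in>A. g x y)"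
      using assms(1-3) by (simp add: sum.union_disjoint)
  qed
  moreover have "(\<Sum>x\<in>B. \<Sum>y\<in>A. g x y) = (\<Sum>x\<in>A. \<Sum>y\<in>B. g x y)"
    using assms(4) by (subst sum.swap) (auto intro!: sum.cong)
  ultimately show ?thesis
    unfolding ordered_pair_sum_def using assms(1-3) by (simp add: sum.union_disjoint sum.distrib)
qed

lemma double_pair_sum:
  assumes "distinct xs" and "\<And>x y. x \<in> set xs \<Longrightarrow> y \<in> set xs \<Longrightarrow> g x y = g y x"
  shows "2 * pair_sum g xs = ordered_pair_sum g (set xs)"
  using assms
proof (induction xs)
  case Nil
  then show ?case by (simp add: ordered_pair_sum_def)
next
  case (Cons x xs)
  have "ordered_pair_sum g (insert x (set xs)) =
      ordered_pair_sum g {x} + ordered_pair_sum g (set xs) + 2 * (\<Sum>x\<in>{x}. \<Sum>y\<in>set xs. g x y)"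
    using Cons.prems ordered_pair_sum_Un[of "{x}" "set xs" g] by auto
  also have "\<dots> = 2 * pair_sum g (x # xs)"
    using Cons by (simp add: ordered_pair_sum_def sum_list_distinct_conv_sum_set)
  finally show ?case by simp
qed

text \<open>Bubble sort: the tail is rearranged by induction behind the prefix
  \<open>us @ [x]\<close>, and then \<open>x\<close> is moved step by step past \<open>ps\<close> to
  its place in \<open>ys\<close>.\<close>

lemma adjacent_swaps_generate:
  assumes refl: "\<And>xs. E xs xs" and trans: "\<And>xs ys zs. E xs ys \<Longrightarrow> E ys zs \<Longrightarrow> E xs zs"
    and swap: "\<And>us x y vs. E (us @ x # y # vs) (us @ y # x # vs)"
    and "mset xs = mset ys"
  shows "E (us @ xs) (us @ ys)"
  using assms(4)
proof (induction xs arbitrary: us ys)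
  case Nil
  then show ?case by (simp add: refl)
next
  case (Cons x xs)
  then obtain ps qs where ys: "ys = ps @ x # qs"
    by (metis list.set_intros(1) set_mset_mset split_list)
  have bubble: "E (us @ x # ps @ qs) (us @ ps @ x # qs)" for us
  proof (induction ps arbitrary: us)
    case (Cons p ps)
    have "E (us @ x # (p # ps) @ qs) (us @ p # x # ps @ qs)" using swap by simp
    moreover have "E ((us @ [p]) @ x # ps @ qs) ((us @ [p]) @ ps @ x # qs)" by (rule Cons.IH)
    ultimately show ?case by (auto intro: trans)
  qed (simp add: refl)
  have "E ((us @ [x]) @ xs) ((us @ [x]) @ ps @ qs)"
    using Cons.prems ys by (intro Cons.IH) auto
  with bubble show ?case
    unfolding ys by (auto intro: trans)
qed

section \<open>Independence of the arrangement of the upper row\<close>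

text \<open>Whether \<open>c\<close> lies on the open cyclic interval that runs upwards from \<open>b\<close> to \<open>a\<close>.\<close>

definition arc :: "nat \<Rightarrow> nat \<Rightarrow> nat \<Rightarrow> bool" where
  "arc a b c \<longleftrightarrow> b < c \<and> c < a \<or> a \<le> b \<and> (c < a \<or> b < c)"

text \<open>The indicator splits into a term in \<open>a\<close> and \<open>c\<close>, a term in
  \<open>b\<close> and \<open>c\<close>, and the indicator that the pair does not descend. Summed
  over a matching with \<open>c\<close> fixed, it therefore sees only the two sets and the number of
  descents.\<close>

lemma of_bool_arc:
  assumes "c \<noteq> a" "c \<noteq> b"
  shows "int (of_bool (arc a b c)) = of_bool (c < a) - of_bool (c < b) + of_bool (a \<le> b)"
  using assms unfolding arc_def of_bool_def by (cases "a \<le> b"; cases "c < a"; cases "c < b"; simp)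

text \<open>For fixed \<open>u\<close> and \<open>v\<close> the condition tells on which of the two
  cyclic arcs cut out by \<open>u\<close> and \<open>v\<close> the point \<open>x\<close>
  lies.\<close>

lemma arc_less: "u < v \<Longrightarrow> arc x u v \<longleftrightarrow> \<not> (u < x \<and> x \<le> v)"
  by (auto simp: arc_def)

lemma arc_greater: "v < u \<Longrightarrow> arc x u v \<longleftrightarrow> v < x \<and> x \<le> u"
  by (auto simp: arc_def)

text \<open>Exchanging \<open>u\<close> and \<open>v\<close> negates the condition. Hence two points
  on the same arc stay on a common arc, and for points on different arcs exchanging both
  \<open>x\<close> with \<open>y\<close> and \<open>u\<close> with \<open>v\<close> keeps the
  value.\<close>

lemma arc_exchange:
  assumes "distinct [x, y, u, v]"
  shows "(arc x u v \<longleftrightarrow> arc y u v) \<Longrightarrow> (arc x v u \<longleftrightarrow> arc y v u)"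
    and "\<not> (arc x u v \<longleftrightarrow> arc y u v) \<Longrightarrow> arc y v u = arc x u v"
  using assms by (cases u v rule: linorder_cases; auto simp: arc_less arc_greater)+

text \<open>By \<open>of_bool_arc\<close>, lying on the same arc means that replacing
  \<open>u\<close> by \<open>v\<close> changes the descent indicators of \<open>x\<close> and of
  \<open>y\<close> by the same amount, so exchanging the partners keeps the number of descents. The
  second form counts non-descents, as they occur in \<open>of_bool_arc\<close>.\<close>

lemma descent_exchange:
  assumes "distinct [x, y, u, v]" and "arc x u v \<longleftrightarrow> arc y u v"
  shows "of_bool (v < x) + of_bool (u < y) = of_bool (u < x) + (of_bool (v < y) :: nat)"
    and "of_bool (x \<le> v) + of_bool (y \<le> u) = of_bool (x \<le> u) + (of_bool (y \<le> v) :: int)"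
  proof -
  have "x \<noteq> u" "x \<noteq> v" "y \<noteq> u" "y \<noteq> v" "u \<noteq> v" using assms(1) by auto
  then show "of_bool (v < x) + of_bool (u < y) = of_bool (u < x) + (of_bool (v < y) :: nat)"
    and "of_bool (x \<le> v) + of_bool (y \<le> u) = of_bool (x \<le> u) + (of_bool (y \<le> v) :: int)"
    using assms(2) unfolding arc_def of_bool_def by presburger+
qed

text \<open>This is \<open>Q4\<close> on the inner quadruples of a non-attacking filling, as
  \<open>Q4_enat\<close> shows; there every repetition gives 1.\<close>

definition arc_quad :: "nat \<Rightarrow> nat \<Rightarrow> nat \<Rightarrow> nat \<Rightarrow> nat" where
  "arc_quad z w u v = (if distinct [z, w, u, v] then of_bool (arc z u v) else 1)"

section \<open>Matchings and the exchange of two partners\<close>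

text \<open>The condition on common elements is the non-attacking condition: an entry of two
  adjacent rows of a rectangle has to occupy the same column in both.\<close>

definition matchings :: "nat set \<Rightarrow> nat set \<Rightarrow> (nat \<Rightarrow> nat) set" where
  "matchings A B = {f \<in> A \<rightarrow>\<^sub>E B. bij_betw f A B \<and> (\<forall>x\<in>A \<inter> B. f x = x)}"

definition descents :: "nat set \<Rightarrow> (nat \<Rightarrow> nat) \<Rightarrow> nat" where
  "descents A f = card {x \<in> A. f x < x}"

abbreviation along :: "('a \<Rightarrow> 'a \<Rightarrow> 'b \<Rightarrow> 'b \<Rightarrow> nat) \<Rightarrow> ('a \<Rightarrow> 'b) \<Rightarrow> 'a \<Rightarrow> 'a \<Rightarrow> nat" where
  "along V f \<equiv> \<lambda>x y. V x y (f x) (f y)"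

lemma finite_matchings: "finite A \<Longrightarrow> finite B \<Longrightarrow> finite (matchings A B)"
  by (rule finite_subset[of _ "A \<rightarrow>\<^sub>E B"]) (auto simp: matchings_def finite_PiE)

lemma matchings_inj: "f \<in> matchings A B \<Longrightarrow> x \<in> A \<Longrightarrow> y \<in> A \<Longrightarrow> f x = f y \<Longrightarrow> x = y"
  unfolding matchings_def bij_betw_def by (blast dest: inj_onD)

lemma matchings_fixed:
  assumes "f \<in> matchings A B" "x \<in> A" "f x \<in> A"
  shows "f x = x"
proof -
  have "f x \<in> B" using assms by (auto simp: matchings_def)
  then have "f (f x) = f x" using assms by (auto simp: matchings_def)
  then show ?thesis using matchings_inj[OF assms(1)] assms(2,3) by blast
qed

text \<open>The pair \<open>x\<close>, \<open>y\<close> is separated from the pair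
  \<open>f x\<close>, \<open>f y\<close>: on the circle, the chord from \<open>x\<close> to
  \<open>y\<close> does not cross the chord from \<open>f x\<close> to \<open>f y\<close>.\<close>

definition separated :: "nat \<Rightarrow> nat \<Rightarrow> (nat \<Rightarrow> nat) \<Rightarrow> bool" where
  "separated x y f \<longleftrightarrow> distinct [x, y, f x, f y] \<and> (arc x (f x) (f y) \<longleftrightarrow> arc y (f x) (f y))"

definition exchange :: "nat \<Rightarrow> nat \<Rightarrow> (nat \<Rightarrow> nat) \<Rightarrow> nat \<Rightarrow> nat" where
  "exchange x y f = (if separated x y f then f(x := f y, y := f x) else f)"

text \<open>By \<open>arc_exchange\<close> a separated pair is still separated after its partners
  are exchanged, so the second application undoes the first.\<close>

lemma exchange_exchange: "exchange x y (exchange x y f) = f"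
proof (cases "separated x y f")
  case True
  then have "x \<noteq> y" "separated x y (f(x := f y, y := f x))"
    using arc_exchange(1)[of x y "f x" "f y"] by (auto simp: separated_def)
  with True show ?thesis by (auto simp: exchange_def fun_eq_iff)
qed (simp add: exchange_def)

lemma exchange_matchings:
  assumes f: "f \<in> matchings A B" and "x \<in> A" "y \<in> A"
  shows "exchange x y f \<in> matchings A B"
proof (cases "separated x y f")
  case True
  have bij: "bij_betw f A B" and fixd: "\<And>x. x \<in> A \<Longrightarrow> x \<in> B \<Longrightarrow> f x = x" and ext: "f \<in> A \<rightarrow>\<^sub>E B"
    using f by (auto simp: matchings_def)
  \<comment> \<open>A separated pair contains no fixed point, so the exchange does not touch the
    condition on common elements.\<close>
  have "x \<notin> B" "y \<notin> B"
    using True fixd assms(2,3) by (auto simp: separated_def)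
  moreover have "bij_betw (f(x := f y, y := f x)) A B"
  proof -
    let ?t = "id(x := y, y := x)"
    have "f(x := f y, y := f x) = f \<circ> ?t"
      by (auto simp: fun_eq_iff)
    moreover have "bij_betw ?t A A"
      using assms(2,3) by (intro bij_betw_byWitness[where f' = ?t]) auto
    ultimately show ?thesis
      using bij_betw_trans[OF _ bij] by metis
  qed
  ultimately show ?thesis
    using True ext fixd assms(2,3) by (auto simp: matchings_def exchange_def PiE_iff extensional_def)
qed (simp add: exchange_def f)

lemma descents_exchange:
  assumes "finite A" "x \<in> A" "y \<in> A"
  shows "descents A (exchange x y f) = descents A f"
proof (cases "separated x y f")
  case True
  then have xy: "x \<noteq> y" by (auto simp: separated_def)
  have *: "descents A g = (\<Sum>z\<in>A - {x, y}. of_bool (g z < z)) + of_bool (g x < x) + of_bool (g y < y)" for g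
  proof -
    have "descents A g = (\<Sum>z\<in>A. of_bool (g z < z))"
      using assms(1) by (simp add: descents_def sum.If_cases of_bool_def Int_def)
    also have "\<dots> = (\<Sum>z\<in>insert x (insert y (A - {x, y})). of_bool (g z < z))"
      using assms by (intro sum.cong) auto
    also have "\<dots> = (\<Sum>z\<in>A - {x, y}. of_bool (g z < z)) + of_bool (g x < x) + of_bool (g y < y)"
      using assms(1) xy by simp
    finally show ?thesis .
  qed
  have "of_bool (f y < x) + of_bool (f x < y) = of_bool (f x < x) + (of_bool (f y < y) :: nat)"
    using True descent_exchange(1) unfolding separated_def by blast
  then show ?thesis
    using True xy unfolding *[of f] *[of "exchange x y f"]
    by (auto simp: exchange_def intro!: sum.cong)
qed (simp add: exchange_def)

text \<open>A repeated entry in a quadruple of a matching can only come from a fixed point.\<close>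

lemma arc_quad_matching:
  assumes f: "f \<in> matchings A B" and "x \<in> A" "y \<in> A" "x \<noteq> y"
  shows "arc_quad x y (f x) (f y) = (if f x = x \<or> f y = y then 1 else of_bool (arc x (f x) (f y)))"
proof -
  have "f x \<noteq> f y" "x \<noteq> f y" "y \<noteq> f x"
    using matchings_inj[OF f, of x y] matchings_fixed[OF f, of x] matchings_fixed[OF f, of y] assms by auto
  then show ?thesis
    using assms(4) by (auto simp: arc_quad_def)
qed

text \<open>Isolates \<open>g a b\<close>, the only term that depends on the order of the two
  neighbours.\<close>

lemma pair_sum_adjacent:
  "pair_sum g (us @ a # b # vs) = pair_sum g us + pair_sum g vs + g a b +
    (\<Sum>c\<leftarrow>us. g c a + g c b) + (\<Sum>c\<leftarrow>vs. g a c + g b c) + (\<Sum>c\<leftarrow>us. \<Sum>d\<leftarrow>vs. g c d)"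
  by (simp add: pair_sum_append sum_list_addf)

text \<open>For \<open>c\<close> to the left, \<open>f x\<close> and \<open>f y\<close> are the
  tested points of the arc of \<open>c\<close>, and they are merely permuted. For \<open>c\<close>
  to the right, \<open>f c\<close> is tested against the arcs of \<open>x\<close> and
  \<open>y\<close>; by \<open>of_bool_arc\<close> the sum of both indicators changes only through
  the descents, which \<open>descent_exchange\<close> keeps. The pair itself keeps its value because
  \<open>x\<close> and \<open>y\<close> lie on the same arc.\<close>

lemma pair_sum_exchange:
  assumes f: "f \<in> matchings A B" and dist: "distinct (us @ x # y # vs)" and A: "set (us @ x # y # vs) = A"
    and sep: "separated x y f"
  shows "pair_sum (along arc_quad (exchange x y f)) (us @ y # x # vs) =
    pair_sum (along arc_quad f) (us @ x # y # vs)"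
proof -
  define f' where "f' = exchange x y f"
  have xy: "x \<in> A" "y \<in> A" "x \<noteq> y" using A dist by auto
  have f': "f' \<in> matchings A B"
    using exchange_matchings[OF f xy(1,2)] by (simp add: f'_def)
  have f'x: "f' x = f y" "f' y = f x" and other: "\<And>z. z \<noteq> x \<Longrightarrow> z \<noteq> y \<Longrightarrow> f' z = f z"
    using sep xy(3) by (auto simp: f'_def exchange_def)
  have d: "distinct [x, y, f x, f y]" and s: "arc x (f x) (f y) \<longleftrightarrow> arc y (f x) (f y)"
    using sep by (auto simp: separated_def)
  have fxd: "f x \<noteq> x" "f y \<noteq> y" "f x \<noteq> y" "f y \<noteq> x" using d by auto
  note aq = arc_quad_matching[OF f] arc_quad_matching[OF f']
  have pair: "arc_quad y x (f' y) (f' x) = arc_quad x y (f x) (f y)"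
    using aq(1)[OF xy] aq(2)[OF xy(2,1)] s fxd xy f'x by simp
  have left: "arc_quad c y (f' c) (f' y) + arc_quad c x (f' c) (f' x) =
      arc_quad c x (f c) (f x) + arc_quad c y (f c) (f y)" if "c \<in> set us" for c
  proof -
    have c: "c \<in> A" "c \<noteq> x" "c \<noteq> y" using that dist A by auto
    show ?thesis
      using aq(1)[OF c(1) xy(1) c(2)] aq(1)[OF c(1) xy(2) c(3)] aq(2)[OF c(1) xy(1) c(2)]
        aq(2)[OF c(1) xy(2) c(3)] fxd f'x other[OF c(2,3)] by simp
  qed
  have right: "arc_quad y c (f' y) (f' c) + arc_quad x c (f' x) (f' c) =
      arc_quad x c (f x) (f c) + arc_quad y c (f y) (f c)" if "c \<in> set vs" for c
  proof (cases "f c = c")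
    case False
    have c: "c \<in> A" "c \<noteq> x" "c \<noteq> y" using that dist A by auto
    have *: "f c \<noteq> x" "f c \<noteq> y" "f c \<noteq> f x" "f c \<noteq> f y"
      using matchings_inj[OF f c(1) xy(1)] matchings_inj[OF f c(1) xy(2)] matchings_fixed[OF f c(1)] c xy False
      by auto
    have "int (of_bool (arc y (f x) (f c)) + of_bool (arc x (f y) (f c))) =
        int (of_bool (arc x (f x) (f c)) + of_bool (arc y (f y) (f c)))"
      unfolding of_nat_add of_bool_arc[OF *(1,3)] of_bool_arc[OF *(1,4)] of_bool_arc[OF *(2,3)]
        of_bool_arc[OF *(2,4)]
      using descent_exchange(2)[OF d s] by linarith
    then show ?thesis
      using aq(1)[OF xy(1) c(1) c(2)[symmetric]] aq(1)[OF xy(2) c(1) c(3)[symmetric]]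
        aq(2)[OF xy(1) c(1) c(2)[symmetric]] aq(2)[OF xy(2) c(1) c(3)[symmetric]]
        fxd f'x other[OF c(2,3)] False by (simp del: of_nat_add of_nat_of_bool)
  next
    case True
    have c: "c \<in> A" "c \<noteq> x" "c \<noteq> y" using that dist A by auto
    show ?thesis
      using aq(1)[OF xy(1) c(1) c(2)[symmetric]] aq(1)[OF xy(2) c(1) c(3)[symmetric]]
        aq(2)[OF xy(1) c(1) c(2)[symmetric]] aq(2)[OF xy(2) c(1) c(3)[symmetric]]
        other[OF c(2,3)] True by simp
  qed
  have "pair_sum (along arc_quad f') us = pair_sum (along arc_quad f) us"
    "pair_sum (along arc_quad f') vs = pair_sum (along arc_quad f) vs"
  proof -
    have "f' c = f c" if "c \<in> set us \<union> set vs" for c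
      using that dist by (intro other) auto
    then show "pair_sum (along arc_quad f') us = pair_sum (along arc_quad f) us"
      "pair_sum (along arc_quad f') vs = pair_sum (along arc_quad f) vs"
      by (simp_all cong: pair_sum_cong[where P = "\<lambda>_ _. True", OF sorted_wrt_true])
  qed
  moreover have "(\<Sum>c\<leftarrow>us. \<Sum>d\<leftarrow>vs. along arc_quad f' c d) = (\<Sum>c\<leftarrow>us. \<Sum>d\<leftarrow>vs. along arc_quad f c d)"
  proof -
    have "along arc_quad f' c d = along arc_quad f c d" if "c \<in> set us" "d \<in> set vs" for c d
    proof -
      have "c \<noteq> x" "c \<noteq> y" "d \<noteq> x" "d \<noteq> y" using that dist by auto
      then show ?thesis using other by simp
    qed
    then show ?thesis by (intro arg_cong[of _ _ sum_list] map_cong refl) simp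
  qed
  moreover have "(\<Sum>c\<leftarrow>us. arc_quad c y (f' c) (f' y) + arc_quad c x (f' c) (f' x)) =
      (\<Sum>c\<leftarrow>us. arc_quad c x (f c) (f x) + arc_quad c y (f c) (f y))"
    by (intro arg_cong[of _ _ sum_list] map_cong refl left)
  moreover have "(\<Sum>c\<leftarrow>vs. arc_quad y c (f' y) (f' c) + arc_quad x c (f' x) (f' c)) =
      (\<Sum>c\<leftarrow>vs. arc_quad x c (f x) (f c) + arc_quad y c (f y) (f c))"
    by (intro arg_cong[of _ _ sum_list] map_cong refl right)
  ultimately show ?thesis
    unfolding f'_def[symmetric] pair_sum_adjacent using pair by simp
qed

text \<open>Here the matching stays. Only the term of the pair itself could change: it is 1 if there
  is a fixed point, and otherwise \<open>arc_exchange\<close> applies to two points on different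
  arcs.\<close>

lemma pair_sum_not_separated:
  assumes f: "f \<in> matchings A B" and dist: "distinct (us @ x # y # vs)" and A: "set (us @ x # y # vs) = A"
    and sep: "\<not> separated x y f"
  shows "pair_sum (along arc_quad f) (us @ y # x # vs) = pair_sum (along arc_quad f) (us @ x # y # vs)"
proof -
  have xy: "x \<in> A" "y \<in> A" "x \<noteq> y" using A dist by auto
  have "f x \<noteq> f y" "x \<noteq> f y" "y \<noteq> f x"
    using matchings_inj[OF f, of x y] matchings_fixed[OF f, of x] matchings_fixed[OF f, of y] xy by auto
  then have "arc_quad y x (f y) (f x) = arc_quad x y (f x) (f y)"
    using arc_exchange(2)[of x y "f x" "f y"] sep xy
      arc_quad_matching[OF f xy] arc_quad_matching[OF f xy(2,1)]
    by (cases "f x = x \<or> f y = y") (auto simp: separated_def)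
  then show ?thesis
    by (simp add: pair_sum_adjacent add.commute)
qed

text \<open>For neighbours \<open>x\<close> and \<open>y\<close> the involution
  \<open>exchange x y\<close> is the required bijection, and neighbour swaps generate all
  arrangements.\<close>

theorem arc_quad_arrangement_independent:
  assumes "finite A" "finite B" and "distinct xs" "set xs = A" and "mset ys = mset xs"
  shows "equidistributed (matchings A B)
    (\<lambda>f. (descents A f, pair_sum (along arc_quad f) xs))
    (\<lambda>f. (descents A f, pair_sum (along arc_quad f) ys))"
proof -
  \<comment> \<open>The guard makes the relation reflexive and transitive on all lists; equality of
    multisets carries the guard from one list to the next.\<close>
  define E where "E = (\<lambda>xs ys. mset xs = mset ys \<and> (distinct xs \<and> set xs = A \<longrightarrow> equidistributed (matchings A B)
    (\<lambda>f. (descents A f, pair_sum (along arc_quad f) xs))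
    (\<lambda>f. (descents A f, pair_sum (along arc_quad f) ys))))"
  have "E ([] @ xs) ([] @ ys)"
  proof (rule adjacent_swaps_generate)
    show "E xs xs" for xs
      by (simp add: E_def equidistributed_cong)
    show "E xs zs" if "E xs ys" "E ys zs" for xs ys zs
    proof -
      have "distinct ys \<longleftrightarrow> distinct xs" "set ys = set xs"
        using that by (auto simp: E_def dest: mset_eq_imp_distinct_iff mset_eq_setD)
      then show ?thesis
        using that equidistributed_trans unfolding E_def by fastforce
    qed
    show "E (us @ x # y # vs) (us @ y # x # vs)" for us x y vs
    proof -
      have "equidistributed (matchings A B)
        (\<lambda>f. (descents A f, pair_sum (along arc_quad f) (us @ x # y # vs)))
        (\<lambda>f. (descents A f, pair_sum (along arc_quad f) (us @ y # x # vs)))"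
        if *: "distinct (us @ x # y # vs)" "set (us @ x # y # vs) = A"
      proof (rule equidistributed_by_injection[where \<phi> = "exchange x y"])
        have xy: "x \<in> A" "y \<in> A" using *(2) by auto
        show "finite (matchings A B)" by (simp add: assms finite_matchings)
        show "inj_on (exchange x y) (matchings A B)"
          by (rule inj_on_inverseI) (rule exchange_exchange)
        show "exchange x y ` matchings A B \<subseteq> matchings A B"
          using exchange_matchings xy by blast
        show "(descents A (exchange x y f), pair_sum (along arc_quad (exchange x y f)) (us @ y # x # vs)) =
            (descents A f, pair_sum (along arc_quad f) (us @ x # y # vs))" if "f \<in> matchings A B" for f
        proof (cases "separated x y f")
          case True
          then show ?thesis
            using pair_sum_exchange[OF that *] descents_exchange[OF assms(1) xy] by simp
        next
          case False
          then show ?thesis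
            using pair_sum_not_separated[OF that *] by (simp add: exchange_def)
        qed
      qed
      then show ?thesis by (simp add: E_def)
    qed
  qed (use assms in simp)
  then show ?thesis using assms by (simp add: E_def)
qed

section \<open>Quadruples of two chords\<close>

text \<open>The three flags select X1, Y1 and Z1 over X2, Y2 and Z2.\<close>

definition chord_rule :: "bool \<Rightarrow> bool \<Rightarrow> bool \<Rightarrow> nat \<Rightarrow> nat \<Rightarrow> nat \<Rightarrow> nat \<Rightarrow> bool" where
  "chord_rule p r s z w u v \<longleftrightarrow>
     z > v \<and> v > w \<and> w > u \<or> u > z \<and> z > v \<and> v > w \<or>
     (if p then z > w \<and> w > v \<and> v > u else z > w \<and> w > u \<and> u > v) \<or>
     (if r then u > v \<and> v > z \<and> z > w else v > u \<and> u > z \<and> z > w) \<or>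
     (if s then z > u \<and> u > v \<and> v > w \<or> v > z \<and> z > w \<and> w > u
      else z > v \<and> v > u \<and> u > w \<or> u > z \<and> z > w \<and> w > v)"

text \<open>A repeated entry counts 1, which is the effect of adding \<open>alpha\<close> to
  \<open>eta\<close>. The second disjunct is the substitution of \<open>(w, z, v, u)\<close>; unlike
  the arc rule, the result is symmetric in the two columns.\<close>

definition chord_quad :: "bool \<Rightarrow> bool \<Rightarrow> bool \<Rightarrow> nat \<Rightarrow> nat \<Rightarrow> nat \<Rightarrow> nat \<Rightarrow> nat" where
  "chord_quad p r s z w u v =
     (if distinct [z, w, u, v] then of_bool (chord_rule p r s z w u v \<or> chord_rule p r s w z v u) else 1)"

lemma chord_quad_sym: "chord_quad p r s w z v u = chord_quad p r s z w u v"
proof -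
  have "distinct [w, z, v, u] \<longleftrightarrow> distinct [z, w, u, v]" by auto
  then show ?thesis by (simp only: chord_quad_def disj_commute)
qed

lemmas nat_order_via_int = of_nat_less_iff[symmetric, where 'a = int]
  of_nat_le_iff[symmetric, where 'a = int] of_nat_eq_iff[symmetric, where 'a = int]

text \<open>Both X1 and X2 place each upper entry above the lower entry of its column, so they
  concern pairs of descents only.\<close>

lemma chord_quad_same_p:
  assumes "\<not> (u < z \<and> v < w)"
  shows "chord_quad p r s z w u v = chord_quad p' r s z w u v"
  using assms unfolding chord_quad_def chord_rule_def nat_order_via_int by (smt (verit))

text \<open>Both Y1 and Y2 place each upper entry below the lower entry of its column, so they
  concern pairs of ascents only.\<close>

lemma chord_quad_same_r:
  assumes "\<not> (z < u \<and> w < v)"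
  shows "chord_quad p r s z w u v = chord_quad p r' s z w u v"
  using assms unfolding chord_quad_def chord_rule_def nat_order_via_int by (smt (verit))

text \<open>On increasing upper pairs the arc rule is that of (X2,Y1,Z1). A flag is prescribed only
  for the type of pair it governs, so on pairs of descents, for instance, \<open>r\<close> and
  \<open>s\<close> stay free.\<close>

lemma chord_quad_arc_less:
  assumes "z < w" and "u < z \<and> v < w \<Longrightarrow> \<not> p" and "z < u \<and> w < v \<Longrightarrow> r"
    and "z < u \<and> v < w \<or> u < z \<and> w < v \<Longrightarrow> s"
  shows "chord_quad p r s z w u v = arc_quad z w u v"
proof (cases "distinct [z, w, u, v]")
  case True
  then have "z \<noteq> u" "z \<noteq> v" "w \<noteq> u" "w \<noteq> v" "u \<noteq> v" by auto
  then have "chord_rule p r s z w u v \<or> chord_rule p r s w z v u \<longleftrightarrow> arc z u v"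
    using assms unfolding arc_def chord_rule_def nat_order_via_int by (smt (verit))
  then show ?thesis using True by (simp add: chord_quad_def arc_quad_def)
qed (simp add: chord_quad_def arc_quad_def)

lemma chord_quad_arc_greater:
  assumes "w < z" and "u < z \<and> v < w \<Longrightarrow> p" and "z < u \<and> w < v \<Longrightarrow> \<not> r"
    and "z < u \<and> v < w \<or> u < z \<and> w < v \<Longrightarrow> \<not> s"
  shows "chord_quad p r s z w u v = arc_quad z w u v"
proof (cases "distinct [z, w, u, v]")
  case True
  then have "z \<noteq> u" "z \<noteq> v" "w \<noteq> u" "w \<noteq> v" "u \<noteq> v" by auto
  then have "chord_rule p r s z w u v \<or> chord_rule p r s w z v u \<longleftrightarrow> arc z u v"
    using assms unfolding arc_def chord_rule_def nat_order_via_int by (smt (verit))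
  then show ?thesis using True by (simp add: chord_quad_def arc_quad_def)
qed (simp add: chord_quad_def arc_quad_def)

text \<open>For a descent \<open>(x, u)\<close> against a fixed non-descent \<open>(y, v)\<close>
  the value is a function of \<open>x\<close> plus a function of \<open>u\<close>. Summed over a set
  of descents, it sees only their upper and lower entries and not how these are matched.\<close>

lemma chord_quad_descent_additive:
  assumes "u < x" "\<not> v < y" "x \<noteq> y" "u \<noteq> v" "x \<noteq> v" "y \<noteq> u"
  shows "int (chord_quad p r s x y u v) =
    (if y = v then 1 else if s then of_bool (y < x) else of_bool (x < y \<or> v < x)) +
    (if y = v then 0 else if s then - of_bool (y < u \<and> u < v) else - of_bool (v < u))"
proof (cases "y = v")
  case False
  \<comment> \<open>Since \<open>u < x\<close>, the negated event implies the other one, so the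
    indicator of the difference is a difference of indicators.\<close>
  then have "chord_rule p r s x y u v \<or> chord_rule p r s y x v u \<longleftrightarrow>
    (if s then y < x \<and> \<not> (y < u \<and> u < v) else (x < y \<or> v < x) \<and> \<not> v < u)"
    using assms unfolding chord_rule_def nat_order_via_int by (smt (verit))
  moreover have "distinct [x, y, u, v]"
    using assms False by simp
  ultimately have "int (chord_quad p r s x y u v) = of_bool (if s then y < x \<and> \<not> (y < u \<and> u < v) else (x < y \<or> v < x) \<and> \<not> v < u)"
    by (simp only: chord_quad_def if_True of_nat_of_bool)
  then show ?thesis
    using assms False unfolding of_bool_def nat_order_via_int by (smt (verit))
qed (simp add: chord_quad_def)

lemma chord_quad_ascent_additive:
  assumes "x < u" "\<not> y < v" "x \<noteq> y" "u \<noteq> v" "x \<noteq> v" "y \<noteq> u"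
  shows "int (chord_quad p r s x y u v) =
    (if y = v then 1 else if s then of_bool (v < x \<and> x < y) else of_bool (y < x)) +
    (if y = v then 0 else if s then of_bool (u < v) else of_bool (v < u \<and> u < y))"
proof (cases "y = v")
  case False
  \<comment> \<open>Since \<open>x < u\<close>, the two alternatives exclude each other, so their
    indicators add up.\<close>
  then have "chord_rule p r s x y u v \<or> chord_rule p r s y x v u \<longleftrightarrow>
    (if s then v < x \<and> x < y \<or> u < v else y < x \<or> v < u \<and> u < y)"
    using assms unfolding chord_rule_def nat_order_via_int by (smt (verit))
  moreover have "distinct [x, y, u, v]"
    using assms False by simp
  ultimately have "int (chord_quad p r s x y u v) = of_bool (if s then v < x \<and> x < y \<or> u < v else y < x \<or> v < u \<and> u < y)"
    by (simp only: chord_quad_def if_True of_nat_of_bool)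
  then show ?thesis
    using assms False unfolding of_bool_def nat_order_via_int by (smt (verit))
qed (simp add: chord_quad_def)

section \<open>Rematching the descents or the ascents only\<close>

lemma matchings_iff:
  "f \<in> matchings A B \<longleftrightarrow> f \<in> extensional A \<and> inj_on f A \<and> f ` A = B \<and> (\<forall>x\<in>A. x \<in> B \<longrightarrow> f x = x)"
  unfolding matchings_def bij_betw_def PiE_def by blast

lemma matchings_restrict:
  assumes f: "f \<in> matchings A B" and "D \<subseteq> A"
  shows "restrict f D \<in> matchings D (f ` D)"
  unfolding matchings_iff
proof (intro conjI ballI impI)
  show "restrict f D \<in> extensional D" by simp
  show "inj_on (restrict f D) D"
    using f \<open>D \<subseteq> A\<close> unfolding matchings_iff inj_on_restrict_eq by (blast intro: inj_on_subset)
  show "restrict f D ` D = f ` D" by simp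
  show "restrict f D x = x" if "x \<in> D" "x \<in> f ` D" for x
  proof -
    have "x \<in> A" "x \<in> B" using that f \<open>D \<subseteq> A\<close> unfolding matchings_iff by blast+
    then show ?thesis using f that(1) unfolding matchings_iff by simp
  qed
qed

text \<open>Elements of \<open>D\<close> are moved by \<open>f\<close> and hence lie outside
  \<open>B\<close>, so new partners on \<open>D\<close> cannot violate the condition on common
  elements.\<close>

lemma matchings_combine:
  assumes f: "f \<in> matchings A B" and "D \<subseteq> A" and g: "g \<in> matchings D (f ` D)"
    and moved: "\<And>x. x \<in> D \<Longrightarrow> f x \<noteq> x"
  shows "(\<lambda>x. if x \<in> D then g x else f x) \<in> matchings A B" (is "?h \<in> _")
proof -
  have inj: "inj_on f A" and im: "f ` A = B" and ext: "f \<in> A \<rightarrow>\<^sub>E B" and fixd: "\<And>x. x \<in> A \<inter> B \<Longrightarrow> f x = x"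
    using f by (auto simp: matchings_def bij_betw_def)
  have "bij_betw ?h D (f ` D)"
    using g by (auto simp: matchings_def cong: bij_betw_cong)
  moreover have "bij_betw ?h (A - D) (f ` (A - D))"
    using inj by (auto simp: bij_betw_def inj_on_def)
  moreover have "f ` D \<inter> f ` (A - D) = {}"
    using inj \<open>D \<subseteq> A\<close> by (auto simp: inj_on_def)
  ultimately have "bij_betw ?h (D \<union> (A - D)) (f ` D \<union> f ` (A - D))"
    by (rule bij_betw_combine)
  moreover have "D \<union> (A - D) = A" "f ` D \<union> f ` (A - D) = B"
    using \<open>D \<subseteq> A\<close> im by auto
  ultimately have bij: "bij_betw ?h A B" by simp
  have "?h x = x" if "x \<in> A \<inter> B" for x
    using fixd[OF that] moved by auto
  moreover have "?h \<in> A \<rightarrow>\<^sub>E B"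
    using bij ext \<open>D \<subseteq> A\<close> by (auto simp: PiE_iff extensional_def bij_betw_def)
  ultimately show ?thesis
    using bij unfolding matchings_def by blast
qed

text \<open>If \<open>g\<close> descends everywhere, the count forces the same for \<open>h\<close>.
  If \<open>g\<close> ascends everywhere, the count only rules out descents of \<open>h\<close>; a
  fixed point of \<open>h\<close> would be a common element of \<open>D\<close> and \<open>E\<close>
  and thus also a fixed point of \<open>g\<close>.\<close>

lemma matchings_monochromatic:
  assumes g: "g \<in> matchings D E" and h: "h \<in> matchings D E" and "finite D"
    and "descents D h = descents D g"
    and R: "R = (\<lambda>x u. u < x) \<or> R = (\<lambda>x u. x < u)" and "\<And>x. x \<in> D \<Longrightarrow> R x (g x)" and "x \<in> D"
  shows "R x (h x)"
  using R
proof
  assume R: "R = (\<lambda>x u. u < x)"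
  then have "{x \<in> D. g x < x} = D" using assms(6) by auto
  then have "card {x \<in> D. h x < x} = card D"
    using assms(4) by (simp add: descents_def)
  then have "{x \<in> D. h x < x} = D"
    using \<open>finite D\<close> by (intro card_subset_eq) auto
  then show ?thesis using R \<open>x \<in> D\<close> by blast
next
  assume R: "R = (\<lambda>x u. x < u)"
  then have gx: "x < g x" if "x \<in> D" for x using assms(6)[OF that] by simp
  then have "{x \<in> D. g x < x} = {}" using not_less_iff_gr_or_eq by blast
  then have "card {x \<in> D. h x < x} = 0"
    using assms(4) unfolding descents_def by (simp only: card.empty)
  then have "{x \<in> D. h x < x} = {}"
    using assms(3) by simp
  then have "\<not> h x < x" using \<open>x \<in> D\<close> by blast
  moreover have "h x \<noteq> x"
  proof
    assume "h x = x"
    then have "x \<in> D \<inter> E" using h \<open>x \<in> D\<close> by (auto simp: matchings_def PiE_iff)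
    then have "g x = x" using g by (simp add: matchings_def)
    then show False using gx[OF \<open>x \<in> D\<close>] by simp
  qed
  ultimately show ?thesis using R by simp
qed

text \<open>The rules \<open>V\<close> and \<open>V'\<close> differ only on pairs of type
  \<open>R\<close>, where \<open>V\<close> is the arc rule of the increasing and \<open>V'\<close>
  that of the decreasing arrangement. Rematching just the columns of type \<open>R\<close> by the
  rearrangement bijection converts these pairs; mixed pairs are insensitive to it by additivity, and
  the remaining pairs are not moved.\<close>

lemma recolouring:
  fixes R :: "nat \<Rightarrow> nat \<Rightarrow> bool" and G F :: "nat \<Rightarrow> nat \<Rightarrow> nat \<Rightarrow> int"
  assumes fin: "finite A" "finite B"
    and R: "R = (\<lambda>x u. u < x) \<or> R = (\<lambda>x u. x < u)"
    and sym: "\<And>x y u v. V y x v u = V x y u v" "\<And>x y u v. V' y x v u = V' x y u v"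
    and outside: "\<And>x y u v. \<not> (R x u \<and> R y v) \<Longrightarrow> V' x y u v = V x y u v"
    and mixed: "\<And>x y u v. R x u \<Longrightarrow> \<not> R y v \<Longrightarrow> x \<noteq> y \<Longrightarrow> u \<noteq> v \<Longrightarrow> x \<noteq> v \<Longrightarrow> y \<noteq> u \<Longrightarrow>
      int (V x y u v) = G y v x + F y v u"
    and less: "\<And>x y u v. R x u \<Longrightarrow> R y v \<Longrightarrow> x < y \<Longrightarrow> V x y u v = arc_quad x y u v"
    and greater: "\<And>x y u v. R x u \<Longrightarrow> R y v \<Longrightarrow> y < x \<Longrightarrow> V' x y u v = arc_quad x y u v"
  shows "equidistributed (matchings A B)
    (\<lambda>f. (descents A f, ordered_pair_sum (along V f) A))
    (\<lambda>f. (descents A f, ordered_pair_sum (along V' f) A))"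
proof -
  let ?up = sorted_list_of_set
  define P where "P = (\<lambda>D E \<psi>. bij_betw \<psi> (matchings D E) (matchings D E) \<and>
      (\<forall>g\<in>matchings D E. (descents D (\<psi> g), pair_sum (along arc_quad (\<psi> g)) (rev (?up D))) =
        (descents D g, pair_sum (along arc_quad g) (?up D))))"
  \<comment> \<open>One bijection is chosen for each pair of sets, independently of the matching;
    injectivity of the map built from it rests on this.\<close>
  define \<psi> where "\<psi> = (\<lambda>D E. SOME \<psi>. P D E \<psi>)"
  have "P D E (\<psi> D E)" if "finite D" "finite E" for D E
  proof -
    have "equidistributed (matchings D E) (\<lambda>f. (descents D f, pair_sum (along arc_quad f) (?up D)))
        (\<lambda>f. (descents D f, pair_sum (along arc_quad f) (rev (?up D))))"
      using that by (intro arc_quad_arrangement_independent) simp_all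
    then show ?thesis
      unfolding \<psi>_def P_def equidistributed_def by (rule someI_ex)
  qed
  then have \<psi>_bij: "bij_betw (\<psi> D E) (matchings D E) (matchings D E)"
    and \<psi>_desc: "g \<in> matchings D E \<Longrightarrow> descents D (\<psi> D E g) = descents D g"
    and \<psi>_sum: "g \<in> matchings D E \<Longrightarrow>
      pair_sum (along arc_quad (\<psi> D E g)) (rev (?up D)) = pair_sum (along arc_quad g) (?up D)"
    if "finite D" "finite E" for D E g
    using that unfolding P_def prod.inject by blast+
  define D where "D = (\<lambda>f. {x \<in> A. R x (f x)})"
  define g where "g = (\<lambda>f. \<psi> (D f) (f ` D f) (restrict f (D f)))"
  define \<phi> where "\<phi> = (\<lambda>f x. if x \<in> D f then g f x else f x)"
  have DA: "D f \<subseteq> A" and finD: "finite (D f)" "finite (f ` D f)" for f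
    using fin by (auto simp: D_def)
  have RD: "R x (f x)" if "x \<in> D f" for x f
    using that by (simp add: D_def)
  have R_neq: "x \<noteq> u" if "R x u" for x u
    using R that by auto
  have restr: "restrict f (D f) \<in> matchings (D f) (f ` D f)" if "f \<in> matchings A B" for f
    using matchings_restrict[OF that DA] .
  have g: "g f \<in> matchings (D f) (f ` D f)" if "f \<in> matchings A B" for f
    using \<psi>_bij[OF finD(1,2)] restr[OF that] unfolding g_def bij_betw_def by blast
  have Rg: "R x (g f x)" if "f \<in> matchings A B" "x \<in> D f" for f x
  proof (rule matchings_monochromatic[OF restr[OF that(1)] g[OF that(1)] finD(1) _ R _ that(2)])
    show "descents (D f) (g f) = descents (D f) (restrict f (D f))"
      unfolding g_def by (rule \<psi>_desc[OF finD restr[OF that(1)]])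
    show "R x (restrict f (D f) x)" if "x \<in> D f" for x
      using RD that by simp
  qed
  have \<phi>_in: "\<phi> f \<in> matchings A B" if "f \<in> matchings A B" for f
    unfolding \<phi>_def using matchings_combine[OF that DA g[OF that]] RD R_neq by fastforce
  have D\<phi>: "D (\<phi> f) = D f" if "f \<in> matchings A B" for f
    using Rg[OF that] DA[of f] by (auto simp: \<phi>_def D_def)
  have im_g: "g f ` D f = f ` D f" if "f \<in> matchings A B" for f
    using g[OF that] by (simp add: matchings_def bij_betw_def)
  have im\<phi>: "\<phi> f ` D f = f ` D f" if "f \<in> matchings A B" for f
    using im_g[OF that] by (simp add: \<phi>_def)
  show ?thesis
  proof (rule equidistributed_by_injection[where \<phi> = \<phi>])
    show "finite (matchings A B)" using fin by (rule finite_matchings)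
    show "\<phi> ` matchings A B \<subseteq> matchings A B" using \<phi>_in by blast
    show "inj_on \<phi> (matchings A B)"
    proof (rule inj_onI)
      fix f f' assume f: "f \<in> matchings A B" and f': "f' \<in> matchings A B" and eq: "\<phi> f = \<phi> f'"
      \<comment> \<open>The set of columns of type \<open>R\<close> and its image can be read off
        the result, so both preimages have been treated by the same bijection.\<close>
      have D: "D f' = D f" and im: "f' ` D f = f ` D f"
        using D\<phi>[OF f] D\<phi>[OF f'] im\<phi>[OF f] im\<phi>[OF f'] eq by auto
      have "g f x = g f' x" if "x \<in> D f" for x
        using fun_cong[OF eq, of x] that D by (simp add: \<phi>_def)
      moreover have "g f \<in> extensional (D f)" "g f' \<in> extensional (D f)"
        using g[OF f] g[OF f'] D unfolding matchings_iff by auto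
      ultimately have "g f = g f'"
        by (intro extensionalityI)
      then have "\<psi> (D f) (f ` D f) (restrict f (D f)) = \<psi> (D f) (f ` D f) (restrict f' (D f))"
        using D im by (simp add: g_def)
      moreover have "inj_on (\<psi> (D f) (f ` D f)) (matchings (D f) (f ` D f))"
        using \<psi>_bij[OF finD(1,2)[of f]] by (rule bij_betw_imp_inj_on)
      moreover have "restrict f' (D f) \<in> matchings (D f) (f ` D f)"
        using restr[OF f'] D im by simp
      ultimately have eq_restr: "restrict f (D f) = restrict f' (D f)"
        using restr[OF f] by (auto dest: inj_onD)
      have "f x = f' x" if "x \<in> D f" for x
        using fun_cong[OF eq_restr, of x] that by simp
      moreover have "f x = f' x" if "x \<notin> D f" for x
        using fun_cong[OF eq, of x] that D by (simp add: \<phi>_def)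
      ultimately show "f = f'" by blast
    qed
    fix f assume f: "f \<in> matchings A B"
    let ?D = "D f" and ?N = "A - D f"
    have A: "A = ?D \<union> ?N" using DA by blast
    have finN: "finite ?N" using fin by simp
    from R have "{x \<in> A. \<phi> f x < x} = {x \<in> A. f x < x}"
    proof
      assume R': "R = (\<lambda>x u. u < x)"
      then show ?thesis
        using D\<phi>[OF f] by (simp add: D_def)
    next
      assume R': "R = (\<lambda>x u. x < u)"
      have "\<phi> f x < x \<longleftrightarrow> f x < x" for x
      proof (cases "x \<in> D f")
        case True
        then have "x < f x" "x < \<phi> f x"
          using RD[of x f] RD[of x "\<phi> f"] D\<phi>[OF f] R' by auto
        then show ?thesis by simp
      qed (simp add: \<phi>_def)
      then show ?thesis by simp
    qed
    then have desc: "descents A (\<phi> f) = descents A f"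
      by (simp only: descents_def)
    have neq: "x \<noteq> y \<and> h x \<noteq> h y \<and> x \<noteq> h y \<and> y \<noteq> h x" if "h \<in> matchings A B" "x \<in> D h" "y \<in> A - D h" for h x y
      using matchings_inj[OF that(1), of x y] matchings_fixed[OF that(1), of x]
        matchings_fixed[OF that(1), of y] that DA[of h] RD R_neq by fastforce
    \<comment> \<open>Reindexing by the injective \<open>h\<close> turns the second summand into a
      sum over the image; the total depends on \<open>h\<close> only through \<open>D h\<close>, its
      image and the values outside \<open>D h\<close>.\<close>
    have cross: "int (\<Sum>x\<in>D h. \<Sum>y\<in>A - D h. V x y (h x) (h y)) =
        (\<Sum>y\<in>A - D h. (\<Sum>x\<in>D h. G y (h y) x) + (\<Sum>u\<in>h ` D h. F y (h y) u))" if h: "h \<in> matchings A B" for h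
    proof -
      have inj: "inj_on h (D h)"
        using matchings_inj[OF h] DA[of h] by (intro inj_onI) blast
      have "int (\<Sum>x\<in>D h. \<Sum>y\<in>A - D h. V x y (h x) (h y)) =
          (\<Sum>x\<in>D h. \<Sum>y\<in>A - D h. G y (h y) x + F y (h y) (h x))"
        unfolding of_nat_sum
      proof (intro sum.cong refl)
        fix x y assume x: "x \<in> D h" and y: "y \<in> A - D h"
        then have "R x (h x)" "\<not> R y (h y)" by (simp_all add: D_def)
        then show "int (V x y (h x) (h y)) = G y (h y) x + F y (h y) (h x)"
          using mixed neq[OF h x y] by blast
      qed
      also have "\<dots> = (\<Sum>y\<in>A - D h. \<Sum>x\<in>D h. G y (h y) x + F y (h y) (h x))"
        by (rule sum.swap)
      finally show ?thesis
        by (simp add: sum.distrib sum.reindex[OF inj])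
    qed
    have \<phi>N: "\<phi> f y = f y" if "y \<in> ?N" for y
      using that by (simp add: \<phi>_def)
    have "(\<Sum>x\<in>?D. \<Sum>y\<in>?N. V' x y (\<phi> f x) (\<phi> f y)) = (\<Sum>x\<in>?D. \<Sum>y\<in>?N. V x y (\<phi> f x) (\<phi> f y))"
      using D\<phi>[OF f] by (intro sum.cong refl outside) (auto simp: D_def)
    also have "int \<dots> = int (\<Sum>x\<in>?D. \<Sum>y\<in>?N. V x y (f x) (f y))"
      using cross[OF \<phi>_in[OF f]] cross[OF f] D\<phi>[OF f] im\<phi>[OF f] \<phi>N by simp
    finally have DN: "(\<Sum>x\<in>?D. \<Sum>y\<in>?N. V' x y (\<phi> f x) (\<phi> f y)) = (\<Sum>x\<in>?D. \<Sum>y\<in>?N. V x y (f x) (f y))"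
      by (simp only: of_nat_eq_iff)
    have NN: "ordered_pair_sum (along V' (\<phi> f)) ?N = ordered_pair_sum (along V f) ?N"
    proof (rule ordered_pair_sum_cong)
      fix x y assume "x \<in> ?N" "y \<in> ?N"
      moreover from this have "\<not> R x (f x)" by (simp add: D_def)
      ultimately show "V' x y (\<phi> f x) (\<phi> f y) = V x y (f x) (f y)"
        using \<phi>N outside by simp
    qed
    \<comment> \<open>Descending through \<open>rev\<close>, the rule \<open>V'\<close> is the arc
      rule; the chosen bijection leads to the ascending list, on which the arc rule is
      \<open>V\<close>.\<close>
    have DD: "ordered_pair_sum (along V' (\<phi> f)) ?D = ordered_pair_sum (along V f) ?D"
    proof -
      have "ordered_pair_sum (along V' (\<phi> f)) ?D = 2 * pair_sum (along V' (\<phi> f)) (rev (?up ?D))"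
        using double_pair_sum[of "rev (?up ?D)" "along V' (\<phi> f)"] sym(2) finD(1) by simp
      also have "pair_sum (along V' (\<phi> f)) (rev (?up ?D)) = pair_sum (along arc_quad (g f)) (rev (?up ?D))"
      proof (rule pair_sum_cong[where P = "(>)"])
        show "sorted_wrt (>) (rev (?up ?D))"
          by (simp add: sorted_wrt_rev)
        show "V' x y (\<phi> f x) (\<phi> f y) = arc_quad x y (g f x) (g f y)"
          if "x \<in> set (rev (?up ?D))" "y \<in> set (rev (?up ?D))" "y < x" for x y
        proof -
          have "x \<in> ?D" "y \<in> ?D" using that finD(1) by auto
          then show ?thesis using greater[OF Rg[OF f] Rg[OF f]] that(3) by (simp add: \<phi>_def)
        qed
      qed
      also have "\<dots> = pair_sum (along arc_quad (restrict f ?D)) (?up ?D)"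
        unfolding g_def by (rule \<psi>_sum[OF finD restr[OF f]])
      also have "\<dots> = pair_sum (along V f) (?up ?D)"
      proof (rule pair_sum_cong[where P = "(<)"])
        show "sorted_wrt (<) (?up ?D)" by simp
        show "arc_quad x y (restrict f ?D x) (restrict f ?D y) = V x y (f x) (f y)"
          if "x \<in> set (?up ?D)" "y \<in> set (?up ?D)" "x < y" for x y
        proof -
          have "x \<in> ?D" "y \<in> ?D" using that finD(1) by auto
          then show ?thesis using less[OF RD RD] that(3) by simp
        qed
      qed
      also have "2 * \<dots> = ordered_pair_sum (along V f) ?D"
        using double_pair_sum[of "?up ?D" "along V f"] sym(1) finD(1) by simp
      finally show ?thesis .
    qed
    have split: "ordered_pair_sum (along W h) A = ordered_pair_sum (along W h) ?D +
        ordered_pair_sum (along W h) ?N + 2 * (\<Sum>x\<in>?D. \<Sum>y\<in>?N. W x y (h x) (h y))"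
      if "\<And>x y u v. W y x v u = W x y u v" for W :: "nat \<Rightarrow> nat \<Rightarrow> nat \<Rightarrow> nat \<Rightarrow> nat" and h
      using ordered_pair_sum_Un[of ?D ?N "along W h"] finD(1) finN that A by simp
    show "(descents A (\<phi> f), ordered_pair_sum (along V' (\<phi> f)) A) =
        (descents A f, ordered_pair_sum (along V f) A)"
      using desc DD NN DN split[of V f, OF sym(1)] split[of V' "\<phi> f", OF sym(2)] by simp
  qed
qed


lemma equidistributed_map:
  assumes "equidistributed M s t"
  shows "equidistributed M (\<lambda>x. h (s x)) (\<lambda>x. h (t x))"
  using assms unfolding equidistributed_def by auto

text \<open>Recolouring the descents toggles \<open>p\<close> and recolouring the ascents toggles
  \<open>r\<close>; the flag \<open>s\<close> of the mixed pairs is kept.\<close>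

lemma chord_quad_flag_independent:
  assumes "finite A" "finite B"
  shows "equidistributed (matchings A B)
    (\<lambda>f. (descents A f, ordered_pair_sum (along (chord_quad p r s) f) A))
    (\<lambda>f. (descents A f, ordered_pair_sum (along (chord_quad p' r' s) f) A))"
proof -
  let ?S = "\<lambda>p r f. (descents A f, ordered_pair_sum (along (chord_quad p r s) f) A)"
  \<comment> \<open>The direction is dictated by the arc rule, which belongs to X2 and Y1 on
    increasing pairs and to X1 and Y2 on decreasing ones; the reverse toggles follow by
    symmetry.\<close>
  have p: "equidistributed (matchings A B) (?S False r) (?S True r)" for r
    by (rule recolouring[OF assms disjI1[OF refl] chord_quad_sym chord_quad_sym chord_quad_same_p
          chord_quad_descent_additive chord_quad_arc_less chord_quad_arc_greater]) auto
  have r: "equidistributed (matchings A B) (?S p True) (?S p False)" for p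
    by (rule recolouring[OF assms disjI2[OF refl] chord_quad_sym chord_quad_sym chord_quad_same_r
          chord_quad_ascent_additive chord_quad_arc_less chord_quad_arc_greater]) auto
  have refl: "equidistributed (matchings A B) (?S p r) (?S p r)" for p r
    by (rule equidistributed_cong) (rule refl)
  have "equidistributed (matchings A B) (?S p r) (?S p' r)"
    using p[of r] equidistributed_sym[OF p[of r]] refl by (cases p; cases p') auto
  also have "equidistributed (matchings A B) (?S p' r) (?S p' r')"
    using r[of p'] equidistributed_sym[OF r[of p']] refl by (cases r; cases r') auto
  finally show ?thesis .
qed

theorem arc_chord_equidistributed:
  assumes "finite A" "finite B" "distinct xs" "set xs = A"
  shows "equidistributed (matchings A B)
    (\<lambda>f. (descents A f, 2 * pair_sum (along arc_quad f) xs))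
    (\<lambda>f. (descents A f, ordered_pair_sum (along (chord_quad p r s) f) A))"
proof -
  let ?up = "sorted_list_of_set A"
  \<comment> \<open>The arrangement is chosen according to \<open>s\<close>, the flag that
    recolouring cannot change: the increasing one for Z1, the decreasing one for Z2.\<close>
  define ys where "ys = (if s then ?up else rev ?up)"
  have ys: "mset ys = mset xs" "distinct ys" "set ys = A"
    using assms by (auto simp: ys_def set_eq_iff_mset_eq_distinct[symmetric])
  have "equidistributed (matchings A B)
    (\<lambda>f. (descents A f, 2 * pair_sum (along arc_quad f) xs))
    (\<lambda>f. (descents A f, 2 * pair_sum (along arc_quad f) ys))"
    using equidistributed_map[OF arc_quad_arrangement_independent[OF assms ys(1)],
        where h = "\<lambda>(d, n). (d, 2 * n)"] by simp
  also have "equidistributed (matchings A B)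
    (\<lambda>f. (descents A f, 2 * pair_sum (along arc_quad f) ys))
    (\<lambda>f. (descents A f, ordered_pair_sum (along (chord_quad (\<not> s) s s) f) A))"
  proof (rule equidistributed_cong)
    fix f
    have "pair_sum (along arc_quad f) ys = pair_sum (along (chord_quad (\<not> s) s s) f) ys"
    proof (cases s)
      case True
      then show ?thesis
        unfolding ys_def by (intro pair_sum_cong[where P = "(<)"]) (simp_all add: chord_quad_arc_less)
    next
      case False
      then show ?thesis
        unfolding ys_def
        by (intro pair_sum_cong[where P = "(>)"]) (simp_all add: chord_quad_arc_greater sorted_wrt_rev)
    qed
    then show "(descents A f, 2 * pair_sum (along arc_quad f) ys) =
        (descents A f, ordered_pair_sum (along (chord_quad (\<not> s) s s) f) A)"
      using double_pair_sum[OF ys(2), of "along (chord_quad (\<not> s) s s) f"] ys(3) chord_quad_sym by simp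
  qed
  also have "equidistributed (matchings A B)
    (\<lambda>f. (descents A f, ordered_pair_sum (along (chord_quad (\<not> s) s s) f) A))
    (\<lambda>f. (descents A f, ordered_pair_sum (along (chord_quad p r s) f) A))"
    by (rule chord_quad_flag_independent[OF assms(1,2)])
  finally show ?thesis .
qed

section \<open>Exchanging the matching of one level\<close>

definition block :: "nat list \<Rightarrow> nat \<Rightarrow> nat set" where
  "block lam h = {j \<in> {1..length lam}. height lam j = h}"

definition row_set :: "nat list \<Rightarrow> filling \<Rightarrow> nat \<Rightarrow> nat \<Rightarrow> nat set" where
  "row_set lam \<sigma> h i = (\<lambda>j. \<sigma> (i, j)) ` block lam h"

definition row_descents :: "nat list \<Rightarrow> filling \<Rightarrow> nat \<Rightarrow> nat \<Rightarrow> nat" where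
  "row_descents lam \<sigma> h i = card {j \<in> block lam h. \<sigma> (i, j) < \<sigma> (i + 1, j)}"

definition level :: "(nat \<Rightarrow> nat \<Rightarrow> nat \<Rightarrow> nat \<Rightarrow> nat) \<Rightarrow> nat list \<Rightarrow> filling \<Rightarrow> nat \<Rightarrow> nat \<Rightarrow> nat" where
  "level V lam \<sigma> h r =
     pair_sum (\<lambda>j k. V (\<sigma> (r + 1, j)) (\<sigma> (r + 1, k)) (\<sigma> (r, j)) (\<sigma> (r, k)))
       (sorted_list_of_set (block lam h))"

text \<open>On \<open>N_plus lam\<close> these data determine everything the theorem compares except
  the quadruple statistics.\<close>

definition same_profile :: "nat list \<Rightarrow> filling \<Rightarrow> filling \<Rightarrow> bool" where
  "same_profile lam \<sigma> \<tau> \<longleftrightarrow>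
     row_set lam \<sigma> = row_set lam \<tau> \<and> row_descents lam \<sigma> = row_descents lam \<tau>"

lemma finite_block [simp]: "finite (block lam h)"
  by (simp add: block_def)

lemma mem_dg: "(i, j) \<in> dg lam \<longleftrightarrow> j \<in> block lam (height lam j) \<and> 1 \<le> i \<and> i \<le> height lam j"
  by (auto simp: dg_def block_def)

lemma block_height: "j \<in> block lam h \<Longrightarrow> height lam j = h"
  by (simp add: block_def)

lemma height_antimono:
  assumes "is_partition lam" "1 \<le> j" "j \<le> k" "k \<le> length lam"
  shows "height lam k \<le> height lam j"
proof (cases "j = k")
  case False
  then have "j - 1 < k - 1" "k - 1 < length lam" using assms by auto
  then show ?thesis
    using assms(1) sorted_wrt_nth_less unfolding is_partition_def height_def by fastforce
qed simp

lemma finite_dg [simp]: "finite (dg lam)"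
proof (rule finite_subset)
  show "dg lam \<subseteq> (\<Union>j\<in>{1..length lam}. {1..height lam j} \<times> {j})"
    by (auto simp: dg_def)
qed auto

lemma N_plus_inj:
  assumes "\<sigma> \<in> N_plus lam" "(i, j) \<in> dg lam" "(i, k) \<in> dg lam" "\<sigma> (i, j) = \<sigma> (i, k)"
  shows "j = k"
proof (rule ccontr)
  assume "j \<noteq> k"
  then have "attacking lam (i, j) (i, k)" "(i, j) \<noteq> (i, k)" by (auto simp: attacking_def)
  then show False using assms unfolding N_plus_def non_attacking_def by blast
qed

text \<open>Boxes in adjacent rows of two columns of equal height attack each other whichever column
  comes first.\<close>

lemma N_plus_same_column:
  assumes "\<sigma> \<in> N_plus lam" "j \<in> block lam h" "k \<in> block lam h" "1 \<le> r" "r < h"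
    and "\<sigma> (r + 1, j) = \<sigma> (r, k)"
  shows "j = k"
proof (rule ccontr)
  assume "j \<noteq> k"
  then have "attacking lam (r + 1, j) (r, k)"
    using assms by (auto simp: attacking_def block_def)
  moreover have "(r + 1, j) \<in> dg lam" "(r, k) \<in> dg lam"
    using assms by (auto simp: dg_def block_def)
  ultimately show False using assms(1,6) unfolding N_plus_def non_attacking_def by fastforce
qed

lemma inj_on_row:
  assumes "\<sigma> \<in> N_plus lam" "1 \<le> i" "i \<le> h"
  shows "inj_on (\<lambda>j. \<sigma> (i, j)) (block lam h)"
proof (rule inj_onI)
  fix j k assume "j \<in> block lam h" "k \<in> block lam h" "\<sigma> (i, j) = \<sigma> (i, k)"
  moreover from this have "(i, j) \<in> dg lam" "(i, k) \<in> dg lam"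
    using assms(2,3) by (auto simp: dg_def block_def)
  ultimately show "j = k" using N_plus_inj[OF assms(1)] by blast
qed

section \<open>Rigid motion of the lower part of the columns\<close>

text \<open>All rows up to \<open>r\<close> move together, so below the cut between the rows
  \<open>r\<close> and \<open>r + 1\<close> every entry keeps its neighbours in the column.\<close>

definition drag :: "nat list \<Rightarrow> nat \<Rightarrow> nat \<Rightarrow> (nat \<Rightarrow> nat) \<Rightarrow> box \<Rightarrow> box" where
  "drag lam h r p = (\<lambda>(i, j). if i \<le> r \<and> j \<in> block lam h then (i, p j) else (i, j))"

text \<open>The motion keeps rows and column heights, and \<open>r < h\<close> leaves the top row in
  place. A new attack could only arise at the cut between the rows \<open>r\<close> and
  \<open>r + 1\<close>, which \<open>stays\<close> excludes.\<close>

lemma drag_N_plus: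
  assumes part: "is_partition lam" and \<sigma>: "\<sigma> \<in> N_plus lam" and "1 \<le> r" "r < h"
    and p: "bij_betw p (block lam h) (block lam h)"
    and stays: "\<And>j k. j \<in> block lam h \<Longrightarrow> k \<in> block lam h \<Longrightarrow> \<sigma> (r + 1, j) = \<sigma> (r, p k) \<Longrightarrow> j = k"
  shows "\<sigma> \<circ> drag lam h r p \<in> N_plus lam"
proof -
  let ?m = "drag lam h r p"
  have p_in: "p j \<in> block lam h" if "j \<in> block lam h" for j
    using p that by (auto simp: bij_betw_def)
  have p_inj: "j = k" if "j \<in> block lam h" "k \<in> block lam h" "p j = p k" for j k
    using p that by (auto simp: bij_betw_def dest: inj_onD)
  have fst_m: "fst (?m u) = fst u" for u
    by (cases u) (simp add: drag_def)
  have snd_m: "snd (?m u) = (if fst u \<le> r \<and> snd u \<in> block lam h then p (snd u) else snd u)" for u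
    by (cases u) (simp add: drag_def)
  have height_m: "height lam (snd (?m u)) = height lam (snd u)" for u
    using p_in[of "snd u"] by (simp add: snd_m block_def)
  have dg_m: "?m u \<in> dg lam \<longleftrightarrow> u \<in> dg lam" for u
  proof (cases u)
    case (Pair i j)
    have "p j \<in> block lam h" "height lam (p j) = height lam j" if "j \<in> block lam h"
      using p_in[OF that] that by (simp_all add: block_def)
    then show ?thesis
      unfolding Pair by (auto simp: drag_def dg_def block_def)
  qed
  have pos: "\<sigma> \<in> positive_fillings lam" and na: "non_attacking lam \<sigma>" and top: "top_row_increasing lam \<sigma>"
    using \<sigma> by (auto simp: N_plus_def)
  have "\<sigma> \<circ> ?m \<in> positive_fillings lam"
    unfolding positive_fillings_def
  proof (rule PiE_I)
    show "(\<sigma> \<circ> ?m) u \<in> {0<..}" if "u \<in> dg lam" for u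
      using PiE_mem[OF pos[unfolded positive_fillings_def], of "?m u"] dg_m[of u] that by simp
    show "(\<sigma> \<circ> ?m) u = undefined" if "u \<notin> dg lam" for u
      using PiE_arb[OF pos[unfolded positive_fillings_def], of "?m u"] dg_m[of u] that by simp
  qed
  moreover have "non_attacking lam (\<sigma> \<circ> ?m)"
    unfolding non_attacking_def
  proof
    assume "\<exists>a\<in>dg lam. \<exists>b\<in>dg lam. a \<noteq> b \<and> (\<sigma> \<circ> ?m) a = (\<sigma> \<circ> ?m) b \<and> attacking lam a b"
    then obtain a b where ab: "a \<in> dg lam" "b \<in> dg lam" "a \<noteq> b" "(\<sigma> \<circ> ?m) a = (\<sigma> \<circ> ?m) b"
      "attacking lam a b"
      by blast
    obtain i j i' k where "a = (i, j)" "b = (i', k)"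
      by (metis surj_pair)
    let ?u = "(i, j)" and ?v = "(i', k)"
    have u: "?u \<in> dg lam" and v: "?v \<in> dg lam" and neq: "\<not> (i = i' \<and> j = k)"
      and eq: "(\<sigma> \<circ> ?m) ?u = (\<sigma> \<circ> ?m) ?v" and att: "attacking lam ?u ?v"
      using ab \<open>a = (i, j)\<close> \<open>b = (i', k)\<close> by auto
    have m_neq: "?m ?u \<noteq> ?m ?v"
      using neq p_inj p_in unfolding drag_def by (auto split: if_splits)
    have cols: "1 \<le> snd (?m w)" "snd (?m w) \<le> length lam" if "w \<in> dg lam" for w
      using dg_m[of w] that by (auto simp: dg_def)
    have "attacking lam (?m ?u) (?m ?v)"
    proof (cases "i = i'")
      case True
      then show ?thesis by (simp add: attacking_def fst_m)
    next
      case False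
      then have i: "i = i' + 1" and jk: "k > j \<or> height lam j = height lam k" "k \<noteq> j"
        using att by (auto simp: attacking_def)
      show ?thesis
      proof (cases "height lam j = height lam k")
        case True
        \<comment> \<open>At equal heights any two different columns attack in adjacent rows.
          Different columns can be brought together only if exactly the lower box is moved, that is,
          at the cut.\<close>
        have "snd (?m ?u) \<noteq> snd (?m ?v)"
        proof
          assume s: "snd (?m ?u) = snd (?m ?v)"
          have jkb: "j \<in> block lam h \<longleftrightarrow> k \<in> block lam h"
            using True u v by (auto simp: dg_def block_def)
          then have *: "i' = r" "j \<in> block lam h" "k \<in> block lam h"
            using s jk(2) i p_inj by (auto simp: snd_m split: if_splits)
          then have "\<sigma> (r + 1, j) = \<sigma> (r, p k)"
            using eq i by (simp add: drag_def)
          then show False using stays * jk(2) by blast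
        qed
        then show ?thesis
          using True i by (auto simp: attacking_def fst_m height_m)
      next
        case False
        then have "j < k" using jk by blast
        then have lt: "height lam k < height lam j"
          using height_antimono[OF part, of j k] u v False by (auto simp: dg_def)
        \<comment> \<open>At different heights the taller column stands to the left, and the motion
          preserves heights.\<close>
        have "snd (?m ?u) < snd (?m ?v)"
        proof (rule ccontr)
          assume "\<not> snd (?m ?u) < snd (?m ?v)"
          then have "height lam (snd (?m ?u)) \<le> height lam (snd (?m ?v))"
            using cols[OF u] cols[OF v] by (intro height_antimono[OF part]) auto
          then show False
            using lt height_m[of ?u] height_m[of ?v] by simp
        qed
        then show ?thesis
          using i by (simp add: attacking_def fst_m)
      qed
    qed
    then show False
      using na m_neq eq u v dg_m unfolding non_attacking_def by auto
  qed
  moreover have "(\<sigma> \<circ> ?m) (top_box lam j) = \<sigma> (top_box lam j)" for j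
    using \<open>r < h\<close> by (auto simp: top_box_def drag_def block_def)
  then have "top_row_increasing lam (\<sigma> \<circ> ?m)"
    using top by (simp only: top_row_increasing_def)
  ultimately show ?thesis by (simp add: N_plus_def)
qed


lemma drag_apply:
  "i \<le> r \<Longrightarrow> j \<in> block lam h \<Longrightarrow> drag lam h r p (i, j) = (i, p j)"
  "r < i \<or> j \<notin> block lam h \<Longrightarrow> drag lam h r p (i, j) = (i, j)"
  by (auto simp: drag_def)

lemma block_disjoint: "j \<in> block lam h \<Longrightarrow> j \<in> block lam h' \<longleftrightarrow> h = h'"
  by (auto simp: block_def)

lemma row_set_drag:
  assumes "bij_betw p (block lam h) (block lam h)"
  shows "row_set lam (\<sigma> \<circ> drag lam h r p) = row_set lam \<sigma>"
proof (intro ext)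
  fix h' i
  show "row_set lam (\<sigma> \<circ> drag lam h r p) h' i = row_set lam \<sigma> h' i"
  proof (cases "h' = h \<and> i \<le> r")
    case True
    then have "row_set lam (\<sigma> \<circ> drag lam h r p) h' i = (\<lambda>j. \<sigma> (i, j)) ` p ` block lam h"
      unfolding row_set_def by (simp add: drag_apply image_image)
    then show ?thesis
      using assms True by (simp add: row_set_def bij_betw_def)
  next
    case False
    then have "drag lam h r p (i, j) = (i, j)" if "j \<in> block lam h'" for j
      using block_disjoint[OF that, of h] by (intro drag_apply(2)) auto
    then show ?thesis
      unfolding row_set_def by simp
  qed
qed

lemma card_Collect_permuted:
  assumes "bij_betw p C C"
  shows "card {j \<in> C. Q (p j)} = card {j \<in> C. Q j}"
proof -
  have inj: "inj_on p C" and im: "p ` C = C"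
    using assms by (simp_all add: bij_betw_def)
  have "{j \<in> C. Q j} = p ` {j \<in> C. Q (p j)}"
    by (subst im[symmetric]) blast
  moreover have "inj_on p {j \<in> C. Q (p j)}"
    using inj by (rule inj_on_subset) blast
  ultimately show ?thesis
    by (simp only: card_image)
qed

lemma row_descents_drag:
  assumes "bij_betw p (block lam h) (block lam h)" and "(h', i) \<noteq> (h, r)"
  shows "row_descents lam (\<sigma> \<circ> drag lam h r p) h' i = row_descents lam \<sigma> h' i"
proof (cases "h' = h \<and> i < r")
  case True
  then have "{j \<in> block lam h'. (\<sigma> \<circ> drag lam h r p) (i, j) < (\<sigma> \<circ> drag lam h r p) (i + 1, j)} =
      {j \<in> block lam h. \<sigma> (i, p j) < \<sigma> (i + 1, p j)}"
    by (auto simp: drag_apply)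
  then show ?thesis
    using card_Collect_permuted[OF assms(1), of "\<lambda>j. \<sigma> (i, j) < \<sigma> (i + 1, j)"] True
    by (simp add: row_descents_def)
next
  case False
  then have "drag lam h r p (i, j) = (i, j)" "drag lam h r p (i + 1, j) = (i + 1, j)"
    if "j \<in> block lam h'" for j
    using block_disjoint[OF that, of h] assms(2) by (auto intro!: drag_apply(2))
  then have "{j \<in> block lam h'. (\<sigma> \<circ> drag lam h r p) (i, j) < (\<sigma> \<circ> drag lam h r p) (i + 1, j)} =
      {j \<in> block lam h'. \<sigma> (i, j) < \<sigma> (i + 1, j)}"
    by auto
  then show ?thesis
    by (simp add: row_descents_def)
qed

lemma level_drag_other:
  assumes "h' \<noteq> h \<or> r < i"
  shows "level V lam (\<sigma> \<circ> drag lam h r p) h' i = level V lam \<sigma> h' i"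
  unfolding level_def
proof (rule pair_sum_cong[OF sorted_wrt_true])
  fix j k
  assume "j \<in> set (sorted_list_of_set (block lam h'))" "k \<in> set (sorted_list_of_set (block lam h'))"
  then have jk: "j \<in> block lam h'" "k \<in> block lam h'" by simp_all
  have "drag lam h r p (i, l) = (i, l)" "drag lam h r p (i + 1, l) = (i + 1, l)"
    if "l \<in> block lam h'" for l
    using assms block_disjoint[OF that, of h] by (auto intro!: drag_apply(2))
  then show "V ((\<sigma> \<circ> drag lam h r p) (i + 1, j)) ((\<sigma> \<circ> drag lam h r p) (i + 1, k))
      ((\<sigma> \<circ> drag lam h r p) (i, j)) ((\<sigma> \<circ> drag lam h r p) (i, k)) =
    V (\<sigma> (i + 1, j)) (\<sigma> (i + 1, k)) (\<sigma> (i, j)) (\<sigma> (i, k))"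
    using jk by simp
qed

lemma double_level:
  assumes "\<And>x y u v. V y x v u = V x y u v"
  shows "2 * level V lam \<sigma> h i = ordered_pair_sum
    (\<lambda>j k. V (\<sigma> (i + 1, j)) (\<sigma> (i + 1, k)) (\<sigma> (i, j)) (\<sigma> (i, k))) (block lam h)"
  unfolding level_def by (subst double_pair_sum) (auto simp: assms)

text \<open>The motion may reverse the order of two columns, hence the symmetry of \<open>V\<close>.
  The arc rule lacks it, and therefore levels are converted from the bottom upwards.\<close>

lemma level_drag_below:
  assumes "bij_betw p (block lam h) (block lam h)" and "i < r"
    and sym: "\<And>x y u v. V y x v u = V x y u v"
  shows "level V lam (\<sigma> \<circ> drag lam h r p) h i = level V lam \<sigma> h i"
proof -
  let ?g = "\<lambda>j k. V (\<sigma> (i + 1, j)) (\<sigma> (i + 1, k)) (\<sigma> (i, j)) (\<sigma> (i, k))"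
  have "2 * level V lam (\<sigma> \<circ> drag lam h r p) h i = ordered_pair_sum (\<lambda>j k. ?g (p j) (p k)) (block lam h)"
    unfolding double_level[of V, OF sym]
    using \<open>i < r\<close> by (intro ordered_pair_sum_cong) (simp add: drag_apply)
  also have "\<dots> = ordered_pair_sum ?g (p ` block lam h)"
    using assms(1) by (intro ordered_pair_sum_reindex[symmetric]) (simp add: bij_betw_def)
  also have "\<dots> = 2 * level V lam \<sigma> h i"
    using assms(1) by (simp add: double_level[of V, OF sym] bij_betw_def)
  finally show ?thesis by simp
qed

text \<open>\<open>N_plus lam\<close> is in general infinite, but an injection that preserves
  \<open>key\<close> permutes each finite fibre.\<close>

lemma bij_betw_by_finite_fibres:
  assumes "inj_on \<Phi> N" "\<Phi> ` N \<subseteq> N" and key: "\<And>x. x \<in> N \<Longrightarrow> key (\<Phi> x) = key x"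
    and fin: "\<And>k. finite {x \<in> N. key x = k}"
  shows "bij_betw \<Phi> N N"
proof -
  have "y \<in> \<Phi> ` N" if "y \<in> N" for y
  proof -
    let ?F = "{x \<in> N. key x = key y}"
    have "\<Phi> ` ?F = ?F"
    proof (rule endo_inj_surj[OF fin])
      show "\<Phi> ` ?F \<subseteq> ?F" using assms(2) key by auto
      show "inj_on \<Phi> ?F" using assms(1) by (rule inj_on_subset) auto
    qed
    then show ?thesis using that by blast
  qed
  then show ?thesis using assms(1,2) by (auto simp: bij_betw_def)
qed

lemma finite_fixed_row_sets: "finite {\<sigma> \<in> N_plus lam. row_set lam \<sigma> = K}"
proof (cases "\<exists>\<sigma>\<in>N_plus lam. row_set lam \<sigma> = K")
  case True
  then have finK: "finite (K h i)" for h i by (auto simp: row_set_def)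
  have "{\<sigma> \<in> N_plus lam. row_set lam \<sigma> = K} \<subseteq> (\<Pi>\<^sub>E (i, j)\<in>dg lam. K (height lam j) i)"
  proof
    fix \<sigma> assume "\<sigma> \<in> {\<sigma> \<in> N_plus lam. row_set lam \<sigma> = K}"
    then have \<sigma>: "\<sigma> \<in> extensional (dg lam)" "K = row_set lam \<sigma>"
      by (auto simp: N_plus_def positive_fillings_def PiE_def)
    show "\<sigma> \<in> (\<Pi>\<^sub>E (i, j)\<in>dg lam. K (height lam j) i)"
      unfolding PiE_def Pi_def using \<sigma> by (auto simp: mem_dg row_set_def)
  qed
  moreover have "finite (\<Pi>\<^sub>E (i, j)\<in>dg lam. K (height lam j) i)"
    by (rule finite_PiE) (auto simp: finK)
  ultimately show ?thesis by (rule finite_subset)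
next
  case False
  then have "{\<sigma> \<in> N_plus lam. row_set lam \<sigma> = K} = {}" by blast
  then show ?thesis by (simp only: finite.emptyI)
qed


lemma descents_image:
  assumes "inj_on a C"
  shows "descents (a ` C) f = card {j \<in> C. f (a j) < a j}"
proof -
  have "{x \<in> a ` C. f x < x} = a ` {j \<in> C. f (a j) < a j}" by blast
  moreover have "inj_on a {j \<in> C. f (a j) < a j}"
    using assms by (rule inj_on_subset) blast
  ultimately show ?thesis
    unfolding descents_def by (simp only: card_image)
qed

definition upper_row :: "nat list \<Rightarrow> filling \<Rightarrow> nat \<Rightarrow> nat \<Rightarrow> nat list" where
  "upper_row lam \<sigma> h r = map (\<lambda>j. \<sigma> (r + 1, j)) (sorted_list_of_set (block lam h))"

text \<open>An upper entry determines its column because the rows of a non-attacking filling have no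
  repetitions; its partner is the entry below.\<close>

definition row_matching :: "nat list \<Rightarrow> filling \<Rightarrow> nat \<Rightarrow> nat \<Rightarrow> nat \<Rightarrow> nat" where
  "row_matching lam \<sigma> h r =
     (\<lambda>x\<in>row_set lam \<sigma> h (r + 1). \<sigma> (r, inv_into (block lam h) (\<lambda>j. \<sigma> (r + 1, j)) x))"

lemma set_upper_row [simp]: "set (upper_row lam \<sigma> h r) = row_set lam \<sigma> h (r + 1)"
  by (simp add: upper_row_def row_set_def)

lemma distinct_upper_row:
  assumes "\<sigma> \<in> N_plus lam" "r < h"
  shows "distinct (upper_row lam \<sigma> h r)"
  using inj_on_row[OF assms(1), of "r + 1" h] assms(2) by (simp add: upper_row_def distinct_map)

lemma row_matching_apply:
  assumes "\<sigma> \<in> N_plus lam" "r < h" "j \<in> block lam h"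
  shows "row_matching lam \<sigma> h r (\<sigma> (r + 1, j)) = \<sigma> (r, j)"
proof -
  have "inj_on (\<lambda>j. \<sigma> (r + 1, j)) (block lam h)"
    using assms(2) by (intro inj_on_row[OF assms(1)]) auto
  then have "inv_into (block lam h) (\<lambda>j. \<sigma> (r + 1, j)) (\<sigma> (r + 1, j)) = j"
    using assms(3) by (rule inv_into_f_f)
  moreover have "\<sigma> (r + 1, j) \<in> row_set lam \<sigma> h (r + 1)"
    using assms(3) by (simp add: row_set_def)
  ultimately show ?thesis
    unfolding row_matching_def by (simp only: restrict_apply')
qed

lemma row_matching_in_matchings:
  assumes \<sigma>: "\<sigma> \<in> N_plus lam" and r: "1 \<le> r" "r < h"
  shows "row_matching lam \<sigma> h r \<in> matchings (row_set lam \<sigma> h (r + 1)) (row_set lam \<sigma> h r)"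
  unfolding matchings_iff
proof (intro conjI ballI impI)
  let ?f = "row_matching lam \<sigma> h r"
  note val = row_matching_apply[OF \<sigma> r(2)]
  show "?f \<in> extensional (row_set lam \<sigma> h (r + 1))"
    by (simp add: row_matching_def)
  show "inj_on ?f (row_set lam \<sigma> h (r + 1))"
  proof (rule inj_onI)
    fix x y assume "x \<in> row_set lam \<sigma> h (r + 1)" "y \<in> row_set lam \<sigma> h (r + 1)" and eq: "?f x = ?f y"
    then obtain j k where jk: "j \<in> block lam h" "x = \<sigma> (r + 1, j)" "k \<in> block lam h" "y = \<sigma> (r + 1, k)"
      unfolding row_set_def by blast
    then have "\<sigma> (r, j) = \<sigma> (r, k)" using eq val by simp
    then have "j = k"
      using inj_onD[OF inj_on_row[OF \<sigma>, of r h]] r jk by simp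
    then show "x = y" using jk by simp
  qed
  show "?f ` row_set lam \<sigma> h (r + 1) = row_set lam \<sigma> h r"
    unfolding row_set_def image_image by (rule image_cong) (simp_all only: val)
  fix x assume "x \<in> row_set lam \<sigma> h (r + 1)" "x \<in> row_set lam \<sigma> h r"
  then obtain j k where jk: "j \<in> block lam h" "x = \<sigma> (r + 1, j)" "k \<in> block lam h" "x = \<sigma> (r, k)"
    unfolding row_set_def by blast
  then have "j = k" using N_plus_same_column[OF \<sigma> jk(1,3) r] by simp
  then show "?f x = x" using val[OF jk(1)] jk by simp
qed

lemma level_arc_quad:
  assumes "\<sigma> \<in> N_plus lam" "r < h"
  shows "level arc_quad lam \<sigma> h r = pair_sum (along arc_quad (row_matching lam \<sigma> h r)) (upper_row lam \<sigma> h r)"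
  unfolding level_def upper_row_def pair_sum_map
proof (rule pair_sum_cong[OF sorted_wrt_true])
  fix j k
  assume "j \<in> set (sorted_list_of_set (block lam h))" "k \<in> set (sorted_list_of_set (block lam h))"
  then have "j \<in> block lam h" "k \<in> block lam h" by simp_all
  then show "arc_quad (\<sigma> (r + 1, j)) (\<sigma> (r + 1, k)) (\<sigma> (r, j)) (\<sigma> (r, k)) =
    along arc_quad (row_matching lam \<sigma> h r) (\<sigma> (r + 1, j)) (\<sigma> (r + 1, k))"
    by (simp only: row_matching_apply[OF assms])
qed

text \<open>The matching at the cut is replaced by its image under the arc-to-chord bijection, and
  the columns below are dragged so that they realise the new matching.\<close>

lemma level_change:
  assumes part: "is_partition lam" and r: "1 \<le> r" "r < h"
  obtains \<phi> where "bij_betw \<phi> (N_plus lam) (N_plus lam)"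
    and "\<And>\<sigma>. \<sigma> \<in> N_plus lam \<Longrightarrow> same_profile lam (\<phi> \<sigma>) \<sigma>"
    and "\<And>\<sigma>. \<sigma> \<in> N_plus lam \<Longrightarrow>
      level (chord_quad p y s) lam (\<phi> \<sigma>) h r = level arc_quad lam \<sigma> h r"
    and "\<And>\<sigma> V h' i. \<sigma> \<in> N_plus lam \<Longrightarrow> h' \<noteq> h \<or> r < i \<Longrightarrow>
      level V lam (\<phi> \<sigma>) h' i = level V lam \<sigma> h' i"
    and "\<And>\<sigma> i. \<sigma> \<in> N_plus lam \<Longrightarrow> i < r \<Longrightarrow>
      level (chord_quad p y s) lam (\<phi> \<sigma>) h i = level (chord_quad p y s) lam \<sigma> h i"
proof -
  let ?C = "block lam h" and ?W = "chord_quad p y s"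
  define P where "P = (\<lambda>xs B \<psi>. bij_betw \<psi> (matchings (set xs) B) (matchings (set xs) B) \<and>
      (\<forall>f\<in>matchings (set xs) B. (descents (set xs) (\<psi> f), ordered_pair_sum (along ?W (\<psi> f)) (set xs)) =
        (descents (set xs) f, 2 * pair_sum (along arc_quad f) xs)))"
  \<comment> \<open>The choice depends only on the upper row and on the set of lower entries, both
    of which are unchanged by the conversion.\<close>
  define \<psi> where "\<psi> = (\<lambda>xs B. SOME \<psi>. P xs B \<psi>)"
  have P: "P xs B (\<psi> xs B)" if "distinct xs" "finite B" for xs B
  proof -
    have "\<exists>\<psi>. P xs B \<psi>"
      using arc_chord_equidistributed[OF finite_set that(2,1) refl, of p y s]
      unfolding P_def equidistributed_def .
    then show ?thesis
      unfolding \<psi>_def by (rule someI_ex)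
  qed
  define A where "A = (\<lambda>\<sigma>. row_set lam \<sigma> h (r + 1))"
  define B where "B = (\<lambda>\<sigma>. row_set lam \<sigma> h r)"
  define f where "f = (\<lambda>\<sigma>. row_matching lam \<sigma> h r)"
  define f' where "f' = (\<lambda>\<sigma>. \<psi> (upper_row lam \<sigma> h r) (B \<sigma>) (f \<sigma>))"
  \<comment> \<open>Column \<open>j\<close> receives the lower part of the column whose entry in row
    \<open>r\<close> is the new partner of the entry at \<open>(r + 1, j)\<close>.\<close>
  define perm where "perm = (\<lambda>\<sigma> j. inv_into ?C (\<lambda>j. \<sigma> (r, j)) (f' \<sigma> (\<sigma> (r + 1, j))))"
  define \<Phi> where "\<Phi> = (\<lambda>\<sigma>. \<sigma> \<circ> drag lam h r (perm \<sigma>))"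
  have finB: "finite (B \<sigma>)" for \<sigma>
    by (simp add: B_def row_set_def)
  have \<psi>_bij: "bij_betw (\<psi> (upper_row lam \<sigma> h r) (B \<sigma>)) (matchings (A \<sigma>) (B \<sigma>)) (matchings (A \<sigma>) (B \<sigma>))"
    and \<psi>_stat: "\<And>f. f \<in> matchings (A \<sigma>) (B \<sigma>) \<Longrightarrow>
      (descents (A \<sigma>) (\<psi> (upper_row lam \<sigma> h r) (B \<sigma>) f),
        ordered_pair_sum (along ?W (\<psi> (upper_row lam \<sigma> h r) (B \<sigma>) f)) (A \<sigma>)) =
      (descents (A \<sigma>) f, 2 * pair_sum (along arc_quad f) (upper_row lam \<sigma> h r))"
    if "\<sigma> \<in> N_plus lam" for \<sigma>
    using P[OF distinct_upper_row[OF that r(2)] finB[of \<sigma>]] unfolding P_def set_upper_row A_def by blast+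
  have f: "f \<sigma> \<in> matchings (A \<sigma>) (B \<sigma>)" if "\<sigma> \<in> N_plus lam" for \<sigma>
    unfolding f_def A_def B_def by (rule row_matching_in_matchings[OF that r])
  have f': "f' \<sigma> \<in> matchings (A \<sigma>) (B \<sigma>)" if "\<sigma> \<in> N_plus lam" for \<sigma>
    unfolding f'_def by (rule bij_betw_apply[OF \<psi>_bij[OF that] f[OF that]])
  have f'_stat: "descents (A \<sigma>) (f' \<sigma>) = descents (A \<sigma>) (f \<sigma>)"
    "ordered_pair_sum (along ?W (f' \<sigma>)) (A \<sigma>) = 2 * pair_sum (along arc_quad (f \<sigma>)) (upper_row lam \<sigma> h r)"
    if "\<sigma> \<in> N_plus lam" for \<sigma>
    using \<psi>_stat[OF that f[OF that]] unfolding f'_def prod.inject by blast+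
  have f_apply: "f \<sigma> (\<sigma> (r + 1, j)) = \<sigma> (r, j)" if "\<sigma> \<in> N_plus lam" "j \<in> ?C" for \<sigma> j
    unfolding f_def by (rule row_matching_apply[OF that(1) r(2) that(2)])
  have a_inj: "inj_on (\<lambda>j. \<sigma> (r + 1, j)) ?C" if "\<sigma> \<in> N_plus lam" for \<sigma>
    using inj_on_row[OF that, of "r + 1" h] r by simp
  have aA: "\<sigma> (r + 1, j) \<in> A \<sigma>" if "j \<in> ?C" for \<sigma> j
    using that by (simp add: A_def row_set_def)
  have perm_in: "perm \<sigma> j \<in> ?C" and perm_apply: "\<sigma> (r, perm \<sigma> j) = f' \<sigma> (\<sigma> (r + 1, j))"
    if "\<sigma> \<in> N_plus lam" "j \<in> ?C" for \<sigma> j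
  proof -
    have "f' \<sigma> (\<sigma> (r + 1, j)) \<in> (\<lambda>j. \<sigma> (r, j)) ` ?C"
      using f'[OF that(1)] aA[OF that(2), of \<sigma>] unfolding matchings_iff B_def row_set_def by blast
    then show "perm \<sigma> j \<in> ?C" "\<sigma> (r, perm \<sigma> j) = f' \<sigma> (\<sigma> (r + 1, j))"
      unfolding perm_def by (rule inv_into_into, rule f_inv_into_f)
  qed
  have perm: "bij_betw (perm \<sigma>) ?C ?C" if "\<sigma> \<in> N_plus lam" for \<sigma>
  proof -
    have "inj_on (perm \<sigma>) ?C"
    proof (rule inj_onI)
      fix j k assume jk: "j \<in> ?C" "k \<in> ?C" "perm \<sigma> j = perm \<sigma> k"
      then have "f' \<sigma> (\<sigma> (r + 1, j)) = f' \<sigma> (\<sigma> (r + 1, k))"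
        using perm_apply[OF that] by metis
      then have "\<sigma> (r + 1, j) = \<sigma> (r + 1, k)"
        by (rule matchings_inj[OF f'[OF that] aA[OF jk(1)] aA[OF jk(2)]])
      then show "j = k" using inj_onD[OF a_inj[OF that]] jk by blast
    qed
    moreover have "perm \<sigma> ` ?C \<subseteq> ?C" using perm_in[OF that] by blast
    ultimately show ?thesis
      unfolding bij_betw_def using endo_inj_surj[OF finite_block] by blast
  qed
  have \<Phi>_in: "\<Phi> \<sigma> \<in> N_plus lam" if "\<sigma> \<in> N_plus lam" for \<sigma>
    unfolding \<Phi>_def
  proof (rule drag_N_plus[OF part that r perm[OF that]])
    fix j k assume jk: "j \<in> ?C" "k \<in> ?C" "\<sigma> (r + 1, j) = \<sigma> (r, perm \<sigma> k)"
    then have "f' \<sigma> (\<sigma> (r + 1, k)) = \<sigma> (r + 1, j)"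
      using perm_apply[OF that] by simp
    \<comment> \<open>The new partner of the entry at \<open>(r + 1, k)\<close> is itself an entry
      of row \<open>r + 1\<close>, hence a fixed point of the new matching.\<close>
    then have "\<sigma> (r + 1, k) = \<sigma> (r + 1, j)"
      using matchings_fixed[OF f'[OF that] aA[OF jk(2)]] aA[OF jk(1), of \<sigma>] by simp
    then show "j = k" using inj_onD[OF a_inj[OF that]] jk by blast
  qed
  have \<Phi>_upper: "\<Phi> \<sigma> (i, j) = \<sigma> (i, j)" if "r < i \<or> j \<notin> ?C" for \<sigma> i j
    unfolding \<Phi>_def using drag_apply(2)[OF that] by simp
  have \<Phi>_lower: "\<Phi> \<sigma> (i, j) = \<sigma> (i, perm \<sigma> j)" if "i \<le> r" "j \<in> ?C" for \<sigma> i j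
    unfolding \<Phi>_def using drag_apply(1)[OF that] by simp
  have \<Phi>_row: "\<Phi> \<sigma> (r, j) = f' \<sigma> (\<sigma> (r + 1, j))" if "\<sigma> \<in> N_plus lam" "j \<in> ?C" for \<sigma> j
    using \<Phi>_lower[of r j] perm_apply[OF that] that(2) by simp
  have rows: "row_set lam (\<Phi> \<sigma>) = row_set lam \<sigma>" if "\<sigma> \<in> N_plus lam" for \<sigma>
    unfolding \<Phi>_def by (rule row_set_drag[OF perm[OF that]])
  have profile: "same_profile lam (\<Phi> \<sigma>) \<sigma>" if \<sigma>: "\<sigma> \<in> N_plus lam" for \<sigma>
  proof -
    have "row_descents lam (\<Phi> \<sigma>) h r = card {j \<in> ?C. f' \<sigma> (\<sigma> (r + 1, j)) < \<sigma> (r + 1, j)}"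
      unfolding row_descents_def using \<Phi>_row[OF \<sigma>] \<Phi>_upper[of "r + 1"] by (auto intro!: arg_cong[of _ _ card])
    also have "\<dots> = descents (A \<sigma>) (f' \<sigma>)"
      unfolding A_def row_set_def by (rule descents_image[OF a_inj[OF \<sigma>], symmetric])
    also have "\<dots> = descents (A \<sigma>) (f \<sigma>)" by (rule f'_stat(1)[OF \<sigma>])
    also have "\<dots> = card {j \<in> ?C. f \<sigma> (\<sigma> (r + 1, j)) < \<sigma> (r + 1, j)}"
      unfolding A_def row_set_def by (rule descents_image[OF a_inj[OF \<sigma>]])
    also have "\<dots> = row_descents lam \<sigma> h r"
      unfolding row_descents_def using f_apply[OF \<sigma>] by (auto intro!: arg_cong[of _ _ card])
    finally have "row_descents lam (\<Phi> \<sigma>) h r = row_descents lam \<sigma> h r" .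
    then have "row_descents lam (\<Phi> \<sigma>) h' i = row_descents lam \<sigma> h' i" for h' i
      using row_descents_drag[OF perm[OF \<sigma>], of h' i r \<sigma>] unfolding \<Phi>_def by (cases "(h', i) = (h, r)") auto
    then show ?thesis
      unfolding same_profile_def using rows[OF \<sigma>] by blast
  qed
  \<comment> \<open>The preimage is recovered in stages: the unmoved boxes, then the new matching,
    by injectivity of the chosen bijection the old one and thus row \<open>r\<close>, then the
    permutation, and finally all lower rows.\<close>
  have "inj_on \<Phi> (N_plus lam)"
  proof (rule inj_onI)
    fix \<sigma> \<tau> assume \<sigma>: "\<sigma> \<in> N_plus lam" and \<tau>: "\<tau> \<in> N_plus lam" and eq: "\<Phi> \<sigma> = \<Phi> \<tau>"
    have upper: "\<sigma> (i, j) = \<tau> (i, j)" if "r < i \<or> j \<notin> ?C" for i j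
      using \<Phi>_upper[OF that, of \<sigma>] \<Phi>_upper[OF that, of \<tau>] eq by simp
    have xs: "upper_row lam \<sigma> h r = upper_row lam \<tau> h r"
      unfolding upper_row_def by (simp add: upper)
    have AB: "A \<sigma> = A \<tau>" "B \<sigma> = B \<tau>"
      using rows[OF \<sigma>] rows[OF \<tau>] eq by (simp_all add: A_def B_def)
    have f'_eq: "f' \<sigma> = f' \<tau>"
    proof (rule extensionalityI[of _ "A \<sigma>"])
      show "f' \<sigma> \<in> extensional (A \<sigma>)" "f' \<tau> \<in> extensional (A \<sigma>)"
        using f'[OF \<sigma>] f'[OF \<tau>] AB unfolding matchings_iff by simp_all
      fix x assume "x \<in> A \<sigma>"
      then obtain j where j: "j \<in> ?C" "x = \<sigma> (r + 1, j)"
        unfolding A_def row_set_def by blast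
      then have "x = \<tau> (r + 1, j)" using upper by simp
      then show "f' \<sigma> x = f' \<tau> x"
        using \<Phi>_row[OF \<sigma> j(1)] \<Phi>_row[OF \<tau> j(1)] eq j(2) by simp
    qed
    have "inj_on (\<psi> (upper_row lam \<sigma> h r) (B \<sigma>)) (matchings (A \<sigma>) (B \<sigma>))"
      by (rule bij_betw_imp_inj_on[OF \<psi>_bij[OF \<sigma>]])
    moreover have "\<psi> (upper_row lam \<sigma> h r) (B \<sigma>) (f \<sigma>) = \<psi> (upper_row lam \<sigma> h r) (B \<sigma>) (f \<tau>)"
      using f'_eq xs AB by (simp add: f'_def)
    ultimately have "f \<sigma> = f \<tau>"
      using f[OF \<sigma>] f[OF \<tau>] AB by (auto dest: inj_onD)
    then have row: "\<sigma> (r, j) = \<tau> (r, j)" if "j \<in> ?C" for j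
      using f_apply[OF \<sigma> that] f_apply[OF \<tau> that] upper[of "r + 1" j] by simp
    have perm_eq: "perm \<sigma> j = perm \<tau> j" if "j \<in> ?C" for j
    proof -
      have "\<sigma> (r, perm \<sigma> j) = \<sigma> (r, perm \<tau> j)"
        using perm_apply[OF \<sigma> that] perm_apply[OF \<tau> that] f'_eq upper[of "r + 1" j]
          row[OF perm_in[OF \<tau> that]] by simp
      then show ?thesis
        using inj_onD[OF inj_on_row[OF \<sigma>, of r h]] r perm_in[OF \<sigma> that] perm_in[OF \<tau> that] by simp
    qed
    show "\<sigma> = \<tau>"
    proof (rule ext)
      fix u :: box
      obtain i j where u: "u = (i, j)" by (cases u)
      show "\<sigma> u = \<tau> u"
      proof (cases "r < i \<or> j \<notin> ?C")
        case True
        then show ?thesis using upper u by blast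
      next
        case False
        then obtain k where k: "k \<in> ?C" "j = perm \<sigma> k"
          using perm[OF \<sigma>] unfolding bij_betw_def by blast
        then show ?thesis
          using \<Phi>_lower[of i k \<sigma>] \<Phi>_lower[of i k \<tau>] perm_eq[OF k(1)] eq False u by simp
      qed
    qed
  qed
  then have "bij_betw \<Phi> (N_plus lam) (N_plus lam)"
    by (rule bij_betw_by_finite_fibres[where key = "row_set lam"])
      (auto simp: \<Phi>_in rows finite_fixed_row_sets)
  moreover have "level ?W lam (\<Phi> \<sigma>) h r = level arc_quad lam \<sigma> h r" if \<sigma>: "\<sigma> \<in> N_plus lam" for \<sigma>
  proof -
    have "2 * level ?W lam (\<Phi> \<sigma>) h r =
        ordered_pair_sum (\<lambda>j k. along ?W (f' \<sigma>) (\<sigma> (r + 1, j)) (\<sigma> (r + 1, k))) ?C"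
      unfolding double_level[of ?W, OF chord_quad_sym]
      by (rule ordered_pair_sum_cong) (use \<Phi>_row[OF \<sigma>] \<Phi>_upper[of "r + 1"] in simp)
    also have "\<dots> = ordered_pair_sum (along ?W (f' \<sigma>)) (A \<sigma>)"
      unfolding A_def row_set_def by (rule ordered_pair_sum_reindex[OF a_inj[OF \<sigma>], symmetric])
    also have "\<dots> = 2 * level arc_quad lam \<sigma> h r"
      using f'_stat(2)[OF \<sigma>] level_arc_quad[OF \<sigma> r(2)] by (simp only: f_def)
    finally show ?thesis by simp
  qed
  moreover have "level V lam (\<Phi> \<sigma>) h' i = level V lam \<sigma> h' i" if "h' \<noteq> h \<or> r < i" for \<sigma> V h' i
    unfolding \<Phi>_def by (rule level_drag_other[OF that])
  moreover have "level ?W lam (\<Phi> \<sigma>) h i = level ?W lam \<sigma> h i" if "\<sigma> \<in> N_plus lam" "i < r" for \<sigma> i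
    unfolding \<Phi>_def by (rule level_drag_below[OF perm[OF that(1)] that(2) chord_quad_sym])
  ultimately show ?thesis using that profile by blast
qed

section \<open>Converting all levels\<close>

lemma same_profile_trans: "same_profile lam \<sigma> \<tau> \<Longrightarrow> same_profile lam \<tau> \<rho> \<Longrightarrow> same_profile lam \<sigma> \<rho>"
  by (simp add: same_profile_def)

text \<open>The set \<open>P\<close> records the levels \<open>(h, r)\<close> already converted; the
  others still carry the arc statistic. Only inner levels \<open>1 \<le> r < h\<close> are
  tracked.\<close>

definition convertible :: "bool \<Rightarrow> bool \<Rightarrow> bool \<Rightarrow> nat list \<Rightarrow> (nat \<times> nat) set \<Rightarrow> bool" where
  "convertible p y s lam P \<longleftrightarrow> (\<exists>\<phi>. bij_betw \<phi> (N_plus lam) (N_plus lam) \<and>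
     (\<forall>\<sigma>\<in>N_plus lam. same_profile lam (\<phi> \<sigma>) \<sigma> \<and>
       (\<forall>h r. 1 \<le> r \<longrightarrow> r < h \<longrightarrow>
         level (if (h, r) \<in> P then chord_quad p y s else arc_quad) lam (\<phi> \<sigma>) h r =
         level arc_quad lam \<sigma> h r)))"

lemma convertible_cong:
  assumes "convertible p y s lam P" and "\<And>h r. 1 \<le> r \<Longrightarrow> r < h \<Longrightarrow> (h, r) \<in> P \<longleftrightarrow> (h, r) \<in> P'"
  shows "convertible p y s lam P'"
  using assms unfolding convertible_def by simp

lemma convertible_empty: "convertible p y s lam {}"
  unfolding convertible_def by (intro exI[of _ id]) (simp add: same_profile_def)

text \<open>Levels below \<open>r\<close> in the same rectangle must already carry the symmetric
  rule to survive the dragging; levels above it and those of other rectangles are untouched.\<close>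

lemma convertible_insert:
  assumes part: "is_partition lam" and conv: "convertible p y s lam P" and r: "1 \<le> r" "r < h"
    and new: "(h, r) \<notin> P" and below: "\<And>i. 1 \<le> i \<Longrightarrow> i < r \<Longrightarrow> (h, i) \<in> P"
  shows "convertible p y s lam (insert (h, r) P)"
proof -
  let ?W = "chord_quad p y s" and ?V = "\<lambda>P u. if u \<in> P then chord_quad p y s else arc_quad"
  obtain \<phi> where \<phi>: "bij_betw \<phi> (N_plus lam) (N_plus lam)"
    "\<And>\<sigma>. \<sigma> \<in> N_plus lam \<Longrightarrow> same_profile lam (\<phi> \<sigma>) \<sigma>"
    "\<And>\<sigma> h r. \<sigma> \<in> N_plus lam \<Longrightarrow> 1 \<le> r \<Longrightarrow> r < h \<Longrightarrow>
      level (?V P (h, r)) lam (\<phi> \<sigma>) h r = level arc_quad lam \<sigma> h r"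
    using conv unfolding convertible_def by blast
  obtain \<psi> where \<psi>: "bij_betw \<psi> (N_plus lam) (N_plus lam)"
    "\<And>\<sigma>. \<sigma> \<in> N_plus lam \<Longrightarrow> same_profile lam (\<psi> \<sigma>) \<sigma>"
    "\<And>\<sigma>. \<sigma> \<in> N_plus lam \<Longrightarrow> level ?W lam (\<psi> \<sigma>) h r = level arc_quad lam \<sigma> h r"
    "\<And>\<sigma> V h' i. \<sigma> \<in> N_plus lam \<Longrightarrow> h' \<noteq> h \<or> r < i \<Longrightarrow> level V lam (\<psi> \<sigma>) h' i = level V lam \<sigma> h' i"
    "\<And>\<sigma> i. \<sigma> \<in> N_plus lam \<Longrightarrow> i < r \<Longrightarrow> level ?W lam (\<psi> \<sigma>) h i = level ?W lam \<sigma> h i"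
    by (rule level_change[OF part r, where p = p and y = y and s = s]) (rule that)
  have "bij_betw (\<psi> \<circ> \<phi>) (N_plus lam) (N_plus lam)"
    by (rule bij_betw_trans[OF \<phi>(1) \<psi>(1)])
  moreover have "same_profile lam ((\<psi> \<circ> \<phi>) \<sigma>) \<sigma> \<and> (\<forall>h' i. 1 \<le> i \<longrightarrow> i < h' \<longrightarrow>
      level (?V (insert (h, r) P) (h', i)) lam ((\<psi> \<circ> \<phi>) \<sigma>) h' i = level arc_quad lam \<sigma> h' i)"
    if \<sigma>: "\<sigma> \<in> N_plus lam" for \<sigma>
  proof (intro conjI allI impI)
    have \<phi>\<sigma>: "\<phi> \<sigma> \<in> N_plus lam" by (rule bij_betw_apply[OF \<phi>(1) \<sigma>])
    show "same_profile lam ((\<psi> \<circ> \<phi>) \<sigma>) \<sigma>"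
      using same_profile_trans[OF \<psi>(2)[OF \<phi>\<sigma>] \<phi>(2)[OF \<sigma>]] by simp
    fix h' i :: nat assume i: "1 \<le> i" "i < h'"
    consider "h' = h" "i = r" | "h' = h" "i < r" | "h' \<noteq> h \<or> r < i" by linarith
    then show "level (?V (insert (h, r) P) (h', i)) lam ((\<psi> \<circ> \<phi>) \<sigma>) h' i = level arc_quad lam \<sigma> h' i"
    proof cases
      case 1
      then show ?thesis using \<psi>(3)[OF \<phi>\<sigma>] \<phi>(3)[OF \<sigma> r] new by simp
    next
      case 2
      then show ?thesis using \<psi>(5)[OF \<phi>\<sigma>, of i] \<phi>(3)[OF \<sigma> i] below[OF i(1)] by simp
    next
      case 3
      then have "(h', i) \<noteq> (h, r)" by auto
      then have "?V (insert (h, r) P) (h', i) = ?V P (h', i)" by (simp only: insert_iff simp_thms)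
      then show ?thesis using \<psi>(4)[OF \<phi>\<sigma> 3] \<phi>(3)[OF \<sigma> i] by (simp only: comp_apply)
    qed
  qed
  ultimately show ?thesis
    unfolding convertible_def by blast
qed

text \<open>Rectangles are treated by increasing height, each from the bottom upwards.\<close>

lemma convertible_up_to:
  assumes part: "is_partition lam" and "n \<le> h"
  shows "convertible p y s lam {(h', i). h' < h \<or> h' = h \<and> i < n}"
  using \<open>n \<le> h\<close>
proof (induction h arbitrary: n)
  case 0
  then show ?case
    by (intro convertible_cong[OF convertible_empty]) auto
next
  case (Suc h)
  from Suc.prems show ?case
  proof (induction n)
    case 0
    \<comment> \<open>The outer hypothesis with \<open>n = h\<close> covers every inner level of
      height \<open>h\<close>.\<close>
    show ?case
      by (rule convertible_cong[OF Suc.IH[OF order_refl]]) auto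
  next
    case (Suc n)
    then have IH: "convertible p y s lam {(h', i). h' < Suc h \<or> h' = Suc h \<and> i < n}" by simp
    show ?case
    proof (cases "n = 0")
      case True
      \<comment> \<open>Level 0 is not an inner level, so nothing is to be converted.\<close>
      then show ?thesis by (intro convertible_cong[OF IH]) auto
    next
      case False
      show ?thesis
        by (rule convertible_cong[OF convertible_insert[OF part IH, of n "Suc h"]])
          (use False Suc.prems in auto)
    qed
  qed
qed

lemma block_empty: "sum_list lam < h \<Longrightarrow> block lam h = {}"
proof -
  assume "sum_list lam < h"
  moreover have "height lam j \<le> sum_list lam" if "j \<in> {1..length lam}" for j
    using that unfolding height_def by (intro member_le_sum_list) auto
  ultimately show ?thesis
    unfolding block_def by force
qed

lemma level_conversion:
  assumes "is_partition lam"
  obtains \<phi> where "bij_betw \<phi> (N_plus lam) (N_plus lam)"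
    and "\<And>\<sigma>. \<sigma> \<in> N_plus lam \<Longrightarrow> same_profile lam (\<phi> \<sigma>) \<sigma>"
    and "\<And>\<sigma> h r. \<sigma> \<in> N_plus lam \<Longrightarrow> 1 \<le> r \<Longrightarrow> r < h \<Longrightarrow>
      level (chord_quad p y s) lam (\<phi> \<sigma>) h r = level arc_quad lam \<sigma> h r"
proof -
  \<comment> \<open>The sum of the parts is a crude bound for the heights; beyond it all blocks are
    empty.\<close>
  let ?P = "{(h', i). h' < Suc (sum_list lam) \<or> h' = Suc (sum_list lam) \<and> i < 0}"
  obtain \<phi> where \<phi>: "bij_betw \<phi> (N_plus lam) (N_plus lam)"
    "\<And>\<sigma>. \<sigma> \<in> N_plus lam \<Longrightarrow> same_profile lam (\<phi> \<sigma>) \<sigma>"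
    "\<And>\<sigma> h r. \<sigma> \<in> N_plus lam \<Longrightarrow> 1 \<le> r \<Longrightarrow> r < h \<Longrightarrow>
      level (if (h, r) \<in> ?P then chord_quad p y s else arc_quad) lam (\<phi> \<sigma>) h r = level arc_quad lam \<sigma> h r"
    using convertible_up_to[OF assms le0, of p y s "Suc (sum_list lam)"] unfolding convertible_def by blast
  have "level (chord_quad p y s) lam (\<phi> \<sigma>) h r = level arc_quad lam \<sigma> h r"
    if "\<sigma> \<in> N_plus lam" "1 \<le> r" "r < h" for \<sigma> h r
  proof (cases "h \<le> sum_list lam")
    case True
    then show ?thesis using \<phi>(3)[OF that] by simp
  next
    case False
    then show ?thesis by (simp add: level_def block_empty)
  qed
  with \<phi>(1,2) show ?thesis by (rule that)
qed

section \<open>Sums over the diagram\<close>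

text \<open>Stated for a general commutative monoid so that it serves the sum in \<open>maj\<close>
  and the product in \<open>c_weight\<close> alike.\<close>

lemma (in comm_monoid_set) F_dg:
  "F g (dg lam) = F (\<lambda>h. F (\<lambda>i. F (\<lambda>j. g (i, j)) (block lam h)) {1..h}) (set lam)"
proof -
  have "F (\<lambda>h. F (\<lambda>i. F (\<lambda>j. g (i, j)) (block lam h)) {1..h}) (set lam) =
      F (\<lambda>h. F (\<lambda>(i, j). g (i, j)) ({1..h} \<times> block lam h)) (set lam)"
    by (simp add: cartesian_product)
  also have "\<dots> = F (\<lambda>(h, i, j). g (i, j)) (SIGMA h:set lam. {1..h} \<times> block lam h)"
    by (subst Sigma) (auto simp: case_prod_unfold)
  also have "\<dots> = F g (dg lam)"
  proof (rule reindex_bij_witness[where i = "\<lambda>(i, j). (height lam j, i, j)" and j = snd])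
    fix u assume "u \<in> dg lam"
    moreover obtain i j where "u = (i, j)" by (cases u)
    ultimately show "(\<lambda>(i, j). (height lam j, i, j)) u \<in> (SIGMA h:set lam. {1..h} \<times> block lam h)"
      by (auto simp: dg_def block_def height_def)
  qed (auto simp: dg_def block_def)
  finally show ?thesis by simp
qed

lemma pair_sum_strictly_sorted:
  "sorted_wrt (<) xs \<Longrightarrow> pair_sum g xs = (\<Sum>j\<in>set xs. \<Sum>k\<in>{k \<in> set xs. j < k}. g j k)"
  for xs :: "'a :: linorder list"
proof (induction xs)
  case (Cons x xs)
  have dist: "distinct xs" and x: "x \<notin> set xs" "\<forall>y\<in>set xs. x < y"
    using Cons.prems by (auto simp: strict_sorted_iff)
  have "(\<Sum>k\<in>{k \<in> set (x # xs). x < k}. g x k) = sum_list (map (g x) xs)"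
  proof -
    have "{k \<in> set (x # xs). x < k} = set xs" using x by auto
    then show ?thesis using dist by (simp add: sum_list_distinct_conv_sum_set)
  qed
  moreover have "(\<Sum>k\<in>{k \<in> set (x # xs). j < k}. g j k) = (\<Sum>k\<in>{k \<in> set xs. j < k}. g j k)"
    if "j \<in> set xs" for j
  proof -
    have "{k \<in> set (x # xs). j < k} = {k \<in> set xs. j < k}" using x that by force
    then show ?thesis by simp
  qed
  ultimately show ?case
    using Cons x by simp
qed simp

lemma finite_quad_positions [simp]: "finite (quad_positions lam)"
proof (rule finite_subset)
  show "quad_positions lam \<subseteq> (\<Union>j\<in>{1..length lam}. {0..height lam j} \<times> {j} \<times> {1..length lam})"
    by (auto simp: quad_positions_def)
qed auto

lemma card_quad_positions:
  "card {u \<in> quad_positions lam. \<Phi> u} =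
    (\<Sum>h\<in>set lam. \<Sum>r\<in>{0..h}. pair_sum (\<lambda>j k. of_bool (\<Phi> (r, j, k))) (sorted_list_of_set (block lam h)))"
proof -
  let ?P = "\<lambda>h. SIGMA j:block lam h. {k \<in> block lam h. j < k}"
  have "card {u \<in> quad_positions lam. \<Phi> u} = (\<Sum>u\<in>quad_positions lam. of_bool (\<Phi> u))"
    by (simp add: sum.If_cases of_bool_def Int_def)
  also have "\<dots> = (\<Sum>(h, r, j, k)\<in>(SIGMA h:set lam. {0..h} \<times> ?P h). of_bool (\<Phi> (r, j, k)))"
  proof (rule sum.reindex_bij_witness[where i = snd and j = "\<lambda>(r, j, k). (height lam j, r, j, k)"])
    fix u assume "u \<in> quad_positions lam"
    moreover obtain r j k where "u = (r, j, k)" by (cases u)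
    ultimately show "(\<lambda>(r, j, k). (height lam j, r, j, k)) u \<in> (SIGMA h:set lam. {0..h} \<times> ?P h)"
      by (auto simp: quad_positions_def block_def height_def)
  qed (auto simp: quad_positions_def block_def)
  also have "\<dots> = (\<Sum>h\<in>set lam. \<Sum>(r, j, k)\<in>{0..h} \<times> ?P h. of_bool (\<Phi> (r, j, k)))"
    by (subst sum.Sigma) auto
  also have "\<dots> = (\<Sum>h\<in>set lam. \<Sum>r\<in>{0..h}. \<Sum>(j, k)\<in>?P h. of_bool (\<Phi> (r, j, k)))"
    by (simp only: sum.cartesian_product)
  also have "\<dots> = (\<Sum>h\<in>set lam. \<Sum>r\<in>{0..h}. \<Sum>j\<in>block lam h. \<Sum>k\<in>{k \<in> block lam h. j < k}. of_bool (\<Phi> (r, j, k)))"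
    by (subst sum.Sigma) auto
  finally show ?thesis
    by (simp add: pair_sum_strictly_sorted)
qed

section \<open>Values of the rules on augmented fillings\<close>

text \<open>If \<open>a > b\<close>, the other two conditions must fail, which says
  \<open>b < c < a\<close>. Otherwise exactly one of them holds, which puts \<open>c\<close> below
  \<open>a\<close> or above \<open>b\<close>.\<close>

lemma Q3_enat:
  assumes "c \<noteq> a" "c \<noteq> b"
  shows "Q3 (enat a) (enat b) (enat c) = of_bool (arc a b c)"
proof -
  have "Q3 (enat a) (enat b) (enat c) = 1 \<longleftrightarrow> arc a b c"
    using assms by (cases "a \<le> b"; cases "c < a"; cases "c < b") (auto simp: Q3_def I_ind_def arc_def)
  then show ?thesis by (auto simp: Q3_def)
qed

text \<open>The hypotheses are what non-attacking guarantees, so only \<open>z = u\<close> and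
  \<open>w = v\<close> remain as coincidences. Both give 1: for \<open>z = u\<close> the arc is the
  whole circle without \<open>z\<close>, and for \<open>w = v\<close> alone the first clause
  applies.\<close>

lemma Q4_enat:
  assumes "z \<noteq> w" "u \<noteq> v" "w \<noteq> u" "z \<noteq> v"
  shows "Q4 (enat z) (enat w) (enat u) (enat v) = arc_quad z w u v"
proof (cases "z = u \<or> w = v")
  case True
  have "arc z z v" "Q3 (enat z) (enat z) (enat v) = of_bool (arc z z v)"
    using assms Q3_enat[of v z z] by (auto simp: arc_def)
  then show ?thesis
    using True assms by (auto simp: Q4_def arc_quad_def)
next
  case False
  then show ?thesis
    using assms by (simp add: Q4_def arc_quad_def Q3_enat)
qed

text \<open>On distinct entries weak and strict inequalities agree, and no ordering of
  \<open>S_star\<close> holds because each demands \<open>z = w\<close>.\<close>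

lemma Q_S_enat:
  assumes "S \<in> S_systems"
  obtains p y s where "\<And>z w u v. distinct [z, w, u, v] \<Longrightarrow>
    Q_S S (enat z) (enat w) (enat u) (enat v) = 1 \<longleftrightarrow> chord_rule p y s z w u v \<or> chord_rule p y s w z v u"
proof -
  have star: "\<not> (\<exists>P\<in>S_star. P (enat z) (enat w) (enat u) (enat v))" if "z \<noteq> w" for z w u v
    using that by (simp add: S_star_def)
  define T where "T = (\<lambda>p y s. S_common \<union> (if p then X1 else X2) \<union> (if y then Y1 else Y2) \<union> (if s then Z1 else Z2))"
  obtain p y s where S: "S = T p y s"
  proof -
    have "S = T True True True \<or> S = T True False True \<or> S = T False True True \<or> S = T False False True \<or>
        S = T True True False \<or> S = T False True False \<or> S = T True False False \<or> S = T False False False"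
      using assms unfolding S_systems_def T_def by simp
    then show ?thesis using that by blast
  qed
  have "(\<exists>P\<in>T p y s. P (enat z) (enat w) (enat u) (enat v)) \<longleftrightarrow> chord_rule p y s z w u v"
    if "distinct [z, w, u, v]" for z w u v
    using that unfolding T_def chord_rule_def S_common_def X1_def X2_def Y1_def Y2_def Z1_def Z2_def
    by (cases p; cases y; cases s) (simp add: order_le_less disj_ac)+
  note rule = this
  have "Q_S S (enat z) (enat w) (enat u) (enat v) = 1 \<longleftrightarrow>
      chord_rule p y s z w u v \<or> chord_rule p y s w z v u"
    if d: "distinct [z, w, u, v]" for z w u v
  proof -
    have "z \<noteq> w" and d': "distinct [w, z, v, u]" using d by auto
    then have "(\<exists>P\<in>S_star. P (enat z) (enat w) (enat u) (enat v)) = False"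
      using star by blast
    then show ?thesis
      unfolding S Q_S_def by (simp only: rule[OF d] rule[OF d']) simp
  qed
  then show ?thesis by (rule that)
qed

text \<open>At \<open>r = 0\<close> both lower entries are infinite: the last two conditions of
  \<open>Q3\<close> hold together, so the position does not count.\<close>

lemma Q4_bottom: "z \<noteq> w \<Longrightarrow> Q4 (enat z) (enat w) \<infinity> \<infinity> \<noteq> 1"
  by (simp add: Q4_def Q3_def I_ind_def)

lemma Q_S_bottom:
  assumes "S \<in> S_systems" "z \<noteq> w"
  shows "Q_S S (enat z) (enat w) \<infinity> \<infinity> \<noteq> 1"
  using assms by (auto simp: Q_S_def S_star_def S_systems_def S_common_def X1_def X2_def Y1_def Y2_def Z1_def Z2_def)

text \<open>At \<open>r = h\<close> both upper entries are 0; a strictly increasing top row makes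
  every such position count.\<close>

lemma Q4_top: "0 < u \<Longrightarrow> u < v \<Longrightarrow> Q4 0 0 (enat u) (enat v) = 1"
  by (simp add: Q4_def Q3_def I_ind_def zero_enat_def)

section \<open>Decomposition of the quadruple statistics\<close>

text \<open>Heights decrease weakly, so the columns of one height form an interval, and a larger run
  would have to keep that height.\<close>

lemma block_rectangle:
  assumes part: "is_partition lam" and "block lam h \<noteq> {}"
  shows "block lam h \<in> rectangles lam"
proof -
  let ?C = "block lam h"
  let ?a = "Min ?C" and ?b = "Max ?C"
  have ab: "?a \<in> ?C" "?b \<in> ?C" using assms(2) by (simp_all add: Min_in Max_in)
  have "?C = {?a..?b}"
  proof
    show "?C \<subseteq> {?a..?b}" by auto
    show "{?a..?b} \<subseteq> ?C"
    proof
      fix j assume j: "j \<in> {?a..?b}"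
      have cols: "1 \<le> ?a" "?b \<le> length lam" "height lam ?a = h" "height lam ?b = h"
        using ab by (auto simp: block_def)
      then have "height lam ?b \<le> height lam j" "height lam j \<le> height lam ?a"
        using j height_antimono[OF part, of j ?b] height_antimono[OF part, of ?a j] by auto
      then show "j \<in> ?C" using j cols by (auto simp: block_def)
    qed
  qed
  then have "equal_height_run lam ?C"
    using assms(2) unfolding equal_height_run_def by (auto simp: block_def)
  moreover have "D = ?C" if "equal_height_run lam D" "?C \<subseteq> D" for D
  proof
    show "D \<subseteq> ?C"
    proof
      fix k assume "k \<in> D"
      then have "k \<in> {1..length lam}" "height lam k = height lam ?a"
        using that ab(1) unfolding equal_height_run_def by blast+
      then show "k \<in> ?C" using ab(1) by (simp add: block_def)
    qed
  qed (rule that(2))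
  ultimately show ?thesis unfolding rectangles_def by blast
qed

lemma rectangle_columns:
  assumes "C \<in> rectangles lam"
  shows "C \<subseteq> {1..length lam}"
  using assms by (simp add: rectangles_def equal_height_run_def)

lemma mem_block:
  assumes "j \<in> block lam h"
  shows "1 \<le> i \<Longrightarrow> i \<le> h \<Longrightarrow> (i, j) \<in> dg lam"
  using assms by (auto simp: dg_def block_def)

lemma top_row_strictly_increasing:
  assumes part: "is_partition lam" and \<sigma>: "\<sigma> \<in> N_plus lam" and jk: "j \<in> block lam h" "k \<in> block lam h" "j < k"
  shows "0 < \<sigma> (h, j)" and "\<sigma> (h, j) < \<sigma> (h, k)"
proof -
  have "h \<in> set lam" using jk(1) by (auto simp: block_def height_def)
  then have h: "1 \<le> h" using part by (auto simp: is_partition_def)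
  then have dg: "(h, j) \<in> dg lam" "(h, k) \<in> dg lam" using jk mem_block by blast+
  then show "0 < \<sigma> (h, j)"
    using \<sigma> by (auto simp: N_plus_def positive_fillings_def)
  have "block lam h \<in> rectangles lam" using jk(1) by (intro block_rectangle[OF part]) auto
  then have "\<sigma> (h, j) \<le> \<sigma> (h, k)"
    using \<sigma> jk unfolding N_plus_def top_row_increasing_def by (fastforce simp: top_box_def block_def)
  moreover have "\<sigma> (h, j) \<noteq> \<sigma> (h, k)"
    using N_plus_inj[OF \<sigma> dg] jk(3) by blast
  ultimately show "\<sigma> (h, j) < \<sigma> (h, k)" by simp
qed

text \<open>A weakly increasing word has no inversions; this evaluates the correction in
  \<open>quadcoinv_bar_star\<close>.\<close>

lemma top_inv_zero:
  assumes "\<sigma> \<in> N_plus lam"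
  shows "top_inv lam \<sigma> = 0"
proof -
  have "word_inv (top_word lam \<sigma> C) = 0" if C: "C \<in> rectangles lam" for C
  proof -
    let ?cs = "sorted_list_of_set C"
    have "finite C" using rectangle_columns[OF C] finite_subset by blast
    have "\<sigma> (top_box lam (?cs ! p)) \<le> \<sigma> (top_box lam (?cs ! p'))" if "p < p'" "p' < length ?cs" for p p'
    proof -
      have "?cs ! p < ?cs ! p'"
        using that strict_sorted_list_of_set[of C] sorted_wrt_nth_less by blast
      moreover have "?cs ! p \<in> C" "?cs ! p' \<in> C"
        using that nth_mem[of p ?cs] nth_mem[of p' ?cs] \<open>finite C\<close> by auto
      ultimately show ?thesis
        using assms C unfolding N_plus_def top_row_increasing_def by blast
    qed
    then have "{(p, p'). p < p' \<and> p' < length (top_word lam \<sigma> C) \<and>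
        top_word lam \<sigma> C ! p > top_word lam \<sigma> C ! p'} = {}"
      unfolding top_word_def by (auto simp: not_less[symmetric])
    then show ?thesis unfolding word_inv_def by (simp only: card.empty)
  qed
  then show ?thesis by (simp add: top_inv_def)
qed

lemma hat_simps:
  "(i, j) \<in> dg lam \<Longrightarrow> hat lam \<sigma> (i, j) = enat (\<sigma> (i, j))"
  "hat lam \<sigma> (0, j) = \<infinity>"
  "hat lam \<sigma> (height lam j + 1, j) = 0"
  by (auto simp: hat_def dg_def)

lemma at_quad_block:
  assumes part: "is_partition lam" and jk: "j \<in> block lam h" "k \<in> block lam h"
  shows "at_quad F lam \<sigma> (0, j, k) = F (enat (\<sigma> (1, j))) (enat (\<sigma> (1, k))) \<infinity> \<infinity>"
    and "at_quad F lam \<sigma> (h, j, k) = F 0 0 (enat (\<sigma> (h, j))) (enat (\<sigma> (h, k)))"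
    and "1 \<le> r \<Longrightarrow> r < h \<Longrightarrow> at_quad F lam \<sigma> (r, j, k) =
      F (enat (\<sigma> (r + 1, j))) (enat (\<sigma> (r + 1, k))) (enat (\<sigma> (r, j))) (enat (\<sigma> (r, k)))"
proof -
  have "h \<in> set lam" using jk(1) by (auto simp: block_def height_def)
  then have h: "1 \<le> h" using part by (auto simp: is_partition_def)
  have heights: "height lam j = h" "height lam k = h" using jk by (auto simp: block_def)
  have dg: "(i, j) \<in> dg lam" "(i, k) \<in> dg lam" if "1 \<le> i" "i \<le> h" for i
    using mem_block[OF jk(1) that] mem_block[OF jk(2) that] .
  have "hat lam \<sigma> (1, j) = enat (\<sigma> (1, j))" "hat lam \<sigma> (1, k) = enat (\<sigma> (1, k))"
    using hat_simps(1) dg[of 1] h by auto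
  then show "at_quad F lam \<sigma> (0, j, k) = F (enat (\<sigma> (1, j))) (enat (\<sigma> (1, k))) \<infinity> \<infinity>"
    by (simp add: at_quad_def hat_simps(2))
  have "hat lam \<sigma> (h + 1, j) = 0" "hat lam \<sigma> (h + 1, k) = 0"
    using hat_simps(3)[of lam \<sigma> j] hat_simps(3)[of lam \<sigma> k] heights by auto
  moreover have "hat lam \<sigma> (h, j) = enat (\<sigma> (h, j))" "hat lam \<sigma> (h, k) = enat (\<sigma> (h, k))"
    using hat_simps(1) dg[of h] h by auto
  ultimately show "at_quad F lam \<sigma> (h, j, k) = F 0 0 (enat (\<sigma> (h, j))) (enat (\<sigma> (h, k)))"
    by (simp only: at_quad_def prod.case)
  show "at_quad F lam \<sigma> (r, j, k) =
      F (enat (\<sigma> (r + 1, j))) (enat (\<sigma> (r + 1, k))) (enat (\<sigma> (r, j))) (enat (\<sigma> (r, k)))"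
    if r: "1 \<le> r" "r < h"
  proof -
    have *: "1 \<le> r + 1" "r + 1 \<le> h" "r \<le> h" using r by auto
    show ?thesis
      unfolding at_quad_def prod.case
        hat_simps(1)[OF dg(1)[OF *(1,2)]] hat_simps(1)[OF dg(2)[OF *(1,2)]]
        hat_simps(1)[OF dg(1)[OF r(1) *(3)]] hat_simps(1)[OF dg(2)[OF r(1) *(3)]] ..
  qed
qed

lemma quad_entries:
  assumes \<sigma>: "\<sigma> \<in> N_plus lam" and jk: "j \<in> block lam h" "k \<in> block lam h" "j \<noteq> k"
  shows "1 \<le> i \<Longrightarrow> i \<le> h \<Longrightarrow> \<sigma> (i, j) \<noteq> \<sigma> (i, k)"
    and "1 \<le> r \<Longrightarrow> r < h \<Longrightarrow> \<sigma> (r + 1, j) \<noteq> \<sigma> (r, k)"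
    and "1 \<le> r \<Longrightarrow> r < h \<Longrightarrow> \<sigma> (r + 1, k) \<noteq> \<sigma> (r, j)"
  using N_plus_inj[OF \<sigma> mem_block[OF jk(1)] mem_block[OF jk(2)]]
    N_plus_same_column[OF \<sigma> jk(1,2)] N_plus_same_column[OF \<sigma> jk(2,1)] jk(3) by blast+

text \<open>The common shape of both quadruple statistics: they agree at the boundary rows
  \<open>r = 0\<close> and \<open>r = h\<close> and differ only in the rule \<open>V\<close> of the
  inner levels.\<close>

definition quad_total :: "(nat \<Rightarrow> nat \<Rightarrow> nat \<Rightarrow> nat \<Rightarrow> nat) \<Rightarrow> nat list \<Rightarrow> filling \<Rightarrow> nat" where
  "quad_total V lam \<sigma> = (\<Sum>h\<in>set lam. \<Sum>r\<in>{0..h}. if r = 0 then 0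
     else if r = h then pair_sum (\<lambda>_ _. 1) (sorted_list_of_set (block lam h)) else level V lam \<sigma> h r)"

lemma card_quads_quad_total:
  assumes bottom: "\<And>h j k. h \<in> set lam \<Longrightarrow> j \<in> block lam h \<Longrightarrow> k \<in> block lam h \<Longrightarrow> j < k \<Longrightarrow> \<not> \<Phi> (0, j, k)"
    and top: "\<And>h j k. h \<in> set lam \<Longrightarrow> j \<in> block lam h \<Longrightarrow> k \<in> block lam h \<Longrightarrow> j < k \<Longrightarrow> \<Phi> (h, j, k)"
    and inner: "\<And>h r j k. j \<in> block lam h \<Longrightarrow> k \<in> block lam h \<Longrightarrow> j < k \<Longrightarrow> 1 \<le> r \<Longrightarrow> r < h \<Longrightarrow>
      of_bool (\<Phi> (r, j, k)) = V (\<sigma> (r + 1, j)) (\<sigma> (r + 1, k)) (\<sigma> (r, j)) (\<sigma> (r, k))"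
  shows "card {u \<in> quad_positions lam. \<Phi> u} = quad_total V lam \<sigma>"
  unfolding card_quad_positions quad_total_def level_def
proof (intro sum.cong refl)
  fix h r assume h: "h \<in> set lam" and r: "r \<in> {0..h}"
  let ?cs = "sorted_list_of_set (block lam h)"
  have cong: "pair_sum (\<lambda>j k. of_bool (\<Phi> (r, j, k))) ?cs = pair_sum g ?cs"
    if "\<And>j k. j \<in> block lam h \<Longrightarrow> k \<in> block lam h \<Longrightarrow> j < k \<Longrightarrow> of_bool (\<Phi> (r, j, k)) = g j k" for g
    using that by (intro pair_sum_cong[where P = "(<)"]) simp_all
  have zero: "pair_sum (\<lambda>_ _. 0) xs = 0" for xs :: "nat list"
    by (induction xs) auto
  consider "r = 0" | "r = h" "r \<noteq> 0" | "1 \<le> r" "r < h" using r by fastforce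
  then show "pair_sum (\<lambda>j k. of_bool (\<Phi> (r, j, k))) ?cs = (if r = 0 then 0
      else if r = h then pair_sum (\<lambda>_ _. 1) ?cs
      else pair_sum (\<lambda>j k. V (\<sigma> (r + 1, j)) (\<sigma> (r + 1, k)) (\<sigma> (r, j)) (\<sigma> (r, k))) ?cs)"
  proof cases
    case 1
    then show ?thesis using cong[of "\<lambda>_ _. 0"] bottom[OF h] zero by simp
  next
    case 2
    then show ?thesis using cong[of "\<lambda>_ _. 1"] top[OF h] by simp
  next
    case 3
    then have "r \<noteq> 0" "r \<noteq> h" by auto
    then show ?thesis using cong[OF inner[OF _ _ _ 3]] by (simp only: if_False)
  qed
qed

lemma Q4_quad_total:
  assumes part: "is_partition lam" and \<sigma>: "\<sigma> \<in> N_plus lam"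
  shows "card {u \<in> quad_positions lam. at_quad Q4 lam \<sigma> u = 1} = quad_total arc_quad lam \<sigma>"
proof (rule card_quads_quad_total)
  fix h j k assume h: "h \<in> set lam" and jk: "j \<in> block lam h" "k \<in> block lam h" "j < k"
  have "1 \<le> h" using part h by (auto simp: is_partition_def)
  then have "\<sigma> (1, j) \<noteq> \<sigma> (1, k)" using quad_entries(1)[OF \<sigma> jk(1,2), of 1] jk(3) by simp
  then show "at_quad Q4 lam \<sigma> (0, j, k) \<noteq> 1"
    unfolding at_quad_block(1)[OF part jk(1,2)] by (rule Q4_bottom)
  show "at_quad Q4 lam \<sigma> (h, j, k) = 1"
    unfolding at_quad_block(2)[OF part jk(1,2)]
    using top_row_strictly_increasing[OF part \<sigma> jk] by (rule Q4_top)
next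
  fix h r j k assume jk: "j \<in> block lam h" "k \<in> block lam h" "j < k" and r: "1 \<le> r" "r < h"
  have "at_quad Q4 lam \<sigma> (r, j, k) = arc_quad (\<sigma> (r + 1, j)) (\<sigma> (r + 1, k)) (\<sigma> (r, j)) (\<sigma> (r, k))"
    unfolding at_quad_block(3)[OF part jk(1,2) r]
    using quad_entries[OF \<sigma> jk(1,2)] jk(3) r by (intro Q4_enat) auto
  then show "of_bool (at_quad Q4 lam \<sigma> (r, j, k) = 1) =
      arc_quad (\<sigma> (r + 1, j)) (\<sigma> (r + 1, k)) (\<sigma> (r, j)) (\<sigma> (r, k))"
    by (simp add: arc_quad_def)
qed

text \<open>Together \<open>eta\<close> and \<open>alpha\<close> count the positions with value 1
  or, for \<open>r \<ge> 1\<close>, with a repeated entry, each position once.\<close>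

lemma eta_alpha_quad_total:
  assumes part: "is_partition lam" and S: "S \<in> S_systems" and \<sigma>: "\<sigma> \<in> N_plus lam"
    and rule: "\<And>z w u v. distinct [z, w, u, v] \<Longrightarrow> Q_S S (enat z) (enat w) (enat u) (enat v) = 1 \<longleftrightarrow>
      chord_rule p y s z w u v \<or> chord_rule p y s w z v u"
  shows "eta S lam \<sigma> + alpha S lam \<sigma> = quad_total (chord_quad p y s) lam \<sigma> + taller_triples lam \<sigma>"
proof -
  let ?D = "at_quad (\<lambda>z w u v. \<not> distinct [z, w, u, v]) lam \<sigma>" and ?Q = "at_quad (Q_S S) lam \<sigma>"
  let ?A = "{u \<in> quad_positions lam. ?Q u = 1}"
    and ?B = "{u \<in> quad_positions lam. fst u \<ge> 1 \<and> ?Q u = 0 \<and> ?D u}"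
  have "?Q u = 0 \<or> ?Q u = 1" for u
    by (cases u) (simp add: at_quad_def Q_S_def)
  then have "?A \<union> ?B = {u \<in> quad_positions lam. ?Q u = 1 \<or> fst u \<ge> 1 \<and> ?D u}"
    by auto
  moreover have "?A \<inter> ?B = {}" by auto
  ultimately have "card ?A + card ?B = card {u \<in> quad_positions lam. ?Q u = 1 \<or> fst u \<ge> 1 \<and> ?D u}"
    by (subst card_Un_disjoint[symmetric]) auto
  also have "\<dots> = quad_total (chord_quad p y s) lam \<sigma>"
  proof (rule card_quads_quad_total)
    fix h j k assume h: "h \<in> set lam" and jk: "j \<in> block lam h" "k \<in> block lam h" "j < k"
    have h1: "1 \<le> h" using part h by (auto simp: is_partition_def)
    then have "\<sigma> (1, j) \<noteq> \<sigma> (1, k)" using quad_entries(1)[OF \<sigma> jk(1,2), of 1] jk(3) by simp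
    \<comment> \<open>At \<open>r = 0\<close> the two infinite entries are a repetition; the bound
      on \<open>r\<close> in \<open>alpha\<close> keeps it from being counted.\<close>
    then show "\<not> (?Q (0, j, k) = 1 \<or> fst (0 :: nat, j, k) \<ge> 1 \<and> ?D (0, j, k))"
      using Q_S_bottom[OF S] by (simp add: at_quad_block(1)[OF part jk(1,2)])
    \<comment> \<open>The two zeros above the top row are a repetition, so \<open>alpha\<close>
      counts the position if \<open>eta\<close> does not.\<close>
    show "?Q (h, j, k) = 1 \<or> fst (h, j, k) \<ge> 1 \<and> ?D (h, j, k)"
      using h1 by (simp add: at_quad_block(2)[OF part jk(1,2)])
  next
    fix h r j k assume jk: "j \<in> block lam h" "k \<in> block lam h" "j < k" and r: "1 \<le> r" "r < h"
    let ?z = "\<sigma> (r + 1, j)" and ?w = "\<sigma> (r + 1, k)" and ?u = "\<sigma> (r, j)" and ?v = "\<sigma> (r, k)"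
    have "?D (r, j, k) \<longleftrightarrow> \<not> distinct [?z, ?w, ?u, ?v]"
      unfolding at_quad_block(3)[OF part jk(1,2) r] by simp
    moreover have "?Q (r, j, k) = 1 \<longleftrightarrow> chord_rule p y s ?z ?w ?u ?v \<or> chord_rule p y s ?w ?z ?v ?u"
      if "distinct [?z, ?w, ?u, ?v]"
      unfolding at_quad_block(3)[OF part jk(1,2) r] by (rule rule[OF that])
    ultimately show "of_bool (?Q (r, j, k) = 1 \<or> fst (r, j, k) \<ge> 1 \<and> ?D (r, j, k)) = chord_quad p y s ?z ?w ?u ?v"
      using r unfolding chord_quad_def by (cases "distinct [?z, ?w, ?u, ?v]") simp_all
  qed
  finally show ?thesis by (simp add: eta_def alpha_def)
qed

section \<open>Statistics determined by row sets and descents\<close>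

lemma leg_eq:
  assumes "(i, j) \<in> dg lam"
  shows "leg lam (i, j) = height lam j - i"
proof -
  have "{i'. (i', j) \<in> dg lam \<and> i < i'} = {i<..height lam j}"
    using assms by (auto simp: dg_def)
  then show ?thesis by (simp add: leg_def)
qed

lemma sum_of_bool_card: "finite A \<Longrightarrow> (\<Sum>x\<in>A. of_bool (P x)) = card {x \<in> A. P x}"
  by (simp add: of_bool_def sum.If_cases Int_def)

text \<open>The leg is constant along a row of a rectangle. The index \<open>i - 1\<close> appears
  because \<open>row_descents\<close> is indexed by the lower row.\<close>

lemma maj_row_descents:
  "maj lam \<sigma> = (\<Sum>h\<in>set lam. \<Sum>i\<in>{1..h}. if i = 1 then 0 else (h - i + 1) * row_descents lam \<sigma> h (i - 1))"
proof -
  have "maj lam \<sigma> = (\<Sum>u\<in>dg lam. if fst u \<noteq> 1 \<and> \<sigma> (South u) < \<sigma> u then leg lam u + 1 else 0)"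
    unfolding maj_def by (subst sum.inter_filter[symmetric]) simp_all
  also have "\<dots> = (\<Sum>h\<in>set lam. \<Sum>i\<in>{1..h}. \<Sum>j\<in>block lam h.
      if i \<noteq> 1 \<and> \<sigma> (i - 1, j) < \<sigma> (i, j) then leg lam (i, j) + 1 else 0)"
    unfolding sum.F_dg South_def by simp
  also have "\<dots> = (\<Sum>h\<in>set lam. \<Sum>i\<in>{1..h}. if i = 1 then 0 else (h - i + 1) * row_descents lam \<sigma> h (i - 1))"
  proof (intro sum.cong refl)
    fix h i :: nat assume i: "i \<in> {1..h}"
    show "(\<Sum>j\<in>block lam h. if i \<noteq> 1 \<and> \<sigma> (i - 1, j) < \<sigma> (i, j) then leg lam (i, j) + 1 else 0) =
        (if i = 1 then 0 else (h - i + 1) * row_descents lam \<sigma> h (i - 1))"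
    proof (cases "i = 1")
      case False
      have "(\<Sum>j\<in>block lam h. if i \<noteq> 1 \<and> \<sigma> (i - 1, j) < \<sigma> (i, j) then leg lam (i, j) + 1 else 0) =
          (\<Sum>j\<in>block lam h. (h - i + 1) * of_bool (\<sigma> (i - 1, j) < \<sigma> (i, j)))"
        using False i by (intro sum.cong refl) (auto simp: leg_eq mem_block block_height)
      also have "\<dots> = (h - i + 1) * card {j \<in> block lam h. \<sigma> (i - 1, j) < \<sigma> (i, j)}"
        by (simp only: sum_distrib_left[symmetric] sum_of_bool_card[OF finite_block])
      finally show ?thesis
        using False i by (simp add: row_descents_def)
    qed simp
  qed
  finally show ?thesis .
qed

lemma same_profile_maj:
  assumes "same_profile lam \<sigma> \<tau>"
  shows "maj lam \<sigma> = maj lam \<tau>"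
proof -
  have eq: "row_descents lam \<sigma> = row_descents lam \<tau>" using assms by (simp add: same_profile_def)
  show ?thesis unfolding maj_row_descents eq ..
qed

lemma row_image:
  "\<sigma> ` {u \<in> dg lam. fst u = i} = (\<Union>h\<in>{h \<in> set lam. 1 \<le> i \<and> i \<le> h}. row_set lam \<sigma> h i)"
proof -
  have "{u \<in> dg lam. fst u = i} = (\<Union>h\<in>{h \<in> set lam. 1 \<le> i \<and> i \<le> h}. Pair i ` block lam h)"
  proof (intro equalityI subsetI)
    fix u assume u: "u \<in> {u \<in> dg lam. fst u = i}"
    obtain j where j: "u = (i, j)" using u by (cases u) auto
    then have "j \<in> block lam (height lam j)" "height lam j \<in> set lam" "1 \<le> i" "i \<le> height lam j"
      using u by (auto simp: dg_def block_def height_def)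
    then show "u \<in> (\<Union>h\<in>{h \<in> set lam. 1 \<le> i \<and> i \<le> h}. Pair i ` block lam h)"
      using j by blast
  qed (auto simp: dg_def block_def)
  then show ?thesis
    by (simp add: image_UN image_image row_set_def)
qed

text \<open>Rows of non-attacking fillings have no repeated entries, so their contents are
  determined by their sets.\<close>

lemma same_profile_row_equivalent:
  assumes \<sigma>: "\<sigma> \<in> N_plus lam" and \<tau>: "\<tau> \<in> N_plus lam" and "same_profile lam \<sigma> \<tau>"
  shows "row_equivalent lam \<sigma> \<tau>"
  unfolding row_equivalent_def
proof
  fix i
  have *: "row_content lam \<rho> i = mset_set (\<rho> ` {u \<in> dg lam. fst u = i})" if "\<rho> \<in> N_plus lam" for \<rho>
    unfolding row_content_def
  proof (rule image_mset_mset_set)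
    show "inj_on \<rho> {u \<in> dg lam. fst u = i}"
      using N_plus_inj[OF that, of i] by (intro inj_onI) (auto simp: prod_eq_iff)
  qed
  show "row_content lam \<sigma> i = row_content lam \<tau> i"
    using assms(3) unfolding *[OF \<sigma>] *[OF \<tau>] row_image same_profile_def by simp
qed

text \<open>Listed along \<open>C\<close>, the values of either map form the increasing enumeration
  of the common image.\<close>

lemma strict_mono_on_same_image:
  fixes f g :: "'a::linorder \<Rightarrow> 'b::linorder"
  assumes "finite C" "strict_mono_on C f" "strict_mono_on C g" "f ` C = g ` C" "x \<in> C"
  shows "f x = g x"
proof -
  let ?cs = "sorted_list_of_set C"
  have sorted: "sorted_wrt (<) (map h ?cs)" if "strict_mono_on C h" for h :: "'a \<Rightarrow> 'b"
    unfolding sorted_wrt_map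
    by (rule sorted_wrt_mono_rel[OF _ strict_sorted_list_of_set])
      (use that assms(1) in \<open>auto dest: strict_mono_onD\<close>)
  have "map f ?cs = map g ?cs"
    using sorted[OF assms(2)] sorted[OF assms(3)] assms(1,4)
    by (intro strict_sorted_equal) auto
  then show ?thesis using assms(1,5) by simp
qed

lemma same_profile_same_top_rows:
  assumes part: "is_partition lam" and \<sigma>: "\<sigma> \<in> N_plus lam" and \<tau>: "\<tau> \<in> N_plus lam"
    and prof: "same_profile lam \<sigma> \<tau>"
  shows "same_top_rows lam \<sigma> \<tau>"
  unfolding same_top_rows_def
proof (intro ballI)
  fix C j assume C: "C \<in> rectangles lam" "j \<in> C"
  then have j: "j \<in> block lam (height lam j)"
    using subsetD[OF rectangle_columns[OF C(1)] C(2)] by (simp add: block_def)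
  let ?h = "height lam j"
  have "strict_mono_on (block lam ?h) (\<lambda>j. \<rho> (?h, j))" if "\<rho> \<in> N_plus lam" for \<rho>
    using top_row_strictly_increasing(2)[OF part that] by (intro strict_mono_onI)
  moreover have "(\<lambda>j. \<sigma> (?h, j)) ` block lam ?h = (\<lambda>j. \<tau> (?h, j)) ` block lam ?h"
    using prof unfolding same_profile_def row_set_def by (metis (no_types))
  ultimately have "\<sigma> (?h, j) = \<tau> (?h, j)"
    using strict_mono_on_same_image[OF finite_block, of lam ?h "\<lambda>j. \<sigma> (?h, j)" "\<lambda>j. \<tau> (?h, j)"] \<sigma> \<tau> j by blast
  then show "\<sigma> (top_box lam j) = \<tau> (top_box lam j)"
    by (simp add: top_box_def)
qed

text \<open>By non-attacking, an entry common to two adjacent rows of a rectangle stands in one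
  column in both, so restricted boxes correspond to common entries.\<close>

lemma card_restricted_block:
  assumes \<sigma>: "\<sigma> \<in> N_plus lam" and i: "1 \<le> i" "i \<le> h"
  shows "card {j \<in> block lam h. restricted \<sigma> (i, j)} =
    (if i = 1 then 0 else card (row_set lam \<sigma> h i \<inter> row_set lam \<sigma> h (i - 1)))"
proof (cases "i = 1")
  case False
  let ?R = "{j \<in> block lam h. restricted \<sigma> (i, j)}"
  have "(\<lambda>j. \<sigma> (i, j)) ` ?R = row_set lam \<sigma> h i \<inter> row_set lam \<sigma> h (i - 1)"
  proof
    show "(\<lambda>j. \<sigma> (i, j)) ` ?R \<subseteq> row_set lam \<sigma> h i \<inter> row_set lam \<sigma> h (i - 1)"
    proof
      fix x assume "x \<in> (\<lambda>j. \<sigma> (i, j)) ` ?R"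
      then obtain j where "j \<in> block lam h" "x = \<sigma> (i, j)" "x = \<sigma> (i - 1, j)"
        by (auto simp: restricted_def South_def)
      then show "x \<in> row_set lam \<sigma> h i \<inter> row_set lam \<sigma> h (i - 1)"
        unfolding row_set_def by blast
    qed
    show "row_set lam \<sigma> h i \<inter> row_set lam \<sigma> h (i - 1) \<subseteq> (\<lambda>j. \<sigma> (i, j)) ` ?R"
    proof
      fix x assume "x \<in> row_set lam \<sigma> h i \<inter> row_set lam \<sigma> h (i - 1)"
      then obtain j k where jk: "j \<in> block lam h" "k \<in> block lam h" "x = \<sigma> (i, j)" "x = \<sigma> (i - 1, k)"
        unfolding row_set_def by blast
      then have "j = k"
        using N_plus_same_column[OF \<sigma> jk(1,2), of "i - 1"] False i by simp
      then have "j \<in> ?R"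
        using jk False by (simp add: restricted_def South_def)
      then show "x \<in> (\<lambda>j. \<sigma> (i, j)) ` ?R"
        unfolding jk(3) by (rule imageI)
    qed
  qed
  moreover have "inj_on (\<lambda>j. \<sigma> (i, j)) ?R"
    using inj_on_row[OF \<sigma> i] by (rule inj_on_subset) blast
  ultimately show ?thesis
    using False by (metis card_image)
qed (simp add: restricted_def)

lemma same_profile_restricted_block:
  assumes "\<sigma> \<in> N_plus lam" "\<tau> \<in> N_plus lam" "same_profile lam \<sigma> \<tau>" and "1 \<le> i" "i \<le> h"
  shows "card {j \<in> block lam h. restricted \<sigma> (i, j)} = card {j \<in> block lam h. restricted \<tau> (i, j)}"
    and "card {j \<in> block lam h. \<not> restricted \<sigma> (i, j)} = card {j \<in> block lam h. \<not> restricted \<tau> (i, j)}"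
proof -
  show *: "card {j \<in> block lam h. restricted \<sigma> (i, j)} = card {j \<in> block lam h. restricted \<tau> (i, j)}"
    using assms by (simp add: card_restricted_block same_profile_def)
  have "card {j \<in> block lam h. \<not> restricted \<rho> (i, j)} =
      card (block lam h) - card {j \<in> block lam h. restricted \<rho> (i, j)}" for \<rho>
  proof -
    have "{j \<in> block lam h. \<not> restricted \<rho> (i, j)} = block lam h - {j \<in> block lam h. restricted \<rho> (i, j)}"
      by blast
    then show ?thesis by (simp add: card_Diff_subset)
  qed
  with * show "card {j \<in> block lam h. \<not> restricted \<sigma> (i, j)} = card {j \<in> block lam h. \<not> restricted \<tau> (i, j)}"
    by simp
qed

lemma card_row_boxes:
  "card {u \<in> dg lam. fst u = i \<and> P u} =
    (\<Sum>h\<in>set lam. \<Sum>i'\<in>{1..h}. if i' = i then card {j \<in> block lam h. P (i, j)} else 0)"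
proof -
  have "card {u \<in> dg lam. fst u = i \<and> P u} = (\<Sum>u\<in>dg lam. of_bool (fst u = i \<and> P u))"
    by (rule sum_of_bool_card[OF finite_dg, symmetric])
  also have "\<dots> = (\<Sum>h\<in>set lam. \<Sum>i'\<in>{1..h}. \<Sum>j\<in>block lam h. of_bool (i' = i \<and> P (i', j)))"
    unfolding sum.F_dg by (simp only: fst_conv)
  also have "\<dots> = (\<Sum>h\<in>set lam. \<Sum>i'\<in>{1..h}. if i' = i then card {j \<in> block lam h. P (i, j)} else 0)"
    by (intro sum.cong refl) (simp only: sum_of_bool_card[OF finite_block], simp)
  finally show ?thesis .
qed

lemma same_profile_restricted_in_row:
  assumes "\<sigma> \<in> N_plus lam" "\<tau> \<in> N_plus lam" "same_profile lam \<sigma> \<tau>"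
  shows "restricted_in_row lam \<sigma> i = restricted_in_row lam \<tau> i"
    and "unrestricted_in_row lam \<sigma> i = unrestricted_in_row lam \<tau> i"
  unfolding restricted_in_row_def unrestricted_in_row_def card_row_boxes
  by (intro sum.cong refl if_cong same_profile_restricted_block[OF assms]; simp)+

text \<open>The number of smaller elements runs exactly once through
  \<open>0, ..., card U - 1\<close>.\<close>

lemma prod_ranks:
  fixes U :: "nat set"
  assumes "finite U"
  shows "(\<Prod>j\<in>U. g (card {k \<in> U. k < j})) = (\<Prod>l<card U. g l :: 'a :: comm_monoid_mult)"
  using assms
proof (induction U rule: finite_linorder_max_induct)
  case (insert b U)
  have "{k \<in> insert b U. k < b} = U" using insert.hyps by auto
  moreover have "{k \<in> insert b U. k < j} = {k \<in> U. k < j}" if "j \<in> U" for j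
    using insert.hyps(2) that by force
  moreover have "b \<notin> U" using insert.hyps by auto
  ultimately show ?case
    using insert by (simp add: mult.commute)
qed simp

text \<open>The unrestricted boxes of a row of a rectangle have consecutive values of \<open>arm_bar\<close>,
  so their contribution depends only on their number.\<close>

lemma c_weight_unrestricted:
  fixes q t :: "'a :: field"
  assumes part: "is_partition lam"
  shows "c_weight lam \<sigma> q t = (\<Prod>h\<in>set lam. \<Prod>i\<in>{1..h}. if i = 1 then 1 else
    (\<Prod>l<card {j \<in> block lam h. \<not> restricted \<sigma> (i, j)}.
      (1 - t) / (1 - q ^ (h - i + 1) * t ^ (card {v \<in> dg lam. fst v = i - 1 \<and> height lam (snd v) < h} + l + 1))))"
proof -
  define W where "W = (\<lambda>u. (1 - t) / (1 - q ^ (leg lam u + 1) * t ^ (arm_bar lam \<sigma> u + 1)))"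
  have "c_weight lam \<sigma> q t = (\<Prod>u\<in>dg lam. if fst u \<noteq> 1 \<and> \<sigma> u \<noteq> \<sigma> (South u) then W u else 1)"
    unfolding c_weight_def W_def by (subst prod.inter_filter[symmetric]) simp_all
  also have "\<dots> = (\<Prod>h\<in>set lam. \<Prod>i\<in>{1..h}. \<Prod>j\<in>block lam h.
      if i \<noteq> 1 \<and> \<not> restricted \<sigma> (i, j) then W (i, j) else 1)"
    unfolding prod.F_dg by (intro prod.cong refl) (auto simp: restricted_def)
  also have "\<dots> = (\<Prod>h\<in>set lam. \<Prod>i\<in>{1..h}. if i = 1 then 1 else
    (\<Prod>l<card {j \<in> block lam h. \<not> restricted \<sigma> (i, j)}.
      (1 - t) / (1 - q ^ (h - i + 1) * t ^ (card {v \<in> dg lam. fst v = i - 1 \<and> height lam (snd v) < h} + l + 1))))"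
  proof (intro prod.cong refl)
    fix h i :: nat assume i: "i \<in> {1..h}"
    let ?U = "{j \<in> block lam h. \<not> restricted \<sigma> (i, j)}"
    let ?e = "card {v \<in> dg lam. fst v = i - 1 \<and> height lam (snd v) < h}"
    let ?g = "\<lambda>l. (1 - t) / (1 - q ^ (h - i + 1) * t ^ (?e + l + 1))"
    show "(\<Prod>j\<in>block lam h. if i \<noteq> 1 \<and> \<not> restricted \<sigma> (i, j) then W (i, j) else 1) =
        (if i = 1 then 1 else (\<Prod>l<card ?U. ?g l))"
    proof (cases "i = 1")
      case False
      have W: "W (i, j) = ?g (card {k \<in> ?U. k < j})" if "j \<in> ?U" for j
      proof -
        have j: "1 \<le> j" "j \<le> length lam" "height lam j = h" using that by (auto simp: block_def)
        have "(i, j) \<in> dg lam" using that i by (intro mem_block) auto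
        then have "leg lam (i, j) = h - i" using j by (simp add: leg_eq)
        \<comment> \<open>Shorter columns stand to the right of column \<open>j\<close>, so the
          first part of \<open>arm_bar\<close> is constant along the row.\<close>
        moreover have "{v \<in> dg lam. fst v = i - 1 \<and> snd v > j \<and> height lam (snd v) < h} =
            {v \<in> dg lam. fst v = i - 1 \<and> height lam (snd v) < h}"
        proof -
          have "snd v > j" if "v \<in> dg lam" "height lam (snd v) < h" for v
            using height_antimono[OF part, of "snd v" j] that j by (cases v) (force simp: dg_def not_less[symmetric])
          then show ?thesis by blast
        qed
        moreover have "card {v \<in> dg lam. fst v = i \<and> snd v < j \<and> height lam (snd v) = h \<and> \<not> restricted \<sigma> v} =
            card {k \<in> ?U. k < j}"
        proof -
          have "{v \<in> dg lam. fst v = i \<and> snd v < j \<and> height lam (snd v) = h \<and> \<not> restricted \<sigma> v} =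
              Pair i ` {k \<in> ?U. k < j}"
            using i j by (auto simp: dg_def block_def)
          then show ?thesis by (simp add: card_image inj_on_def)
        qed
        ultimately show ?thesis
          using j(3) by (simp add: W_def arm_bar_def)
      qed
      have "(\<Prod>j\<in>block lam h. if i \<noteq> 1 \<and> \<not> restricted \<sigma> (i, j) then W (i, j) else 1) = (\<Prod>j\<in>?U. W (i, j))"
        using False by (subst prod.inter_filter) simp_all
      also have "\<dots> = (\<Prod>j\<in>?U. ?g (card {k \<in> ?U. k < j}))"
        by (intro prod.cong refl W)
      also have "\<dots> = (\<Prod>l<card ?U. ?g l)"
        by (rule prod_ranks) simp
      finally show ?thesis using False by simp
    qed simp
  qed
  finally show ?thesis .
qed

lemma same_profile_c_weight:
  fixes q t :: "'a :: field"
  assumes part: "is_partition lam" and "\<sigma> \<in> N_plus lam" "\<tau> \<in> N_plus lam" "same_profile lam \<sigma> \<tau>"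
  shows "c_weight lam \<sigma> q t = c_weight lam \<tau> q t"
  unfolding c_weight_unrestricted[OF part]
  by (intro prod.cong refl if_cong) (simp add: same_profile_restricted_block(2)[OF assms(2-4)])

section \<open>Triples between columns of different heights\<close>

text \<open>Summing \<open>of_bool_arc\<close> over the columns leaves only the two row sets, the
  width and the number of descents.\<close>

lemma card_arc_row:
  assumes \<sigma>: "\<sigma> \<in> N_plus lam" and r: "1 \<le> r" "r < h"
    and c: "c \<notin> row_set lam \<sigma> h (r + 1)" "c \<notin> row_set lam \<sigma> h r"
  shows "int (card {j \<in> block lam h. arc (\<sigma> (r + 1, j)) (\<sigma> (r, j)) c}) =
    int (card {a \<in> row_set lam \<sigma> h (r + 1). c < a}) - int (card {b \<in> row_set lam \<sigma> h r. c < b})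
      + int (card (block lam h)) - int (row_descents lam \<sigma> h r)"
proof -
  let ?C = "block lam h"
  have count: "(\<Sum>j\<in>?C. of_bool (c < \<sigma> (i, j))) = int (card {a \<in> row_set lam \<sigma> h i. c < a})"
    if "1 \<le> i" "i \<le> h" for i
  proof -
    have "{a \<in> row_set lam \<sigma> h i. c < a} = (\<lambda>j. \<sigma> (i, j)) ` {j \<in> ?C. c < \<sigma> (i, j)}"
      by (auto simp: row_set_def)
    moreover have "inj_on (\<lambda>j. \<sigma> (i, j)) {j \<in> ?C. c < \<sigma> (i, j)}"
      using inj_on_row[OF \<sigma> that] by (rule inj_on_subset) blast
    ultimately have "card {a \<in> row_set lam \<sigma> h i. c < a} = card {j \<in> ?C. c < \<sigma> (i, j)}"
      by (simp only: card_image)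
    then show ?thesis by (simp add: sum.If_cases of_bool_def Int_def)
  qed
  have "int (card {j \<in> ?C. arc (\<sigma> (r + 1, j)) (\<sigma> (r, j)) c}) =
      (\<Sum>j\<in>?C. int (of_bool (arc (\<sigma> (r + 1, j)) (\<sigma> (r, j)) c)))"
    by (simp only: sum_of_bool_card[OF finite_block, symmetric] of_nat_sum)
  also have "\<dots> = (\<Sum>j\<in>?C. of_bool (c < \<sigma> (r + 1, j)) - of_bool (c < \<sigma> (r, j)) +
      (1 - of_bool (\<sigma> (r, j) < \<sigma> (r + 1, j))))"
  proof (intro sum.cong refl)
    fix j assume "j \<in> ?C"
    then have "c \<noteq> \<sigma> (r + 1, j)" "c \<noteq> \<sigma> (r, j)" using c by (auto simp: row_set_def)
    from of_bool_arc[OF this]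
    show "int (of_bool (arc (\<sigma> (r + 1, j)) (\<sigma> (r, j)) c)) =
        of_bool (c < \<sigma> (r + 1, j)) - of_bool (c < \<sigma> (r, j)) + (1 - of_bool (\<sigma> (r, j) < \<sigma> (r + 1, j)))"
      by (simp only: not_less[symmetric] of_bool_not_iff)
  qed
  also have "\<dots> = (\<Sum>j\<in>?C. of_bool (c < \<sigma> (r + 1, j))) - (\<Sum>j\<in>?C. of_bool (c < \<sigma> (r, j))) +
      (int (card ?C) - (\<Sum>j\<in>?C. of_bool (\<sigma> (r, j) < \<sigma> (r + 1, j))))"
    by (simp only: sum.distrib sum_subtractf) simp
  also have "(\<Sum>j\<in>?C. of_bool (\<sigma> (r, j) < \<sigma> (r + 1, j))) = int (row_descents lam \<sigma> h r)"
    by (simp add: row_descents_def sum.If_cases of_bool_def Int_def)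
  finally show ?thesis
    using count[of "r + 1"] count[of r] r by simp
qed

text \<open>The triples are grouped by the entry \<open>c\<close> of the shorter column. Its row
  lies strictly below the top of the taller column, so all three boxes belong to the diagram itself
  and \<open>Q3\<close> becomes \<open>arc\<close>.\<close>

lemma taller_triples_sum:
  assumes part: "is_partition lam" and \<sigma>: "\<sigma> \<in> N_plus lam"
  shows "taller_triples lam \<sigma> = (\<Sum>h'\<in>set lam. \<Sum>r\<in>{1..h'}. \<Sum>c\<in>row_set lam \<sigma> h' r.
    \<Sum>h\<in>{h \<in> set lam. h' < h}. card {j \<in> block lam h. arc (\<sigma> (r + 1, j)) (\<sigma> (r, j)) c})"
proof -
  let ?H = "\<lambda>h'. {h \<in> set lam. h' < h}"
  let ?J = "\<lambda>h r c. {j \<in> block lam h. arc (\<sigma> (r + 1, j)) (\<sigma> (r, j)) c}"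
  let ?T = "{(r, j, k). (r, j, k) \<in> queue_inversion_triples lam \<sigma> \<and> height lam j > height lam k}"
  let ?S = "SIGMA u:dg lam. SIGMA h:?H (height lam (snd u)). ?J h (fst u) (\<sigma> u)"
  have mem: "(r, j, k) \<in> ?T \<longleftrightarrow> (r, k) \<in> dg lam \<and> height lam j \<in> ?H (height lam k) \<and> j \<in> ?J (height lam j) r (\<sigma> (r, k))"
    for r j k
  proof (cases "j \<in> {1..length lam} \<and> (r, k) \<in> dg lam \<and> height lam k < height lam j")
    case True
    then have j: "j \<in> block lam (height lam j)" "height lam j \<in> set lam"
      by (auto simp: block_def height_def)
    have r: "1 \<le> r" "r < height lam j" "1 \<le> k" "k \<le> length lam" using True by (auto simp: dg_def)
    have "j < k"
      using height_antimono[OF part, of k j] True r by (auto simp: not_less[symmetric])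
    have dg: "(r + 1, j) \<in> dg lam" "(r, j) \<in> dg lam" using mem_block[OF j(1)] r by auto
    have c: "\<sigma> (r, k) \<noteq> \<sigma> (r + 1, j)" "\<sigma> (r, k) \<noteq> \<sigma> (r, j)"
    proof -
      show "\<sigma> (r, k) \<noteq> \<sigma> (r, j)"
        using N_plus_inj[OF \<sigma> dg(2)] True \<open>j < k\<close> by fastforce
      have "attacking lam (r + 1, j) (r, k)" using \<open>j < k\<close> by (simp add: attacking_def)
      then show "\<sigma> (r, k) \<noteq> \<sigma> (r + 1, j)"
        using \<sigma> dg(1) True unfolding N_plus_def non_attacking_def by fastforce
    qed
    have hats: "hat lam \<sigma> (r + 1, j) = enat (\<sigma> (r + 1, j))" "hat lam \<sigma> (r, j) = enat (\<sigma> (r, j))"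
      "hat lam \<sigma> (r, k) = enat (\<sigma> (r, k))"
      using hat_simps(1) dg True by blast+
    have "0 < \<sigma> (r, k)"
      using \<sigma> True by (auto simp: N_plus_def positive_fillings_def)
    then have "hat lam \<sigma> (r, k) \<noteq> 0"
      using hats by (simp add: zero_enat_def)
    moreover have "(r + 1, j) \<in> hat_dg lam" "(r, j) \<in> hat_dg lam" "(r, k) \<in> hat_dg lam"
      using dg True by (auto simp: hat_dg_def dg_def)
    ultimately have "(r, j, k) \<in> ?T \<longleftrightarrow> arc (\<sigma> (r + 1, j)) (\<sigma> (r, j)) (\<sigma> (r, k))"
      using True \<open>j < k\<close> by (simp only: queue_inversion_triples_def hats Q3_enat[OF c] mem_Collect_eq prod.case) auto
    then show ?thesis using True j by simp
  next
    case False
    have "(r, j, k) \<notin> ?T"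
    proof
      assume "(r, j, k) \<in> ?T"
      then have hat: "(r + 1, j) \<in> hat_dg lam" "(r, k) \<in> hat_dg lam" "hat lam \<sigma> (r, k) \<noteq> 0"
        and Q: "Q3 (hat lam \<sigma> (r + 1, j)) (hat lam \<sigma> (r, j)) (hat lam \<sigma> (r, k)) = 1"
        and lt: "height lam k < height lam j"
        by (auto simp: queue_inversion_triples_def)
      \<comment> \<open>For \<open>r = 0\<close> both \<open>b\<close> and \<open>c\<close> are
        infinite, so two of the conditions in \<open>Q3\<close> hold.\<close>
      have "r \<noteq> 0"
      proof
        assume "r = 0"
        then show False using Q by (auto simp: hat_simps(2) Q3_def I_ind_def)
      qed
      \<comment> \<open>The condition that \<open>c\<close> is not 0 excludes the added box on top
        of the shorter column.\<close>
      moreover have "r \<noteq> height lam k + 1"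
        using hat(3) hat_simps(3) by metis
      ultimately have "(r, k) \<in> dg lam" "j \<in> {1..length lam}"
        using hat by (auto simp: hat_dg_def dg_def)
      then show False using False lt by blast
    qed
    moreover have "\<not> ((r, k) \<in> dg lam \<and> height lam j \<in> ?H (height lam k) \<and> j \<in> ?J (height lam j) r (\<sigma> (r, k)))"
      using False by (auto simp: block_def)
    ultimately show ?thesis by blast
  qed
  have "card ?T = card ?S"
  proof (rule bij_betw_same_card[of "\<lambda>(r, j, k). ((r, k), height lam j, j)"])
    show "bij_betw (\<lambda>(r, j, k). ((r, k), height lam j, j)) ?T ?S"
    proof (rule bij_betw_byWitness[where f' = "\<lambda>((r, k), h, j). (r, j, k)"])
      show "(\<lambda>(r, j, k). ((r, k), height lam j, j)) ` ?T \<subseteq> ?S"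
      proof
        fix x assume "x \<in> (\<lambda>(r, j, k). ((r, k), height lam j, j)) ` ?T"
        then obtain r j k where "(r, j, k) \<in> ?T" "x = ((r, k), height lam j, j)" by auto
        then show "x \<in> ?S" unfolding mem by simp
      qed
      show "(\<lambda>((r, k), h, j). (r, j, k)) ` ?S \<subseteq> ?T"
      proof
        fix x assume "x \<in> (\<lambda>((r, k), h, j). (r, j, k)) ` ?S"
        then obtain r k h j where x: "x = (r, j, k)" and S: "((r, k), h, j) \<in> ?S" by auto
        then have "height lam j = h" by (auto simp: block_def)
        with S show "x \<in> ?T" unfolding x mem by auto
      qed
    qed (auto simp: block_def)
  qed
  then have "taller_triples lam \<sigma> = (\<Sum>u\<in>dg lam. \<Sum>h\<in>?H (height lam (snd u)). card (?J h (fst u) (\<sigma> u)))"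
    by (simp add: taller_triples_def card_SigmaI)
  also have "\<dots> = (\<Sum>h'\<in>set lam. \<Sum>r\<in>{1..h'}. \<Sum>k\<in>block lam h'. \<Sum>h\<in>?H h'. card (?J h r (\<sigma> (r, k))))"
    unfolding sum.F_dg by (intro sum.cong refl) (simp_all add: block_height)
  also have "\<dots> = (\<Sum>h'\<in>set lam. \<Sum>r\<in>{1..h'}. \<Sum>c\<in>row_set lam \<sigma> h' r. \<Sum>h\<in>?H h'. card (?J h r c))"
  proof (rule sum.cong[OF refl], rule sum.cong[OF refl])
    fix h' r :: nat assume "r \<in> {1..h'}"
    then have "inj_on (\<lambda>k. \<sigma> (r, k)) (block lam h')" by (intro inj_on_row[OF \<sigma>]) auto
    then show "(\<Sum>k\<in>block lam h'. \<Sum>h\<in>?H h'. card (?J h r (\<sigma> (r, k)))) =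
        (\<Sum>c\<in>row_set lam \<sigma> h' r. \<Sum>h\<in>?H h'. card (?J h r c))"
      unfolding row_set_def by (simp only: sum.reindex comp_def)
  qed
  finally show ?thesis .
qed

text \<open>Shorter columns stand to the right, so by non-attacking an entry of row \<open>r\<close>
  there occurs neither in row \<open>r\<close> nor in row \<open>r + 1\<close> of a taller
  rectangle. Thus \<open>card_arc_row\<close> applies, and its right-hand side depends on the
  profile only.\<close>

lemma same_profile_taller_triples:
  assumes part: "is_partition lam" and \<sigma>: "\<sigma> \<in> N_plus lam" and \<tau>: "\<tau> \<in> N_plus lam"
    and prof: "same_profile lam \<sigma> \<tau>"
  shows "taller_triples lam \<sigma> = taller_triples lam \<tau>"
  unfolding taller_triples_sum[OF part \<sigma>] taller_triples_sum[OF part \<tau>]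
proof (intro sum.cong refl)
  fix h' r :: nat show "row_set lam \<sigma> h' r = row_set lam \<tau> h' r" using prof by (simp add: same_profile_def)
next
  fix h' r c h :: nat assume "r \<in> {1..h'}" and c: "c \<in> row_set lam \<tau> h' r" and "h \<in> {h \<in> set lam. h' < h}"
  then have r: "1 \<le> r" "r \<le> h'" "h' < h" "r < h" by auto
  have apart: "c \<notin> row_set lam \<rho> h r \<and> c \<notin> row_set lam \<rho> h (r + 1)"
    if \<rho>: "\<rho> \<in> N_plus lam" and c: "c \<in> row_set lam \<rho> h' r" for \<rho>
  proof -
    obtain k where k: "k \<in> block lam h'" "c = \<rho> (r, k)" using c unfolding row_set_def by blast
    have "\<rho> (r, k) \<noteq> \<rho> (r, j) \<and> \<rho> (r, k) \<noteq> \<rho> (r + 1, j)" if j: "j \<in> block lam h" for j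
    proof -
      have "\<not> k \<le> j"
        using height_antimono[OF part, of k j] j k(1) r(3) by (auto simp: block_def)
      moreover from this have "attacking lam (r + 1, j) (r, k)" by (simp add: attacking_def)
      moreover have "(r, k) \<in> dg lam" "(r, j) \<in> dg lam" "(r + 1, j) \<in> dg lam"
        using mem_block[OF k(1)] mem_block[OF j] r by auto
      ultimately show ?thesis
        using N_plus_inj[OF \<rho>, of r k j] \<rho> unfolding N_plus_def non_attacking_def by fastforce
    qed
    then show ?thesis unfolding row_set_def k(2) by blast
  qed
  have "c \<in> row_set lam \<sigma> h' r" using c prof by (simp add: same_profile_def)
  then have "int (card {j \<in> block lam h. arc (\<sigma> (r + 1, j)) (\<sigma> (r, j)) c}) =
      int (card {j \<in> block lam h. arc (\<tau> (r + 1, j)) (\<tau> (r, j)) c})"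
    using apart[OF \<sigma>] apart[OF \<tau> c] card_arc_row[OF \<sigma> r(1,4)] card_arc_row[OF \<tau> r(1,4)] prof
    by (simp only: same_profile_def) simp
  then show "card {j \<in> block lam h. arc (\<sigma> (r + 1, j)) (\<sigma> (r, j)) c} =
      card {j \<in> block lam h. arc (\<tau> (r + 1, j)) (\<tau> (r, j)) c}"
    by (simp only: of_nat_eq_iff)
qed

theorem theorem7p2:
  fixes lam :: "nat list" and S :: "ordering set"
  assumes "is_partition lam" and "S \<in> S_systems"
  shows "\<exists>\<phi>. bij_betw \<phi> (N_plus lam) (N_plus lam) \<and>
    (\<forall>\<sigma>\<in>N_plus lam.
       row_equivalent lam (\<phi> \<sigma>) \<sigma> \<and>
       (maj lam (\<phi> \<sigma>), eta_circ S lam (\<phi> \<sigma>)) = (maj lam \<sigma>, quadcoinv_bar_star lam \<sigma>) \<and>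
       c_weight lam \<sigma> q_var t_var = c_weight lam (\<phi> \<sigma>) q_var t_var \<and>
       same_top_rows lam (\<phi> \<sigma>) \<sigma> \<and>
       (\<forall>i. restricted_in_row lam \<sigma> i = restricted_in_row lam (\<phi> \<sigma>) i \<and>
            unrestricted_in_row lam \<sigma> i = unrestricted_in_row lam (\<phi> \<sigma>) i))"
proof -
  note part = assms(1)
  obtain p y s where rule: "\<And>z w u v. distinct [z, w, u, v] \<Longrightarrow>
      Q_S S (enat z) (enat w) (enat u) (enat v) = 1 \<longleftrightarrow>
      chord_rule p y s z w u v \<or> chord_rule p y s w z v u"
    using Q_S_enat[OF assms(2)] by blast
  obtain \<phi> where \<phi>: "bij_betw \<phi> (N_plus lam) (N_plus lam)"
    and prof: "\<And>\<sigma>. \<sigma> \<in> N_plus lam \<Longrightarrow> same_profile lam (\<phi> \<sigma>) \<sigma>"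
    and levels: "\<And>\<sigma> h r. \<sigma> \<in> N_plus lam \<Longrightarrow> 1 \<le> r \<Longrightarrow> r < h \<Longrightarrow>
      level (chord_quad p y s) lam (\<phi> \<sigma>) h r = level arc_quad lam \<sigma> h r"
    by (rule level_conversion[OF part, where p = p and y = y and s = s]) (rule that)
  show ?thesis
  proof (intro exI[of _ \<phi>] conjI ballI allI)
    fix \<sigma> assume \<sigma>: "\<sigma> \<in> N_plus lam"
    then have \<phi>\<sigma>: "\<phi> \<sigma> \<in> N_plus lam" by (rule bij_betw_apply[OF \<phi>])
    note prof = prof[OF \<sigma>]
    show "row_equivalent lam (\<phi> \<sigma>) \<sigma>" by (rule same_profile_row_equivalent[OF \<phi>\<sigma> \<sigma> prof])
    show "same_top_rows lam (\<phi> \<sigma>) \<sigma>" by (rule same_profile_same_top_rows[OF part \<phi>\<sigma> \<sigma> prof])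
    show "c_weight lam \<sigma> q_var t_var = c_weight lam (\<phi> \<sigma>) q_var t_var"
      by (rule same_profile_c_weight[OF part \<phi>\<sigma> \<sigma> prof, symmetric])
    show "restricted_in_row lam \<sigma> i = restricted_in_row lam (\<phi> \<sigma>) i"
      "unrestricted_in_row lam \<sigma> i = unrestricted_in_row lam (\<phi> \<sigma>) i" for i
      by (rule same_profile_restricted_in_row[OF \<phi>\<sigma> \<sigma> prof, symmetric])+
    \<comment> \<open>The boundary rows contribute equally by definition, and the inner levels agree
      by \<open>levels\<close>.\<close>
    have "quad_total (chord_quad p y s) lam (\<phi> \<sigma>) = quad_total arc_quad lam \<sigma>"
      unfolding quad_total_def using levels[OF \<sigma>] by (intro sum.cong refl) auto
    then have "eta S lam (\<phi> \<sigma>) + alpha S lam (\<phi> \<sigma>) = quadcoinv lam \<sigma>"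
      using eta_alpha_quad_total[OF part assms(2) \<phi>\<sigma> rule] Q4_quad_total[OF part \<sigma>]
        same_profile_taller_triples[OF part \<phi>\<sigma> \<sigma> prof] by (simp add: quadcoinv_def)
    then show "(maj lam (\<phi> \<sigma>), eta_circ S lam (\<phi> \<sigma>)) = (maj lam \<sigma>, quadcoinv_bar_star lam \<sigma>)"
      using same_profile_maj[OF prof] top_inv_zero[OF \<sigma>]
      by (simp add: eta_circ_def quadcoinv_bar_star_def quadcoinv_bar_def)
  qed (rule \<phi>)
qed

end
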